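(* Consider the sequence of double-ended queues described in the context, under the standing assumptions. Assume $\mathbb{E}|\bar X^n(0)|\to0$ and that there exists $c\in\mathbb{R}$ with $\sqrt n(\alpha^n-\beta^n)\to c$ as $n\to\infty$. Then the fluid limit (solution of $x(t)=(\alpha-\beta)t-\theta\int_0^tx^+ds+\gamma\int_0^tx^-ds$ with $x(0)=0$) is $x\equiv0$, and if $\hat X^n(0)$ converges weakly to a probability measure $\mu$, then $\hat X^n\Rightarrow\hat X$ in $\mathcal{D}([0,\infty):\mathbb{R})$, where $$\hat X(t)=\hat X(0)+\sqrt{\alpha^3\sigma^2+\beta^3\varsigma^2}\,W(t)+ct-\theta\int_0^t\hat X^+(u)du+\gamma\int_0^t\hat X^-(u)du,\quad t\ge0,$$ $W$ is a standard Brownian motion and $\hat X(0)$ has law $\mu$ and is independent of $W$.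
   Context: Model: for each $n$, independent i.i.d. inter-arrival sequences $\{U^n_k\}$ (sellers, mean $1/\alpha^n$, standard deviation $\sigma^n$) and $\{V^n_k\}$ (buyers, mean $1/\beta^n$, standard deviation $\varsigma^n$), renewal counting processes $N^n_s(t)=\max\{k:\sum_{i\le k}U^n_i\le t\}$, $N^n_b(t)=\max\{k:\sum_{i\le k}V^n_i\le t\}$, independent unit-rate Poisson processes $N^n_{sr},N^n_{br}$, an independent integer initial value $X^n(0)$, rates $\theta^n,\gamma^n>0$, and queue length $X^n(t)=X^n(0)+N^n_s(t)-N^n_b(t)-N^n_{sr}\big(\theta^n\int_0^tX^{n,+}(s)ds\big)+N^n_{br}\big(\gamma^n\int_0^tX^{n,-}(s)ds\big)$, with $a^+=\max\{a,0\}$, $a^-=\max\{0,-a\}$. Standing assumptions: $\mathbb{P}(U^n_1>0)=\mathbb{P}(V^n_1>0)=1$; $\{(U^n_1)^2\}$, $\{(V^n_1)^2\}$ uniformly integrable; $\alpha^n\to\alpha$, $\beta^n\to\beta$, $\sigma^n\to\sigma$, $\varsigma^n\to\varsigma$ with $\alpha,\beta,\sigma,\varsigma\in(0,\infty)$; $n\theta^n\to\theta\in(0,\infty)$, $n\gamma^n\to\gamma\in(0,\infty)$. Scalings: $\bar X^n(t)=X^n(nt)/n$, $\hat X^n(t)=X^n(nt)/\sqrt n$. $\mathcal{D}([0,\infty):\mathbb{R})$ carries the Skorohod $J_1$ topology. *)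

theory Defs
  imports "HOL-Probability.Probability"
begin

definition renewal_count :: "(nat \<Rightarrow> real) \<Rightarrow> real \<Rightarrow> nat" where
  "renewal_count u t = Sup {k. (\<Sum>i\<in>{1..k}. u i) \<le> t}"

definition unit_poisson_process :: "'a measure \<Rightarrow> ('a \<Rightarrow> real \<Rightarrow> nat) \<Rightarrow> bool" where
  "unit_poisson_process M P \<longleftrightarrow> prob_space M \<and>
     (\<forall>t. (\<lambda>\<omega>. P \<omega> t) \<in> measurable M (count_space UNIV)) \<and>
     (AE \<omega> in M. P \<omega> 0 = 0 \<and> mono_on {0..} (P \<omega>) \<and>
        (\<forall>t\<ge>0. ((\<lambda>s. real (P \<omega> s)) \<longlongrightarrow> real (P \<omega> t)) (at_right t))) \<and>
     (\<forall>s t k. 0 \<le> s \<and> s < t \<longrightarrow>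
        measure M {\<omega> \<in> space M. real (P \<omega> t) - real (P \<omega> s) = real k}
          = (t - s) ^ k / fact k * exp (- (t - s))) \<and>
     (\<forall>ts k. 0 \<le> ts 0 \<and> strict_mono (ts :: nat \<Rightarrow> real) \<longrightarrow>
        prob_space.indep_vars M (\<lambda>_. borel)
          (\<lambda>i \<omega>. real (P \<omega> (ts (Suc i))) - real (P \<omega> (ts i))) {..<k})"

definition standard_BM :: "'a measure \<Rightarrow> ('a \<Rightarrow> real \<Rightarrow> real) \<Rightarrow> bool" where
  "standard_BM M W \<longleftrightarrow> prob_space M \<and>
     (\<forall>t. (\<lambda>\<omega>. W \<omega> t) \<in> borel_measurable M) \<and>
     (AE \<omega> in M. W \<omega> 0 = 0 \<and> continuous_on {0..} (W \<omega>)) \<and>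
     (\<forall>s t. 0 \<le> s \<and> s < t \<longrightarrow>
        distributed M lborel (\<lambda>\<omega>. W \<omega> t - W \<omega> s) (normal_density 0 (sqrt (t - s)))) \<and>
     (\<forall>ts k. 0 \<le> ts 0 \<and> strict_mono (ts :: nat \<Rightarrow> real) \<longrightarrow>
        prob_space.indep_vars M (\<lambda>_. borel)
          (\<lambda>i \<omega>. W \<omega> (ts (Suc i)) - W \<omega> (ts i)) {..<k})"

definition cadlag :: "(real \<Rightarrow> real) \<Rightarrow> bool" where
  "cadlag x \<longleftrightarrow> (\<forall>t\<ge>0. (x \<longlongrightarrow> x t) (at_right t)) \<and>
                 (\<forall>t>0. \<exists>l. (x \<longlongrightarrow> l) (at_left t))"

definition time_change :: "(real \<Rightarrow> real) \<Rightarrow> bool" where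
  "time_change lam \<longleftrightarrow> strict_mono_on {0..} lam \<and> continuous_on {0..} lam \<and> lam ` {0..} = {0..}"

(* Convergence in the Skorohod J1 topology on D([0,oo):R) (Billingsley, Thm 16.1) *)
definition J1_conv :: "(nat \<Rightarrow> real \<Rightarrow> real) \<Rightarrow> (real \<Rightarrow> real) \<Rightarrow> bool" where
  "J1_conv xs x \<longleftrightarrow> (\<exists>lam. (\<forall>k. time_change (lam k)) \<and>
     (\<forall>e>0. eventually (\<lambda>k. \<forall>t\<ge>0. \<bar>lam k t - t\<bar> \<le> e) sequentially) \<and>
     (\<forall>T\<ge>0. \<forall>e>0. eventually (\<lambda>k. \<forall>t\<in>{0..T}. \<bar>xs k (lam k t) - x t\<bar> \<le> e) sequentially))"

(* Continuity on D w.r.t. J1 (J1 is metrizable, so sequential continuity) *)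
definition J1_continuous :: "((real \<Rightarrow> real) \<Rightarrow> real) \<Rightarrow> bool" where
  "J1_continuous f \<longleftrightarrow> (\<forall>xs x. cadlag x \<and> (\<forall>k. cadlag (xs k)) \<and> J1_conv xs x
        \<longrightarrow> (\<lambda>k. f (xs k)) \<longlonglongrightarrow> f x)"

definition weak_conv_D :: "(nat \<Rightarrow> 'a measure) \<Rightarrow> (nat \<Rightarrow> 'a \<Rightarrow> real \<Rightarrow> real)
     \<Rightarrow> 'b measure \<Rightarrow> ('b \<Rightarrow> real \<Rightarrow> real) \<Rightarrow> bool" where
  "weak_conv_D M Y N Z \<longleftrightarrow> (\<forall>f. bounded (f ` {x. cadlag x}) \<and> J1_continuous f \<longrightarrow>
     (\<lambda>n. \<integral>\<omega>. f (Y n \<omega>) \<partial>M n) \<longlonglongrightarrow> (\<integral>\<omega>. f (Z \<omega>) \<partial>N))"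

definition gen_sets :: "'a measure \<Rightarrow> ('a \<Rightarrow> 'c) \<Rightarrow> 'c measure \<Rightarrow> 'a set set" where
  "gen_sets M f Mt = sets (vimage_algebra (space M) f Mt)"

end

theory Submission
  imports Defs
begin

text \<open>
  Pathwise, the scaled queue solves \<open>x = w + \<integral> b(x)\<close> with \<open>b(x) = \<gamma> x\<^sup>- - \<theta> x\<^sup>+\<close> up to a small error: a
  renewal count is its mean minus a centred random walk at a deterministic index, and the Poisson
  processes, run at arguments of order \<open>sqrt n\<close>, contribute only their means. A solution is
  approximated by the Euler scheme of step \<open>1/m\<close>, a continuous function of the initial value and the
  increments of the driving path \<open>w\<close> over a grid. These are independent, so the one-dimensional
  central limit theorem for triangular arrays gives their joint convergence as \<open>n \<rightarrow> \<infinity>\<close> for fixed \<open>m\<close>;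
  Ottaviani's inequality bounds the error of the scheme uniformly in \<open>n\<close>. A bounded J1-continuous
  functional is, at continuous paths, the limit of Lipschitz envelopes for the uniform norm, which
  transfers the convergence without a tightness argument in the Skorohod space.
\<close>

section \<open>Cadlag paths and Gronwall's inequality\<close>

text \<open>Three obstacles shape the argument. The departure processes are run at arguments that
  are integrals of the queue itself, and a Poisson path is close to its mean only on a range fixed
  in advance; the bound on the queue that keeps the arguments in this range needs the very closeness
  it should provide. A crossing argument in \<open>queue_path_bound\<close> breaks this circle.
  Next, a renewal count is a walk read at a random index, so its increments over disjoint time
  intervals are not independent; reading the walk at a deterministic index makes them so, at the
  price of a modulus of continuity for the walk. Finally, the steps have only two moments, which is
  too little for a union bound over many short blocks; a fourth-order tail bound is therefore
  borrowed from the Gaussian limit. The diffusion coefficient has a simple origin: the centred step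
  \<open>\<alpha>n n * U n i \<omega> - 1\<close> has variance close to
  \<open>(\<alpha> * \<sigma>)\<^sup>2\<close>, and about \<open>\<alpha> * n * t\<close> steps
  occur by time \<open>n * t\<close>, whence \<open>\<alpha> ^ 3 * \<sigma>\<^sup>2\<close>;
  likewise for the buyers.\<close>

lemma cadlag_at_right:
  assumes "cadlag f" "0 \<le> x" "0 < e"
  obtains d where "d > 0" "\<And>t. x \<le> t \<Longrightarrow> t < x + d \<Longrightarrow> \<bar>f t - f x\<bar> < e"
proof -
  have "(f \<longlongrightarrow> f x) (at_right x)" using assms unfolding cadlag_def by auto
  from tendstoD[OF this \<open>0 < e\<close>] obtain b where "b > x" "\<And>t. x < t \<Longrightarrow> t < b \<Longrightarrow> dist (f t) (f x) < e"
    unfolding eventually_at_right_field by blast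
  then show ?thesis using that[of "b - x"] assms(3)
    by (auto simp: dist_real_def) (metis abs_zero add.commute diff_add_cancel eq_iff_diff_eq_0 le_less)
qed

lemma cadlag_at_left:
  assumes "cadlag f" "0 < x" "0 < e"
  obtains l d where "d > 0" "d \<le> x" "\<And>t. x - d < t \<Longrightarrow> t < x \<Longrightarrow> \<bar>f t - l\<bar> < e"
proof -
  obtain l where "(f \<longlongrightarrow> l) (at_left x)" using assms unfolding cadlag_def by auto
  from tendstoD[OF this \<open>0 < e\<close>] obtain b where b: "b < x" "\<And>t. b < t \<Longrightarrow> t < x \<Longrightarrow> dist (f t) l < e"
    unfolding eventually_at_left_field by blast
  show ?thesis using that[of "min x (x - b)" l] b assms(2)
    by (auto simp: dist_real_def min_def split: if_splits)
qed

lemma cadlag_continuous_on: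
  assumes "continuous_on {0..} f"
  shows "cadlag f"
  unfolding cadlag_def
proof (intro conjI allI impI)
  fix t :: real assume t: "t \<ge> 0"
  have "(f \<longlongrightarrow> f t) (at t within {0..})" using assms t by (auto simp: continuous_on_def)
  then show "(f \<longlongrightarrow> f t) (at_right t)" by (rule tendsto_within_subset) (use t in auto)
next
  fix t :: real assume t: "t > 0"
  have "(f \<longlongrightarrow> f t) (at t within {0..})" using assms t by (auto simp: continuous_on_def)
  then have "(f \<longlongrightarrow> f t) (at t within {0..<t})" by (rule tendsto_within_subset) auto
  moreover have "at t within {0..<t} = at_left t"
    using t by (intro at_within_nhd[where S="{0<..}"]) auto
  ultimately show "\<exists>l. (f \<longlongrightarrow> l) (at_left t)" by auto
qed

lemma cadlag_compose:
  assumes "cadlag f" "continuous_on UNIV g"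
  shows "cadlag (\<lambda>t. g (f t))"
proof -
  have "(g \<longlongrightarrow> g y) (nhds y)" for y
    using assms(2) by (simp add: continuous_on_eq_continuous_at isCont_def tendsto_at_iff_tendsto_nhds)
  then have "((\<lambda>t. g (f t)) \<longlongrightarrow> g y) F" if "(f \<longlongrightarrow> y) F" for y F
    using that by (rule filterlim_compose)
  then show ?thesis using assms(1) unfolding cadlag_def by blast
qed

lemma cadlag_diff: "cadlag f \<Longrightarrow> cadlag g \<Longrightarrow> cadlag (\<lambda>t. f t - g t)"
  unfolding cadlag_def by (blast intro: tendsto_diff)

text \<open>Bisection in the form of \<open>Bolzano\<close>: approximability on two adjoining
  intervals gives it on their union, and near any point the one-sided limits provide a two-valued
  step function. Boundedness of \<open>g\<close> is carried along because it later yields a bound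
  for \<open>f\<close> itself.\<close>

lemma cadlag_approx_integrable:
  assumes f: "cadlag f" and e: "0 < e" and "0 \<le> a" "a \<le> b"
  obtains g where "g integrable_on {a..b}" "\<And>t. t \<in> {a..b} \<Longrightarrow> \<bar>f t - g t\<bar> \<le> e" "bounded (g ` {a..b})"
proof -
  let ?P = "\<lambda>a b. 0 \<le> a \<longrightarrow> (\<exists>g. g integrable_on {a..b} \<and> (\<forall>t\<in>{a..b}. \<bar>f t - g t\<bar> \<le> e) \<and> bounded (g ` {a..b}))"
  have "?P a b"
  proof (rule Bolzano[OF \<open>a \<le> b\<close>, where P = ?P])
    fix a b c :: real assume P: "?P a b" "?P b c" and le: "a \<le> b" "b \<le> c"
    show "?P a c"
    proof
      assume a0: "0 \<le> a"
      from P a0 le obtain g h where g: "g integrable_on {a..b}" "\<forall>t\<in>{a..b}. \<bar>f t - g t\<bar> \<le> e" "bounded (g ` {a..b})"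
        and h: "h integrable_on {b..c}" "\<forall>t\<in>{b..c}. \<bar>f t - h t\<bar> \<le> e" "bounded (h ` {b..c})" by auto
      let ?k = "\<lambda>t. if t \<le> b then g t else h t"
      have "?k integrable_on {a..b}" by (rule integrable_eq[OF g(1)]) auto
      \<comment> \<open>On \<open>{b..c}\<close> the functions \<open>?k\<close> and
        \<open>h\<close> can differ only at \<open>b\<close>.\<close>
      moreover have "?k integrable_on {b..c}"
        by (rule integrable_spike[OF h(1), of "{b}"]) auto
      ultimately have "?k integrable_on {a..c}" using Henstock_Kurzweil_Integration.integrable_combine[OF le] by blast
      moreover have "\<forall>t\<in>{a..c}. \<bar>f t - ?k t\<bar> \<le> e" using g h by auto
      moreover have "bounded (?k ` {a..c})"
        by (rule bounded_subset[OF bounded_Un[THEN iffD2, OF conjI[OF g(3) h(3)]]]) auto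
      ultimately show "\<exists>g. g integrable_on {a..c} \<and> (\<forall>t\<in>{a..c}. \<bar>f t - g t\<bar> \<le> e) \<and> bounded (g ` {a..c})" by blast
    qed
  next
    fix x :: real assume x: "a \<le> x" "x \<le> b"
    then have x0: "0 \<le> x" using assms by simp
    obtain d1 where d1: "d1 > 0" "\<And>t. x \<le> t \<Longrightarrow> t < x + d1 \<Longrightarrow> \<bar>f t - f x\<bar> < e"
      using cadlag_at_right[OF f x0 e] by blast
    \<comment> \<open>At \<open>x = 0\<close> no left limit is available, but no
      \<open>t \<ge> 0\<close> lies to the left either, so any \<open>l\<close> serves.\<close>
    have "\<exists>l d. d > 0 \<and> (\<forall>t\<ge>0. x - d < t \<longrightarrow> t < x \<longrightarrow> \<bar>f t - l\<bar> < e)"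
    proof (cases "x = 0")
      case True then show ?thesis by (auto intro: exI[of _ 1])
    next
      case False then show ?thesis using cadlag_at_left[OF f _ e, of x] x0 by (metis le_less)
    qed
    then obtain l d2 where d2: "d2 > 0" "\<And>t. 0 \<le> t \<Longrightarrow> x - d2 < t \<Longrightarrow> t < x \<Longrightarrow> \<bar>f t - l\<bar> < e" by blast
    show "\<exists>d>0. \<forall>a b. a \<le> x \<and> x \<le> b \<and> b - a < d \<longrightarrow> ?P a b"
    proof (intro exI[of _ "min d1 d2"] conjI allI impI)
      fix c k :: real assume ck: "c \<le> x \<and> x \<le> k \<and> k - c < min d1 d2" and c0: "0 \<le> c"
      let ?k = "\<lambda>t. if t < x then l else f x"
      have "?k integrable_on {c..x}" by (rule integrable_spike[of "\<lambda>_. l" _ "{x}"]) auto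
      moreover have "?k integrable_on {x..k}" by (rule integrable_eq[of "\<lambda>_. f x"]) auto
      ultimately have "?k integrable_on {c..k}" using Henstock_Kurzweil_Integration.integrable_combine[of c x k ?k] ck by blast
      moreover have "\<forall>t\<in>{c..k}. \<bar>f t - ?k t\<bar> \<le> e" using d1(2) d2(2) ck c0 by (auto intro!: less_imp_le)
      moreover have "bounded (?k ` {c..k})" by (rule bounded_subset[of "{l, f x}"]) auto
      ultimately show "\<exists>g. g integrable_on {c..k} \<and> (\<forall>t\<in>{c..k}. \<bar>f t - g t\<bar> \<le> e) \<and> bounded (g ` {c..k})" by blast
    qed (use d1 d2 in auto)
  qed
  then show ?thesis using that assms by blast
qed

lemma cadlag_integrable:
  assumes "cadlag f" "0 \<le> a"
  shows "f integrable_on {a..b}"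
proof (cases "a \<le> b")
  case True
  have "f integrable_on cbox a b"
  proof (rule integrable_uniform_limit)
    fix e :: real assume "e > 0"
    from cadlag_approx_integrable[OF assms(1) this assms(2) True]
    show "\<exists>g. (\<forall>x\<in>cbox a b. norm (f x - g x) \<le> e) \<and> g integrable_on cbox a b" by (metis cbox_interval real_norm_def)
  qed
  then show ?thesis by simp
qed auto

lemma cadlag_bounded:
  assumes "cadlag f"
  obtains B where "0 \<le> B" "\<And>t. t \<in> {0..T} \<Longrightarrow> \<bar>f t\<bar> \<le> B"
proof (cases "0 \<le> T")
  case True
  obtain g where g: "\<And>t. t \<in> {0..T} \<Longrightarrow> \<bar>f t - g t\<bar> \<le> 1" "bounded (g ` {0..T})"
    using cadlag_approx_integrable[OF assms, of 1 0 T] True by auto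
  from g(2) obtain B where "\<And>t. t \<in> {0..T} \<Longrightarrow> \<bar>g t\<bar> \<le> B" unfolding bounded_iff by fastforce
  with g(1) have "\<bar>f t\<bar> \<le> \<bar>B\<bar> + 1" if "t \<in> {0..T}" for t
    using that by (smt (verit))
  then show ?thesis using that[of "\<bar>B\<bar> + 1"] by auto
next
  case False
  show ?thesis by (rule that[of 0]) (use False in auto)
qed

text \<open>The weight \<open>exp (2 L t)\<close> makes the integral operator a contraction with factor \<open>1/2\<close>,
  so no iteration is needed.\<close>

lemma gronwall_cadlag:
  fixes g :: "real \<Rightarrow> real"
  assumes g: "cadlag g" and nonneg: "\<And>t. t \<in> {0..T} \<Longrightarrow> 0 \<le> g t" and L: "0 < L" and a: "0 \<le> a"
    and bd: "\<And>t. t \<in> {0..T} \<Longrightarrow> g t \<le> a + L * integral {0..t} g" and t: "t \<in> {0..T}"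
  shows "g t \<le> 2 * a * exp (2 * L * T)"
proof -
  define h where "h t = g t * exp (- 2 * L * t)" for t
  define B where "B = (SUP s\<in>{0..T}. h s)"
  obtain C where C: "0 \<le> C" "\<And>t. t \<in> {0..T} \<Longrightarrow> \<bar>g t\<bar> \<le> C" using cadlag_bounded[OF g] by blast
  \<comment> \<open>Finiteness of the supremum \<open>B\<close> is what allows
    \<open>B \<le> a + B / 2\<close> to be solved for \<open>B\<close> below.\<close>
  have "h s \<le> C" if "s \<in> {0..T}" for s
  proof -
    have "h s \<le> \<bar>g s\<bar> * 1" unfolding h_def using that L by (intro mult_mono) auto
    then show ?thesis using C(2)[OF that] by simp
  qed
  then have bdd: "bdd_above (h ` {0..T})" by (intro bdd_aboveI2[where M=C])
  have hB: "h s \<le> B" if "s \<in> {0..T}" for s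
    unfolding B_def using that bdd by (intro cSUP_upper)
  have ne: "{0..T} \<noteq> {}" using t by auto
  have gB: "g s \<le> B * exp (2 * L * s)" if "s \<in> {0..T}" for s
    using hB[OF that] unfolding h_def by (simp add: exp_minus field_simps)
  have B0: "0 \<le> B"
  proof -
    have "0 \<le> h t" using nonneg[OF t] by (simp add: h_def)
    then show ?thesis using hB[OF t] by simp
  qed
  have "h s \<le> a + B / 2" if s: "s \<in> {0..T}" for s
  proof -
    have int: "((\<lambda>u. B * exp (2 * L * u)) has_integral B / (2 * L) * exp (2 * L * s) - B / (2 * L) * exp (2 * L * 0)) {0..s}"
      using s L by (intro fundamental_theorem_of_calculus)
        (auto intro!: derivative_eq_intros simp: has_real_derivative_iff_has_vector_derivative[symmetric])
    have "g s \<le> a + L * integral {0..s} g" using bd[OF s] .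
    also have "integral {0..s} g \<le> integral {0..s} (\<lambda>u. B * exp (2 * L * u))"
      using s int by (intro integral_le cadlag_integrable[OF g] gB) auto
    also have "\<dots> = B / (2 * L) * (exp (2 * L * s) - 1)"
      using integral_unique[OF int] by (simp add: algebra_simps)
    also have "a + L * \<dots> \<le> a + B / 2 * exp (2 * L * s)" using L B0 by (simp add: field_simps)
    finally have "g s \<le> a + B / 2 * exp (2 * L * s)" using L by simp
    then have "h s \<le> (a + B / 2 * exp (2 * L * s)) * exp (- 2 * L * s)"
      unfolding h_def by (intro mult_right_mono) auto
    also have "\<dots> = a * exp (- 2 * L * s) + B / 2" by (simp add: algebra_simps flip: exp_add)
    also have "a * exp (- 2 * L * s) \<le> a * 1" using a L s by (intro mult_left_mono) auto
    finally show ?thesis by simp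
  qed
  then have "B \<le> a + B / 2" unfolding B_def using ne by (intro cSUP_least) auto
  then have "B \<le> 2 * a" by simp
  have "g t \<le> B * exp (2 * L * t)" using gB t by auto
  also have "\<dots> \<le> 2 * a * exp (2 * L * T)" using \<open>B \<le> 2 * a\<close> B0 L t by (intro mult_mono) auto
  finally show ?thesis .
qed

section \<open>The Euler scheme\<close>

text \<open>Euler scheme of step \<open>1/m\<close> for \<open>x = w + \<integral> b(x)\<close>; \<open>v 0\<close> is the initial value and
  \<open>v (Suc k)\<close> the increment of the driving path over the \<open>k\<close>-th step.\<close>

fun euler :: "(real \<Rightarrow> real) \<Rightarrow> nat \<Rightarrow> (nat \<Rightarrow> real) \<Rightarrow> nat \<Rightarrow> real" where
  "euler b m v 0 = v 0"
| "euler b m v (Suc k) = euler b m v k + v (Suc k) + b (euler b m v k) / real m"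

definition euler_path :: "(real \<Rightarrow> real) \<Rightarrow> nat \<Rightarrow> (nat \<Rightarrow> real) \<Rightarrow> real \<Rightarrow> real" where
  "euler_path b m v t = euler b m v (nat \<lfloor>real m * t\<rfloor>)"

lemma nat_floor_mult_eq_iff:
  assumes "0 < m"
  shows "(real k / real m \<le> t \<and> t < real (Suc k) / real m) \<longleftrightarrow> (0 \<le> t \<and> nat \<lfloor>real m * t\<rfloor> = k)"
proof
  assume *: "real k / real m \<le> t \<and> t < real (Suc k) / real m"
  then have "real k \<le> real m * t" "real m * t < real k + 1" using assms by (auto simp: field_simps)
  moreover have "0 \<le> t" using * assms by (meson divide_nonneg_pos of_nat_0_le_iff of_nat_0_less_iff order_trans)
  ultimately show "0 \<le> t \<and> nat \<lfloor>real m * t\<rfloor> = k" by (auto intro: floor_unique simp: nat_eq_iff floor_eq_iff)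
next
  assume "0 \<le> t \<and> nat \<lfloor>real m * t\<rfloor> = k"
  then have "\<lfloor>real m * t\<rfloor> = int k" "0 \<le> t" using assms by auto
  then have "real k \<le> real m * t" "real m * t < real k + 1" by (auto simp: floor_eq_iff)
  then show "real k / real m \<le> t \<and> t < real (Suc k) / real m" using assms by (auto simp: field_simps)
qed

lemma grid_point_bounds:
  assumes "0 < m" "0 \<le> t" and k: "k = nat \<lfloor>real m * t\<rfloor>"
  shows "real k / real m \<le> t" "t < real k / real m + 1 / real m"
  using nat_floor_mult_eq_iff[OF assms(1), of k t] assms by (auto simp: add_divide_distrib add.commute)

lemma cadlag_grid_step:
  assumes m: "0 < m"
  shows "cadlag (\<lambda>t. c (nat \<lfloor>real m * t\<rfloor>) :: real)"
  unfolding cadlag_def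
proof (intro conjI allI impI)
  fix t :: real assume t: "0 \<le> t"
  define k where "k = nat \<lfloor>real m * t\<rfloor>"
  have b: "real k / real m \<le> t" "t < real (Suc k) / real m"
    using nat_floor_mult_eq_iff[OF m, of k t] t k_def by auto
  have "eventually (\<lambda>s. c (nat \<lfloor>real m * s\<rfloor>) = c k) (at_right t)"
    unfolding eventually_at_right_field
    using b nat_floor_mult_eq_iff[OF m, of k] by (intro exI[of _ "real (Suc k) / real m"]) (metis less_imp_le order_trans)
  then show "((\<lambda>t. c (nat \<lfloor>real m * t\<rfloor>)) \<longlongrightarrow> c (nat \<lfloor>real m * t\<rfloor>)) (at_right t)"
    unfolding k_def[symmetric] by (rule tendsto_eventually)
next
  fix t :: real assume t: "0 < t"
  \<comment> \<open>At a grid point the left limit belongs to the preceding cell, hence the ceiling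
    minus one instead of the floor.\<close>
  define k where "k = nat (\<lceil>real m * t\<rceil> - 1)"
  have "0 < real m * t" using m t by simp
  then have "1 \<le> \<lceil>real m * t\<rceil>" by (simp add: less_ceiling_iff add1_zle_eq[symmetric] del: add1_zle_eq)
  then have "real k = of_int \<lceil>real m * t\<rceil> - 1" unfolding k_def by simp
  then have "real k < real m * t" "real m * t \<le> real k + 1" by linarith+
  then have b: "real k / real m < t" "t \<le> real (Suc k) / real m" using m by (auto simp: field_simps)
  have "eventually (\<lambda>s. c (nat \<lfloor>real m * s\<rfloor>) = c k) (at_left t)"
    unfolding eventually_at_left_field
    using b nat_floor_mult_eq_iff[OF m, of k] by (intro exI[of _ "real k / real m"]) (metis less_imp_le less_le_trans)
  then show "\<exists>l. ((\<lambda>t. c (nat \<lfloor>real m * t\<rfloor>)) \<longlongrightarrow> l) (at_left t)"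
    by (intro exI[of _ "c k"] tendsto_eventually)
qed

lemma cadlag_euler_path: "0 < m \<Longrightarrow> cadlag (euler_path b m v)"
  unfolding euler_path_def by (rule cadlag_grid_step)

lemma lipschitz_continuous_real:
  fixes b :: "real \<Rightarrow> real"
  assumes "\<And>x y. \<bar>b x - b y\<bar> \<le> L * \<bar>x - y\<bar>"
  shows "continuous_on UNIV b"
proof -
  have "0 \<le> L" using assms[of 1 0] by simp
  then have "L-lipschitz_on UNIV b" using assms by (auto intro!: lipschitz_onI simp: dist_real_def)
  then show ?thesis by (rule lipschitz_on_continuous_on)
qed

text \<open>The path is frozen on each cell, so the drift integral over a full cell is exactly one
  Euler step. At grid points the scheme thus solves the integral equation without error, the form in
  which it can be compared with a solution.\<close>

lemma euler_integral:
  assumes m: "0 < m" and b: "continuous_on UNIV b"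
  shows "euler b m v k = (\<Sum>i\<le>k. v i) + integral {0..real k / real m} (\<lambda>s. b (euler_path b m v s))"
proof (induction k)
  case (Suc k)
  let ?g = "\<lambda>s. b (euler_path b m v s)"
  have int: "?g integrable_on {0..u}" for u
    using cadlag_integrable[OF cadlag_compose[OF cadlag_euler_path[OF m] b]] by auto
  have "integral {0..real (Suc k) / real m} ?g
     = integral {0..real k / real m} ?g + integral {real k / real m..real (Suc k) / real m} ?g"
    using m by (intro Henstock_Kurzweil_Integration.integral_combine[symmetric] int) (auto simp: divide_right_mono)
  also have "integral {real k / real m..real (Suc k) / real m} ?g
     = integral {real k / real m..real (Suc k) / real m} (\<lambda>_. b (euler b m v k))"
  \<comment> \<open>Cells are half open: only at the right endpoint may the path have moved to its
    next value.\<close>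
  proof (rule integral_spike[of "{real (Suc k) / real m}"])
    fix t assume "t \<in> {real k / real m..real (Suc k) / real m} - {real (Suc k) / real m}"
    then have "nat \<lfloor>real m * t\<rfloor> = k" using nat_floor_mult_eq_iff[OF m, of k t] by auto
    then show "b (euler b m v k) = ?g t" by (simp add: euler_path_def)
  qed auto
  also have "\<dots> = b (euler b m v k) / real m"
    by (simp add: add_divide_distrib divide_right_mono)
  finally show ?case using Suc by simp
qed simp

text \<open>At the last grid point \<open>q\<close> before a time \<open>s\<close> the scheme solves
  its equation exactly, so three defects remain: \<open>e1\<close> in the equation for
  \<open>x\<close>, \<open>e2\<close> from moving \<open>w\<close> from \<open>q\<close> to
  \<open>s\<close>, and \<open>L * R / m\<close> from the drift over the unfinished cell. Gronwall
  turns their sum into the bound. Boundedness is asked of \<open>x\<close> alone, so nothing has to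
  be known beforehand about the size of the scheme.\<close>

lemma euler_path_close:
  fixes x w b :: "real \<Rightarrow> real"
  assumes x: "cadlag x" and m: "0 < m" and L: "0 < L"
    and lip: "\<And>x y. \<bar>b x - b y\<bar> \<le> L * \<bar>x - y\<bar>" and b0: "b 0 = 0" and R: "\<And>t. t \<in> {0..T} \<Longrightarrow> \<bar>x t\<bar> \<le> R"
    and eq: "\<And>t. t \<in> {0..T} \<Longrightarrow> \<bar>x t - w t - integral {0..t} (\<lambda>s. b (x s))\<bar> \<le> e1"
    and osc: "\<And>t. t \<in> {0..T} \<Longrightarrow> \<bar>w t - w (real (nat \<lfloor>real m * t\<rfloor>) / real m)\<bar> \<le> e2"
    and v: "\<And>k. real k / real m \<le> T \<Longrightarrow> w (real k / real m) = (\<Sum>i\<le>k. v i)"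
    and t: "t \<in> {0..T}"
  shows "\<bar>x t - euler_path b m v t\<bar> \<le> 2 * (e1 + e2 + L * R / m) * exp (2 * L * T)"
proof -
  let ?y = "euler_path b m v"
  let ?g = "\<lambda>t. \<bar>x t - ?y t\<bar>"
  have b: "continuous_on UNIV b" using lip by (rule lipschitz_continuous_real)
  have y: "cadlag ?y" using m by (rule cadlag_euler_path)
  have g: "cadlag ?g" by (rule cadlag_compose[OF cadlag_diff[OF x y], of abs]) (intro continuous_intros)
  have R0: "0 \<le> R" and e1: "0 \<le> e1" and e2: "0 \<le> e2" using R[of 0] eq[of 0] osc[of 0] t by auto
  have bx: "cadlag (\<lambda>s. b (x s))" and by': "cadlag (\<lambda>s. b (?y s))"
    using cadlag_compose[OF x b] cadlag_compose[OF y b] by auto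
  have Lg: "cadlag (\<lambda>u. L * ?g u)"
    using cadlag_compose[OF g, of "\<lambda>z. L * z"] by (auto intro: continuous_intros)
  have "?g s \<le> (e1 + e2 + L * R / m) + L * integral {0..s} ?g" if s: "s \<in> {0..T}" for s
  proof -
    define k where "k = nat \<lfloor>real m * s\<rfloor>"
    define q where "q = real k / real m"
    have q: "0 \<le> q" "q \<le> s" "s < q + 1 / m" using grid_point_bounds[OF m _ k_def] s by (auto simp: q_def)
    have ys: "?y s = w q + integral {0..q} (\<lambda>u. b (?y u))"
      unfolding euler_path_def[of _ _ _ s] k_def[symmetric] euler_integral[OF m b]
      using v[of k] q s by (simp add: q_def)
    have split: "integral {0..s} (\<lambda>u. b (x u)) = integral {0..q} (\<lambda>u. b (x u)) + integral {q..s} (\<lambda>u. b (x u))"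
      using q by (intro Henstock_Kurzweil_Integration.integral_combine[symmetric] cadlag_integrable bx) auto
    have i1: "\<bar>integral {q..s} (\<lambda>u. b (x u))\<bar> \<le> (L * R) * (s - q)"
    proof -
      have "norm (integral {q..s} (\<lambda>u. b (x u))) \<le> integral {q..s} (\<lambda>_. L * R)"
      proof (rule integral_norm_bound_integral)
        fix u assume u: "u \<in> {q..s}"
        have "\<bar>b (x u)\<bar> \<le> L * \<bar>x u\<bar>" using lip[of "x u" 0] b0 by simp
        also have "\<dots> \<le> L * R" using R[of u] u q s L by (intro mult_left_mono) auto
        finally show "norm (b (x u)) \<le> L * R" by simp
      qed (use cadlag_integrable[OF bx q(1)] in auto)
      also have "\<dots> = (L * R) * (s - q)" using q by simp
      finally have "norm (integral {q..s} (\<lambda>u. b (x u))) \<le> (L * R) * (s - q)" .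
      then show ?thesis by simp
    qed
    also have "\<dots> \<le> L * R * (1 / m)" using q L R0 by (intro mult_left_mono) auto
    finally have i1: "\<bar>integral {q..s} (\<lambda>u. b (x u))\<bar> \<le> L * R / m" by simp
    have "\<bar>integral {0..q} (\<lambda>u. b (x u)) - integral {0..q} (\<lambda>u. b (?y u))\<bar>
        = norm (integral {0..q} (\<lambda>u. b (x u) - b (?y u)))"
      using bx by' by (subst integral_diff) (auto intro!: cadlag_integrable)
    also have "\<dots> \<le> integral {0..q} (\<lambda>u. L * ?g u)"
      using lip by (intro integral_norm_bound_integral cadlag_integrable cadlag_diff bx by' Lg) auto
    also have "\<dots> \<le> integral {0..s} (\<lambda>u. L * ?g u)"
      using q L by (intro integral_subset_le cadlag_integrable Lg) auto
    also have "\<dots> = L * integral {0..s} ?g" by simp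
    finally have i2: "\<bar>integral {0..q} (\<lambda>u. b (x u)) - integral {0..q} (\<lambda>u. b (?y u))\<bar> \<le> L * integral {0..s} ?g" .
    have "\<bar>w s - w q\<bar> \<le> e2" using osc[OF s] by (simp add: q_def k_def)
    with eq[OF s] i1 i2 split show ?thesis unfolding ys by (smt (verit))
  qed
  from gronwall_cadlag[OF g _ L _ this t] show ?thesis using e1 e2 L R0 by simp
qed

section \<open>Pathwise bounds for the queue and for renewal counts\<close>

text \<open>The paths \<open>p1\<close>, \<open>p2\<close> are controlled only for arguments up to
  \<open>C * r\<close>, while the arguments \<open>h1\<close>, \<open>h2\<close> grow with the
  queue. If one of them exceeded \<open>C * r\<close>, the larger would equal \<open>C * r\<close>
  at some time \<open>a\<close> by continuity; up to \<open>a\<close> the control is valid, Gronwall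
  gives the bound \<open>R\<close>, and so the argument at \<open>a\<close> is at most
  \<open>r * (L * (R * T))\<close>, which is less than \<open>C * r\<close>.\<close>

lemma queue_path_bound:
  fixes x u p1 p2 h1 h2 :: "real \<Rightarrow> real"
  assumes x: "cadlag x" and r: "0 < r" and th: "0 \<le> th" and ga: "0 \<le> ga" and L: "0 < L" "th + ga \<le> L"
    and h1: "\<And>t. t \<in> {0..T} \<Longrightarrow> h1 t = r * (th * integral {0..t} (\<lambda>s. max (x s) 0))"
    and h2: "\<And>t. t \<in> {0..T} \<Longrightarrow> h2 t = r * (ga * integral {0..t} (\<lambda>s. max (- x s) 0))"
    and eq: "\<And>t. t \<in> {0..T} \<Longrightarrow> x t = u t - p1 (h1 t) / r + p2 (h2 t) / r"
    and u: "\<And>t. t \<in> {0..T} \<Longrightarrow> \<bar>u t\<bar> \<le> R0"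
    and R: "R = 2 * (R0 + 2 * e) * exp (2 * L * T)" and C: "L * T * R < C" and e: "0 \<le> e"
    and p1: "\<And>y. 0 \<le> y \<Longrightarrow> y \<le> C * r \<Longrightarrow> \<bar>p1 y - y\<bar> \<le> e * r"
    and p2: "\<And>y. 0 \<le> y \<Longrightarrow> y \<le> C * r \<Longrightarrow> \<bar>p2 y - y\<bar> \<le> e * r"
    and t: "t \<in> {0..T}"
  shows "\<bar>x t\<bar> \<le> R"
    and "\<bar>x t - u t + th * integral {0..t} (\<lambda>s. max (x s) 0) - ga * integral {0..t} (\<lambda>s. max (- x s) 0)\<bar> \<le> 2 * e"
proof -
  let ?xp = "\<lambda>s. max (x s) 0" and ?xm = "\<lambda>s. max (- x s) 0" and ?xa = "\<lambda>s. \<bar>x s\<bar>"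
  have cp: "cadlag ?xp" and cm: "cadlag ?xm" and ca: "cadlag ?xa"
    by (rule cadlag_compose[OF x, of "\<lambda>z. max z 0"], intro continuous_intros)
      (rule cadlag_compose[OF x, of "\<lambda>z. max (- z) 0"], intro continuous_intros,
       rule cadlag_compose[OF x, of abs], intro continuous_intros)
  define P where "P s = integral {0..s} ?xp" for s
  define Q where "Q s = integral {0..s} ?xm" for s
  note int = cadlag_integrable[OF cp] cadlag_integrable[OF cm] cadlag_integrable[OF ca]
  have P0: "0 \<le> P s" and Q0: "0 \<le> Q s" for s
    unfolding P_def Q_def by (intro integral_nonneg int; simp)+
  have PQ: "P s + Q s = integral {0..s} ?xa" for s
    unfolding P_def Q_def
    by (subst integral_add[symmetric]) (auto intro!: int Henstock_Kurzweil_Integration.integral_cong)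
  have mono: "P a \<le> P c" "Q a \<le> Q c" if "a \<le> c" for a c
    unfolding P_def Q_def using that by (auto intro!: integral_subset_le int)
  have R0': "0 \<le> R0" using u[of 0] t by auto
  have hP: "h1 s = r * (th * P s)" "h2 s = r * (ga * Q s)" if "s \<in> {0..T}" for s
    using h1[OF that] h2[OF that] by (auto simp: P_def Q_def)
  have dev: "\<bar>x s - u s + th * P s - ga * Q s\<bar> \<le> 2 * e" if s: "s \<in> {0..T}" "h1 s \<le> C * r" "h2 s \<le> C * r" for s
  proof -
    have n: "0 \<le> h1 s" "0 \<le> h2 s" using hP[OF s(1)] P0 Q0 th ga r by auto
    have "x s - u s + th * P s - ga * Q s = (p2 (h2 s) - h2 s) / r - (p1 (h1 s) - h1 s) / r"
    proof -
      have "th * P s = h1 s / r" "ga * Q s = h2 s / r" using hP[OF s(1)] r by auto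
      then show ?thesis using eq[OF s(1)] by (simp add: diff_divide_distrib)
    qed
    also have "\<bar>\<dots>\<bar> \<le> \<bar>p2 (h2 s) - h2 s\<bar> / r + \<bar>p1 (h1 s) - h1 s\<bar> / r"
      using r by (auto intro: order_trans[OF abs_triangle_ineq4])
    also have "\<dots> \<le> e + e" using p1[OF n(1) s(2)] p2[OF n(2) s(3)] r by (intro add_mono) (auto simp: field_simps)
    finally show ?thesis by simp
  qed
  \<comment> \<open>The horizon \<open>S\<close> is kept free: it is the crossing time inside the
    contradiction and \<open>T\<close> afterwards.\<close>
  have bound: "\<bar>x s\<bar> \<le> 2 * (R0 + 2 * e) * exp (2 * L * S)"
    if S: "S \<le> T" "\<And>a. a \<in> {0..S} \<Longrightarrow> h1 a \<le> C * r \<and> h2 a \<le> C * r" and s: "s \<in> {0..S}" for s S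
  proof (rule gronwall_cadlag[OF ca, where T = S and L = L])
    fix a assume a: "a \<in> {0..S}"
    then have a': "a \<in> {0..T}" using S by auto
    have "\<bar>x a\<bar> \<le> R0 + 2 * e + \<bar>th * P a - ga * Q a\<bar>"
      using dev[OF a'] S(2)[OF a] u[OF a'] by linarith
    also have "\<bar>th * P a - ga * Q a\<bar> \<le> th * P a + ga * Q a"
      using mult_nonneg_nonneg[OF th P0[of a]] mult_nonneg_nonneg[OF ga Q0[of a]] by linarith
    also have "\<dots> \<le> L * P a + L * Q a"
      using th ga L P0 Q0 by (intro add_mono mult_right_mono) auto
    also have "\<dots> = L * integral {0..a} ?xa" unfolding PQ[symmetric] by (simp add: algebra_simps)
    finally show "\<bar>x a\<bar> \<le> R0 + 2 * e + L * integral {0..a} ?xa" by simp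
  qed (use L s R0' e in auto)
  have R_nonneg: "0 \<le> R" unfolding R using R0' e by simp
  have H: "h1 s \<le> C * r \<and> h2 s \<le> C * r" if s: "s \<in> {0..T}" for s
  proof (rule ccontr)
    define H where "H s = max (r * (th * P s)) (r * (ga * Q s))" for s
    assume "\<not> ?thesis"
    then have gt: "C * r < H s" using hP[OF s] by (auto simp: H_def)
    have T0: "0 \<le> T" using s by auto
    have "0 \<le> L * T * R" using L T0 R_nonneg by auto
    then have C0: "0 < C" using C by linarith
    have cont: "continuous_on {0..s} H"
      unfolding H_def P_def Q_def
      by (intro continuous_intros indefinite_integral_continuous_1 int) auto
    have H0: "H 0 = 0" by (simp add: H_def P_def Q_def)
    obtain a where a: "0 \<le> a" "a \<le> s" "H a = C * r"
      using IVT'[of H 0 "C * r" s] gt H0 cont s C0 r by (auto intro: less_imp_le)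
    have aT: "a \<le> T" using a s by auto
    \<comment> \<open>The crossing time need not be the first one: \<open>P\<close> and
      \<open>Q\<close> are monotone, so both arguments stay below \<open>C * r\<close> on all of
      \<open>{0..a}\<close>.\<close>
    have small: "h1 c \<le> C * r \<and> h2 c \<le> C * r" if c: "c \<in> {0..a}" for c
    proof -
      have "r * (th * P c) \<le> r * (th * P a)" "r * (ga * Q c) \<le> r * (ga * Q a)"
        using c r th ga mono[of c a] by (auto intro!: mult_left_mono)
      then show ?thesis using hP[of c] c aT a(3) by (auto simp: H_def)
    qed
    have xR: "\<bar>x c\<bar> \<le> R" if c: "c \<in> {0..a}" for c
    proof -
      have "\<bar>x c\<bar> \<le> 2 * (R0 + 2 * e) * exp (2 * L * a)" using bound[OF aT small c] by blast
      also have "\<dots> \<le> R" unfolding R using R0' e L aT by (intro mult_left_mono) auto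
      finally show ?thesis .
    qed
    have "integral {0..a} ?xa \<le> integral {0..a} (\<lambda>_. R)"
      using xR by (intro integral_le int) auto
    then have iR: "P a + Q a \<le> R * a" unfolding PQ using a by (simp add: mult.commute)
    have "H a \<le> r * (L * (P a + Q a))"
    proof -
      have "th * P a \<le> L * (P a + Q a)" "ga * Q a \<le> L * (P a + Q a)"
        using th ga L P0[of a] Q0[of a] by (auto intro!: mult_mono)
      then show ?thesis unfolding H_def using r by (auto intro!: mult_left_mono)
    qed
    also have "\<dots> \<le> r * (L * (R * a))" using iR r L by (auto intro!: mult_left_mono)
    also have "\<dots> \<le> r * (L * (R * T))" using r L R_nonneg aT by (auto intro!: mult_left_mono)
    also have "\<dots> < r * C" using C r by (simp add: algebra_simps)
    finally show False using a by (simp add: mult.commute)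
  qed
  show "\<bar>x t\<bar> \<le> R" unfolding R using bound[of T t] H t by auto
  show "\<bar>x t - u t + th * integral {0..t} ?xp - ga * integral {0..t} ?xm\<bar> \<le> 2 * e"
    using dev[of t] H[of t] t by (simp add: P_def Q_def)
qed

text \<open>A partial sum beyond \<open>t\<close> bounds the set of admissible indices, because
  positive steps make the partial sums increase; only then is the natural number \<open>Sup\<close>
  in \<open>renewal_count\<close> a maximum, from which both inequalities are read off.\<close>

lemma renewal_count_bounds:
  fixes u :: "nat \<Rightarrow> real"
  assumes pos: "\<And>i. 1 \<le> i \<Longrightarrow> 0 < u i" and t: "0 \<le> t" and K: "t < (\<Sum>i\<in>{1..K}. u i)"
  shows "renewal_count u t < K"
    and "(\<Sum>i\<in>{1..renewal_count u t}. u i) \<le> t"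
    and "t < (\<Sum>i\<in>{1..Suc (renewal_count u t)}. u i)"
proof -
  let ?S = "\<lambda>k. \<Sum>i\<in>{1..k}. u i"
  let ?A = "{k. ?S k \<le> t}"
  have mono: "?S j \<le> ?S k" if "j \<le> k" for j k
    using that pos by (intro sum_mono2) (auto intro: less_imp_le)
  have sub: "?A \<subseteq> {..<K}"
  proof
    fix k assume "k \<in> ?A"
    then have "?S k < ?S K" using K by simp
    then show "k \<in> {..<K}" using mono[of K k] by (cases "k < K") auto
  qed
  then have fin: "finite ?A" by (rule finite_subset) simp
  have ne: "?A \<noteq> {}" using t by (auto intro: exI[of _ 0])
  have eq: "renewal_count u t = Max ?A" unfolding renewal_count_def by (rule cSup_eq_Max[OF fin ne])
  have "Max ?A \<in> ?A" by (rule Max_in[OF fin ne])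
  then show "?S (renewal_count u t) \<le> t" "renewal_count u t < K" using sub by (auto simp: eq)
  show "t < ?S (Suc (renewal_count u t))"
  proof (rule ccontr)
    assume "\<not> ?thesis"
    then have "Suc (Max ?A) \<in> ?A" unfolding eq by simp
    from Max_ge[OF fin this] show False by simp
  qed
qed

text \<open>Multiplied by \<open>a\<close>, the two inequalities that define the count
  \<open>N\<close> say that \<open>N - a * t\<close> lies between \<open>- 1 - D (Suc N)\<close> and
  \<open>- D N\<close>. The crude bound \<open>B\<close> first locates \<open>N\<close> within
  \<open>B + 1\<close> of \<open>a * t\<close>; the oscillation hypothesis then exchanges the random
  indices \<open>N\<close> and \<open>Suc N\<close> for the deterministic \<open>q\<close>. The
  \<open>2\<close> in the condition on \<open>q\<close> is this \<open>1\<close> plus the step from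
  \<open>N\<close> to \<open>Suc N\<close>.\<close>

lemma renewal_count_approx:
  fixes u D :: "nat \<Rightarrow> real"
  assumes pos: "\<And>i. 1 \<le> i \<Longrightarrow> 0 < u i" and a: "0 < a"
    and D: "\<And>k. D k = (\<Sum>i\<in>{1..k}. a * u i - 1)"
    and bd: "\<And>i. i \<le> K \<Longrightarrow> \<bar>D i\<bar> \<le> B"
    and osc: "\<And>i j. i \<le> K \<Longrightarrow> j \<le> K \<Longrightarrow> \<bar>real i - real j\<bar> \<le> \<delta> \<Longrightarrow> \<bar>D i - D j\<bar> \<le> e"
    and t: "0 \<le> t" "a * t < real K - B" and q: "q \<le> K" "\<bar>real q - a * t\<bar> + B + 2 \<le> \<delta>" 
  shows "\<bar>real (renewal_count u t) - a * t + D q\<bar> \<le> 1 + e"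
proof -
  define N where "N = renewal_count u t"
  let ?S = "\<lambda>k. \<Sum>i\<in>{1..k}. u i"
  have DS: "a * ?S k = D k + real k" for k
    unfolding D by (simp add: sum_subtractf sum_distrib_left)
  have "real K - B \<le> a * ?S K" using DS[of K] bd[of K] by auto
  then have "a * t < a * ?S K" using t by linarith
  then have tK: "t < ?S K" using a by simp
  note N = renewal_count_bounds[OF pos t(1) tK, folded N_def]
  have NK: "N \<le> K" "Suc N \<le> K" using N(1) by auto
  have u1: "real N - a * t \<le> - D N" using mult_left_mono[OF N(2), of a] a DS[of N] by linarith
  have "a * t < D (Suc N) + real (Suc N)" using mult_strict_left_mono[OF N(3) a] DS[of "Suc N"] by linarith
  then have l1: "- 1 - D (Suc N) < real N - a * t" by simp
  have "\<bar>real N - a * t\<bar> \<le> 1 + B" using u1 l1 bd[OF NK(1)] bd[OF NK(2)] by linarith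
  then have "\<bar>real N - real q\<bar> \<le> \<delta>" "\<bar>real (Suc N) - real q\<bar> \<le> \<delta>" using q by auto
  from osc[OF NK(1) q(1) this(1)] osc[OF NK(2) q(1) this(2)] u1 l1
  show ?thesis unfolding N_def[symmetric] by linarith
qed

section \<open>Measurability of J1-continuous functionals\<close>

lemma J1_continuousD:
  "J1_continuous f \<Longrightarrow> cadlag x \<Longrightarrow> (\<And>k. cadlag (xs k)) \<Longrightarrow> J1_conv xs x \<Longrightarrow> (\<lambda>k. f (xs k)) \<longlonglongrightarrow> f x"
  unfolding J1_continuous_def by blast

lemma time_change_id: "time_change (\<lambda>t. t)"
  by (simp add: time_change_def strict_mono_on_def)

lemma J1_conv_uniform:
  assumes "\<And>T e. 0 \<le> T \<Longrightarrow> 0 < e \<Longrightarrow> eventually (\<lambda>k. \<forall>t\<in>{0..T}. \<bar>xs k t - x t\<bar> \<le> e) sequentially"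
  shows "J1_conv xs x"
  unfolding J1_conv_def using assms time_change_id by (intro exI[of _ "\<lambda>_ t. t"]) auto

text \<open>The definition of J1 convergence asks for a single sequence of time changes for all
  horizons and tolerances; a diagonal choice produces it.\<close>

lemma J1_convI:
  assumes ev: "\<And>T e. 0 \<le> T \<Longrightarrow> 0 < e \<Longrightarrow> eventually (\<lambda>k. \<exists>lam. time_change lam \<and>
     (\<forall>t\<ge>0. \<bar>lam t - t\<bar> \<le> e) \<and> (\<forall>t\<in>{0..T}. \<bar>xs k (lam t) - x t\<bar> \<le> e)) sequentially"
  shows "J1_conv xs x"
proof -
  define good where "good k p lam \<longleftrightarrow> time_change lam \<and> (\<forall>t\<ge>0. \<bar>lam t - t\<bar> \<le> 1 / (real p + 1)) \<and>
     (\<forall>t\<in>{0..real p}. \<bar>xs k (lam t) - x t\<bar> \<le> 1 / (real p + 1))" for k p lam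
  \<comment> \<open>\<open>A k\<close> holds the precisions that path \<open>k\<close> attains; the
    cap \<open>p \<le> k\<close> makes it finite, so that a best one exists. The identity serves as
    default while no precision is attained.\<close>
  define A where "A k = {p. p \<le> k \<and> (\<exists>lam. good k p lam)}" for k
  define lam where "lam k = (if A k = {} then (\<lambda>t. t) else (SOME l. good k (Max (A k)) l))" for k
  have fin: "finite (A k)" for k by (rule finite_subset[of _ "{..k}"]) (auto simp: A_def)
  have lam: "good k (Max (A k)) (lam k)" if "A k \<noteq> {}" for k
  proof -
    have "Max (A k) \<in> A k" using that fin by (rule Max_in[rotated])
    then have "\<exists>l. good k (Max (A k)) l" by (simp add: A_def)
    then show ?thesis using that by (simp add: lam_def someI_ex)
  qed
  have tc: "time_change (lam k)" for k
    using lam[of k] time_change_id by (cases "A k = {}") (auto simp: good_def lam_def)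
  have large: "eventually (\<lambda>k. A k \<noteq> {} \<and> p \<le> Max (A k)) sequentially" for p
  proof -
    have "eventually (\<lambda>k. \<exists>l. good k p l) sequentially"
      unfolding good_def by (rule ev) auto
    then show ?thesis using eventually_ge_at_top[of p]
    proof eventually_elim
      case (elim k)
      then have "p \<in> A k" by (simp add: A_def)
      then show ?case using Max_ge[OF fin] by auto
    qed
  qed
  have mono: "1 / (real (Max (A k)) + 1) \<le> e" if "p \<le> Max (A k)" "1 / (real p + 1) < e" for p k e
  proof -
    have "1 / (real (Max (A k)) + 1) \<le> 1 / (real p + 1)" using that by (intro divide_left_mono) auto
    then show ?thesis using that by simp
  qed
  show ?thesis unfolding J1_conv_def
  proof (intro exI[of _ lam] conjI allI impI tc)
    fix e :: real assume "e > 0"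
    then obtain p where p: "1 / (real p + 1) < e" using reals_Archimedean[of e] by (auto simp: inverse_eq_divide add.commute)
    show "eventually (\<lambda>k. \<forall>t\<ge>0. \<bar>lam k t - t\<bar> \<le> e) sequentially"
      using large[of p]
    proof eventually_elim
      case (elim k)
      show ?case using lam[of k] elim mono[of p k e] p unfolding good_def by (meson order_trans)
    qed
  next
    fix T e :: real assume "0 \<le> T" "e > 0"
    then obtain p where p: "1 / (real p + 1) < e" using reals_Archimedean[of e] by (auto simp: inverse_eq_divide add.commute)
    obtain p' where p': "T \<le> real p'" using real_arch_simple by blast
    show "eventually (\<lambda>k. \<forall>t\<in>{0..T}. \<bar>xs k (lam k t) - x t\<bar> \<le> e) sequentially"
      using large[of "max p p'"]
    proof eventually_elim
      case (elim k)
      have "\<bar>xs k (lam k t) - x t\<bar> \<le> e" if t: "t \<in> {0..T}" for t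
      proof -
        have "t \<le> real (Max (A k))" using t p' elim by (auto intro: order_trans)
        then have "\<bar>xs k (lam k t) - x t\<bar> \<le> 1 / (real (Max (A k)) + 1)"
          using lam[of k] elim t unfolding good_def by auto
        then show ?thesis using mono[of p k e] p elim by auto
      qed
      then show ?case by blast
    qed
  qed
qed

text \<open>A sampled path depends on countably many values of \<open>x\<close> only, which is what
  makes functionals of it measurable.\<close>

definition sample :: "nat \<Rightarrow> (real \<Rightarrow> real) \<Rightarrow> real \<Rightarrow> real" where
  "sample m x t = x (real (nat \<lfloor>real m * t\<rfloor>) / real m)"

lemma cadlag_sample: "0 < m \<Longrightarrow> cadlag (sample m x)"
  unfolding sample_def by (rule cadlag_grid_step)

text \<open>The sampled path takes values of \<open>x\<close> from \<open>{a..<b}\<close> exactly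
  during the interval from \<open>grid_ceil m a\<close> to \<open>grid_ceil m b\<close>, right end
  excluded.\<close>

definition grid_ceil :: "nat \<Rightarrow> real \<Rightarrow> real" where
  "grid_ceil m s = real_of_int \<lceil>real m * s\<rceil> / real m"

lemma grid_ceil_bounds: "0 < m \<Longrightarrow> s \<le> grid_ceil m s" "0 < m \<Longrightarrow> grid_ceil m s < s + 1 / real m"
  unfolding grid_ceil_def by (auto simp: field_simps) (linarith)+

text \<open>Prescribed endpoint values allow pieces to be glued. Closeness to \<open>x\<close> is
  not asked at \<open>b\<close>, where \<open>x\<close> may jump: that jump is matched by the piece
  starting at \<open>b\<close>.\<close>

definition local_time_change :: "(real \<Rightarrow> real) \<Rightarrow> real \<Rightarrow> real \<Rightarrow> real \<Rightarrow> nat \<Rightarrow> (real \<Rightarrow> real) \<Rightarrow> bool" where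
  "local_time_change x e a b m lam \<longleftrightarrow> strict_mono_on {a..b} lam \<and> continuous_on {a..b} lam \<and>
     lam a = grid_ceil m a \<and> lam b = grid_ceil m b \<and> (\<forall>t\<in>{a..b}. \<bar>lam t - t\<bar> \<le> e) \<and>
     (\<forall>t\<in>{a..<b}. \<bar>sample m x (lam t) - x t\<bar> \<le> e)"

text \<open>Where \<open>x\<close> oscillates by at most \<open>e\<close>, it suffices that the time
  change carries \<open>{a..<b}\<close> to the times at which the sampled path reads values from
  \<open>{a..<b}\<close>; the affine map between the two intervals does this.\<close>

lemma local_time_change_linear:
  assumes "0 \<le> a" "a < b" "0 < e" and osc: "\<And>t u. t \<in> {a..<b} \<Longrightarrow> u \<in> {a..<b} \<Longrightarrow> \<bar>x t - x u\<bar> \<le> e"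
  shows "eventually (\<lambda>m. \<exists>lam. local_time_change x e a b m lam) sequentially"
proof -
  \<comment> \<open>A mesh below \<open>b - a\<close> keeps the two endpoints from being rounded up
    to the same grid point.\<close>
  have "eventually (\<lambda>m. 1 / real m < min e (b - a)) sequentially"
    using assms by (intro order_tendstoD(2)[OF lim_1_over_n]) auto
  then show ?thesis using eventually_gt_at_top[of 0]
  proof eventually_elim
    case (elim m)
    let ?c = "grid_ceil m"
    define r where "r = (?c b - ?c a) / (b - a)"
    define lam where "lam t = ?c a + (t - a) * r" for t
    have m: "0 < m" and m1: "1 / real m < e" "1 / real m < b - a" using elim by auto
    note ca = grid_ceil_bounds[OF m, of a] and cb = grid_ceil_bounds[OF m, of b]
    have "?c a < ?c b" using ca cb m1 by linarith
    then have r: "0 < r" using assms by (simp add: r_def)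
    have lb: "lam b = ?c b" using assms by (simp add: lam_def r_def)
    have close: "\<bar>lam t - t\<bar> \<le> e" if t: "t \<in> {a..b}" for t
    proof -
      define s where "s = (t - a) / (b - a)"
      have s: "0 \<le> s" "s \<le> 1" using t assms by (auto simp: s_def)
      have ts: "t = a + s * (b - a)" using assms by (simp add: s_def)
      \<comment> \<open>The displacement of an affine map is a convex combination of its values at
        the endpoints, each between 0 and \<open>1 / real m\<close>.\<close>
      have "lam t - t = (1 - s) * (?c a - a) + s * (?c b - b)"
        unfolding lam_def using assms by (simp add: r_def ts field_simps)
      moreover have "0 \<le> (1 - s) * (?c a - a)" "0 \<le> s * (?c b - b)" using s ca cb by auto
      moreover have "(1 - s) * (?c a - a) \<le> (1 - s) * (1 / real m)" "s * (?c b - b) \<le> s * (1 / real m)"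
        using s ca cb by (intro mult_left_mono; linarith)+
      moreover have "(1 - s) * (1 / real m) + s * (1 / real m) = 1 / real m"
        by (simp only: distrib_right[symmetric]) simp
      ultimately show ?thesis using m1 by linarith
    qed
    have smp: "\<bar>sample m x (lam t) - x t\<bar> \<le> e" if t: "t \<in> {a..<b}" for t
    proof -
      define k where "k = \<lfloor>real m * lam t\<rfloor>"
      have "?c a \<le> lam t" unfolding lam_def using t r by simp
      moreover have "lam t < lam b" unfolding lam_def using t r by simp
      ultimately have "real_of_int \<lceil>real m * a\<rceil> \<le> real m * lam t" "real m * lam t < real_of_int \<lceil>real m * b\<rceil>"
        using m unfolding lb grid_ceil_def by (auto simp: field_simps)
      then have k: "\<lceil>real m * a\<rceil> \<le> k" "k \<le> \<lceil>real m * b\<rceil> - 1" unfolding k_def by linarith+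
      have "0 \<le> real m * a" using assms by simp
      then have "-1 < \<lceil>real m * a\<rceil>" by linarith
      then have k0: "0 \<le> k" using k by linarith
      have "real m * a \<le> real_of_int k" "real_of_int k < real m * b" using k by linarith+
      then have "real (nat k) / real m \<in> {a..<b}" using m k0 by (auto simp: field_simps)
      then show ?thesis using osc t by (simp add: sample_def k_def)
    qed
    have "local_time_change x e a b m lam"
      unfolding local_time_change_def
      using r close smp lb by (auto simp: strict_mono_on_def lam_def intro!: continuous_intros)
    then show ?case by blast
  qed
qed

lemma local_time_change_join:
  assumes l1: "local_time_change x e a b m lam1" and l2: "local_time_change x e b c m lam2" and le: "a \<le> b" "b \<le> c"
  shows "local_time_change x e a c m (\<lambda>t. if t \<le> b then lam1 t else lam2 t)"
proof -
  let ?l = "\<lambda>t. if t \<le> b then lam1 t else lam2 t"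
  have eq: "lam1 b = lam2 b" using l1 l2 by (simp add: local_time_change_def)
  have m1: "\<And>s t. s \<in> {a..b} \<Longrightarrow> t \<in> {a..b} \<Longrightarrow> s < t \<Longrightarrow> lam1 s < lam1 t"
    and m2: "\<And>s t. s \<in> {b..c} \<Longrightarrow> t \<in> {b..c} \<Longrightarrow> s < t \<Longrightarrow> lam2 s < lam2 t"
    using l1 l2 by (auto simp: local_time_change_def strict_mono_on_def)
  have "?l s < ?l t" if "s \<in> {a..c}" "t \<in> {a..c}" "s < t" for s t
  proof -
    consider "t \<le> b" | "s \<le> b" "b < t" | "b < s" by linarith
    then show ?thesis
    proof cases
      case 2
      have "lam1 s \<le> lam1 b" using m1[of s b] 2 that le by (cases "s = b") auto
      also have "\<dots> < lam2 t" unfolding eq using m2[of b t] 2 that le by auto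
      finally show ?thesis using 2 by simp
    qed (use that m1[of s t] m2[of s t] in auto)
  qed
  then have mono: "strict_mono_on {a..c} ?l" by (auto simp: strict_mono_on_def)
  have "continuous_on ({a..b} \<union> {b..c}) ?l"
    using l1 l2 le eq by (intro continuous_on_If) (auto simp: local_time_change_def)
  moreover have "{a..b} \<union> {b..c} = {a..c}" using le by auto
  ultimately have cont: "continuous_on {a..c} ?l" by simp
  have "\<bar>sample m x (?l t) - x t\<bar> \<le> e" if t: "t \<in> {a..<c}" for t
  proof -
    consider "t < b" | "t = b" "b < c" | "b < t"
      using t by force
    then show ?thesis
    proof cases
      case 2
      \<comment> \<open>At the joint the bound comes from the right piece, since the left one says
        nothing there; both maps agree at \<open>b\<close>.\<close>
      have "\<forall>t\<in>{b..<c}. \<bar>sample m x (lam2 t) - x t\<bar> \<le> e" using l2 unfolding local_time_change_def by blast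
      then have "\<bar>sample m x (lam2 b) - x b\<bar> \<le> e" using 2 by auto
      then show ?thesis using 2 eq by simp
    qed (use t l1 l2 in \<open>auto simp: local_time_change_def\<close>)
  qed
  then show ?thesis unfolding local_time_change_def
    using mono cont l1 l2 le eq by (auto simp: local_time_change_def)
qed

text \<open>Degenerate pieces arise in the bisection when the chosen point is an endpoint of the
  interval.\<close>

lemma local_time_change_refl:
  assumes "0 < e"
  shows "eventually (\<lambda>m. \<exists>lam. local_time_change x e a a m lam) sequentially"
proof -
  have "eventually (\<lambda>m. 1 / real m < e) sequentially"
    using assms by (intro order_tendstoD(2)[OF lim_1_over_n]) auto
  then show ?thesis using eventually_gt_at_top[of 0]
  proof eventually_elim
    case (elim m)
    then show ?case using grid_ceil_bounds[of m a]
      by (intro exI[of _ "\<lambda>_. grid_ceil m a"]) (auto simp: local_time_change_def strict_mono_on_def)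
  qed
qed

text \<open>Bisection again: around any point \<open>s\<close> the path oscillates little on each
  side separately, so affine pieces to the left and to the right of \<open>s\<close> are joined at
  \<open>s\<close>, and a jump of \<open>x\<close> at \<open>s\<close> is aligned with the jump of
  the sampled path at \<open>grid_ceil m s\<close>.\<close>

lemma eventually_local_time_change:
  assumes x: "cadlag x" and e: "0 < e" and "0 \<le> a" "a \<le> b"
  shows "eventually (\<lambda>m. \<exists>lam. local_time_change x e a b m lam) sequentially"
proof -
  let ?Q = "\<lambda>a b. eventually (\<lambda>m. \<exists>lam. local_time_change x e a b m lam) sequentially"
  have join: "?Q a c" if "?Q a b" "?Q b c" "a \<le> b" "b \<le> c" for a b c
    using that(1,2) by eventually_elim (use local_time_change_join that(3,4) in blast)
  have "0 \<le> a \<longrightarrow> ?Q a b"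
  proof (rule Bolzano[OF \<open>a \<le> b\<close>, where P = "\<lambda>a b. 0 \<le> a \<longrightarrow> ?Q a b"])
    fix a b c :: real assume "0 \<le> a \<longrightarrow> ?Q a b" "0 \<le> b \<longrightarrow> ?Q b c" "a \<le> b" "b \<le> c"
    then show "0 \<le> a \<longrightarrow> ?Q a c" using join by auto
  next
    fix s :: real assume s: "a \<le> s" "s \<le> b"
    then have s0: "0 \<le> s" using assms by simp
    have e2: "0 < e / 2" using e by simp
    obtain d1 where d1: "d1 > 0" "\<And>t. s \<le> t \<Longrightarrow> t < s + d1 \<Longrightarrow> \<bar>x t - x s\<bar> < e / 2"
      using cadlag_at_right[OF x s0 e2] by blast
    have "\<exists>l d. d > 0 \<and> (\<forall>t\<ge>0. s - d < t \<longrightarrow> t < s \<longrightarrow> \<bar>x t - l\<bar> < e / 2)"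
    proof (cases "s = 0")
      case True then show ?thesis by (auto intro: exI[of _ 1])
    next
      case False then show ?thesis using cadlag_at_left[OF x _ e2, of s] s0 by (metis le_less)
    qed
    then obtain l d2 where d2: "d2 > 0" "\<And>t. 0 \<le> t \<Longrightarrow> s - d2 < t \<Longrightarrow> t < s \<Longrightarrow> \<bar>x t - l\<bar> < e / 2" by blast
    show "\<exists>d>0. \<forall>a b. a \<le> s \<and> s \<le> b \<and> b - a < d \<longrightarrow> 0 \<le> a \<longrightarrow> ?Q a b"
    proof (intro exI[of _ "min d1 d2"] conjI allI impI)
      fix a b :: real assume ab: "a \<le> s \<and> s \<le> b \<and> b - a < min d1 d2" and a0: "0 \<le> a"
      have "?Q a s"
      proof (cases "a = s")
        case False
        show ?thesis
        proof (rule local_time_change_linear[OF a0 _ e])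
          fix t u assume "t \<in> {a..<s}" "u \<in> {a..<s}"
          then show "\<bar>x t - x u\<bar> \<le> e" using d2(2)[of t] d2(2)[of u] ab a0 unfolding atLeastLessThan_iff by linarith
        qed (use False ab in auto)
      qed (simp add: local_time_change_refl e)
      moreover have "?Q s b"
      proof (cases "b = s")
        case False
        show ?thesis
        proof (rule local_time_change_linear[OF s0 _ e])
          fix t u assume "t \<in> {s..<b}" "u \<in> {s..<b}"
          then show "\<bar>x t - x u\<bar> \<le> e" using d1(2)[of t] d1(2)[of u] ab a0 unfolding atLeastLessThan_iff by linarith
        qed (use False ab in auto)
      qed (simp add: local_time_change_refl e)
      ultimately show "?Q a b" using join ab by blast
    qed (use d1 d2 in auto)
  qed
  then show ?thesis using assms by simp
qed

text \<open>The sampled path shows a jump of \<open>x\<close> only at the next grid point, so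
  convergence is in general not locally uniform; a time change displacing by less than one mesh
  width repairs this.\<close>

lemma J1_conv_sample:
  assumes x: "cadlag x"
  shows "J1_conv (\<lambda>k. sample (Suc k) x) x"
proof (rule J1_convI)
  fix T e :: real assume T: "0 \<le> T" and e: "0 < e"
  have "eventually (\<lambda>m. \<exists>lam. local_time_change x e 0 (T + 1) m lam) sequentially"
    using eventually_local_time_change[OF x e] T by simp
  then have "eventually (\<lambda>m. \<exists>lam. local_time_change x e 0 (T + 1) (Suc m) lam) sequentially"
    by (rule eventually_compose_filterlim[OF _ filterlim_Suc])
  then show "eventually (\<lambda>k. \<exists>lam. time_change lam \<and>
     (\<forall>t\<ge>0. \<bar>lam t - t\<bar> \<le> e) \<and> (\<forall>t\<in>{0..T}. \<bar>sample (Suc k) x (lam t) - x t\<bar> \<le> e)) sequentially"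
  proof eventually_elim
    case (elim k)
    \<comment> \<open>The local bound excludes the right endpoint, so the construction goes beyond
      \<open>T\<close>. Past \<open>S\<close> a translation continues it, which preserves the
      displacement reached at \<open>S\<close>.\<close>
    define S where "S = T + 1"
    from elim obtain l where l: "local_time_change x e 0 S (Suc k) l" unfolding S_def by blast
    define lam where "lam t = (if t \<le> S then l t else t + (l S - S))" for t
    have S: "0 \<le> S" using T by (simp add: S_def)
    have lm: "\<And>s t. s \<in> {0..S} \<Longrightarrow> t \<in> {0..S} \<Longrightarrow> s < t \<Longrightarrow> l s < l t"
      and lc: "\<And>t. t \<in> {0..S} \<Longrightarrow> \<bar>l t - t\<bar> \<le> e" and l0: "l 0 = 0"
      using l by (auto simp: local_time_change_def strict_mono_on_def grid_ceil_def)
    have mono: "lam s < lam t" if "0 \<le> s" "s < t" for s t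
    proof -
      have "l s \<le> l S" if "s \<le> S" using that lm[of s S] \<open>0 \<le> s\<close> S by (cases "s = S") auto
      then show ?thesis using that lm[of s t] unfolding lam_def by (auto split: if_splits)
    qed
    have "continuous_on ({0..S} \<union> {S..}) lam"
      unfolding lam_def using l S by (intro continuous_on_If) (auto simp: local_time_change_def intro!: continuous_intros)
    moreover have "{0..S} \<union> {S..} = {0..}" using S by auto
    ultimately have cont: "continuous_on {0..} lam" by simp
    have close: "\<bar>lam t - t\<bar> \<le> e" if "0 \<le> t" for t
      using lc[of t] lc[of S] S that by (auto simp: lam_def)
    have lam0: "lam 0 = 0" using l0 S by (simp add: lam_def)
    have "lam ` {0..} = {0..}"
    proof (intro subset_antisym subsetI)
      fix y assume "y \<in> lam ` {0..}"
      then obtain t where "0 \<le> t" "y = lam t" by auto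
      then show "y \<in> {0..}" using mono[of 0 t] lam0 by (cases "t = 0") auto
    next
      fix y :: real assume y: "y \<in> {0..}"
      \<comment> \<open>A displacement of at most \<open>e\<close> places \<open>lam (y + e)\<close>
        above \<open>y\<close>, so the intermediate value theorem reaches \<open>y\<close>.\<close>
      have "y \<le> lam (y + e)" using close[of "y + e"] y e by auto
      moreover have "continuous_on {0..y + e} lam" using cont by (rule continuous_on_subset) auto
      ultimately obtain t where "0 \<le> t" "lam t = y" using IVT'[of lam 0 y "y + e"] lam0 y e by auto
      then show "y \<in> lam ` {0..}" by auto
    qed
    then have "time_change lam" using mono cont by (auto simp: time_change_def strict_mono_on_def)
    moreover have "\<forall>t\<in>{0..T}. \<bar>sample (Suc k) x (lam t) - x t\<bar> \<le> e"
      using l by (auto simp: lam_def local_time_change_def S_def)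
    ultimately show ?case using close by blast
  qed
qed

text \<open>The product topology on real sequences is metrizable, so sequential continuity is
  continuity, and for countably many factors its Borel sets form the product sigma-algebra.\<close>

lemma sequentially_continuous_functional:
  fixes G :: "(nat \<Rightarrow> real) \<Rightarrow> real"
  assumes "\<And>vs v. (\<And>k. (\<lambda>j. vs j k) \<longlonglongrightarrow> v k) \<Longrightarrow> (\<lambda>j. G (vs j)) \<longlonglongrightarrow> G v"
  shows "G \<in> borel_measurable (Pi\<^sub>M UNIV (\<lambda>_. borel))"
proof -
  have "continuous_on UNIV G"
  proof (subst continuous_on_sequentially, intro ballI allI impI)
    fix vs :: "nat \<Rightarrow> nat \<Rightarrow> real" and v assume *: "(\<forall>n. vs n \<in> UNIV) \<and> vs \<longlonglongrightarrow> v"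
    have "(\<lambda>j. vs j k) \<longlonglongrightarrow> v k" for k
    proof -
      have "isCont (\<lambda>x :: nat \<Rightarrow> real. x k) v"
        
        by (rule continuous_on_eq_continuous_at[OF open_UNIV, THEN iffD1, rule_format,
              OF continuous_on_product_coordinates]) simp
      then show ?thesis using isCont_tendsto_compose[of v "\<lambda>x. x k" vs sequentially] * by blast
    qed
    then show "(G \<circ> vs) \<longlonglongrightarrow> G v" using assms[of vs v] by (simp add: comp_def)
  qed
  then have "G \<in> borel_measurable borel" by (rule borel_measurable_continuous_onI)
  moreover have "sets (Pi\<^sub>M UNIV (\<lambda>_::nat. borel :: real measure)) = sets borel" by (rule sets_PiM_equal_borel)
  ultimately show ?thesis by (simp cong: measurable_cong_sets)
qed

text \<open>\<open>weak_conv_D\<close> integrates functionals of paths without a sigma-algebra on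
  the path space, so measurability has to come from continuity: on grid step paths \<open>f\<close>
  is a continuous function of a sequence of coordinates, and sampled paths converge to the path in
  J1.\<close>

lemma J1_continuous_measurable:
  assumes f: "J1_continuous f" and cad: "\<And>\<omega>. \<omega> \<in> space M \<Longrightarrow> cadlag (Y \<omega>)"
    and Y: "\<And>t. (\<lambda>\<omega>. Y \<omega> t) \<in> borel_measurable M"
  shows "(\<lambda>\<omega>. f (Y \<omega>)) \<in> borel_measurable M"
proof (rule borel_measurable_LIMSEQ_real)
  define G where "G m v = f (\<lambda>t. v (nat \<lfloor>real (Suc m) * t\<rfloor>))" for m and v :: "nat \<Rightarrow> real"
  have G: "G m \<in> borel_measurable (Pi\<^sub>M UNIV (\<lambda>_. borel))" for m
  proof (rule sequentially_continuous_functional)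
    fix vs :: "nat \<Rightarrow> nat \<Rightarrow> real" and v assume v: "\<And>k. (\<lambda>j. vs j k) \<longlonglongrightarrow> v k"
    have "J1_conv (\<lambda>j t. vs j (nat \<lfloor>real (Suc m) * t\<rfloor>)) (\<lambda>t. v (nat \<lfloor>real (Suc m) * t\<rfloor>))"
    proof (rule J1_conv_uniform)
      fix T e :: real assume "0 \<le> T" "0 < e"
      have "eventually (\<lambda>j. \<forall>k\<in>{..nat \<lfloor>real (Suc m) * T\<rfloor>}. dist (vs j k) (v k) < e) sequentially"
        using v \<open>0 < e\<close> by (intro eventually_ball_finite) (auto intro: tendstoD)
      then show "eventually (\<lambda>j. \<forall>t\<in>{0..T}. \<bar>vs j (nat \<lfloor>real (Suc m) * t\<rfloor>) - v (nat \<lfloor>real (Suc m) * t\<rfloor>)\<bar> \<le> e) sequentially"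
      proof eventually_elim
        case (elim j)
        show ?case
        proof
          fix t assume "t \<in> {0..T}"
          then have "nat \<lfloor>real (Suc m) * t\<rfloor> \<le> nat \<lfloor>real (Suc m) * T\<rfloor>"
            by (intro nat_mono floor_mono mult_left_mono) auto
          then show "\<bar>vs j (nat \<lfloor>real (Suc m) * t\<rfloor>) - v (nat \<lfloor>real (Suc m) * t\<rfloor>)\<bar> \<le> e"
            using elim by (auto simp: dist_real_def intro: less_imp_le)
        qed
      qed
    qed
    then show "(\<lambda>j. G m (vs j)) \<longlonglongrightarrow> G m v"
      unfolding G_def by (intro J1_continuousD[OF f] cadlag_grid_step) auto
  qed
  fix m
  have "(\<lambda>\<omega>. (\<lambda>k. Y \<omega> (real k / real (Suc m)))) \<in> measurable M (Pi\<^sub>M UNIV (\<lambda>_. borel))"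
    using Y by (intro measurable_PiM_single') auto
  from measurable_compose[OF this G[of m]]
  show "(\<lambda>\<omega>. f (sample (Suc m) (Y \<omega>))) \<in> borel_measurable M" unfolding G_def sample_def .
next
  fix \<omega> assume "\<omega> \<in> space M"
  then show "(\<lambda>m. f (sample (Suc m) (Y \<omega>))) \<longlonglongrightarrow> f (Y \<omega>)"
    by (intro J1_continuousD[OF f] J1_conv_sample cadlag_sample cad) auto
qed

section \<open>A criterion for weak convergence\<close>

text \<open>The index \<open>j\<close> is both the time horizon and the Lipschitz constant, so a
  single limit in \<open>j\<close> removes both restrictions.\<close>

definition lipschitz_functional :: "nat \<Rightarrow> real \<Rightarrow> ((real \<Rightarrow> real) \<Rightarrow> real) \<Rightarrow> bool" where
  "lipschitz_functional j B g \<longleftrightarrow> (\<forall>x. cadlag x \<longrightarrow> \<bar>g x\<bar> \<le> B) \<and>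
     (\<forall>x y r. cadlag x \<longrightarrow> cadlag y \<longrightarrow> 0 \<le> r \<longrightarrow> (\<forall>t\<in>{0..real j}. \<bar>x t - y t\<bar> \<le> r) \<longrightarrow> \<bar>g x - g y\<bar> \<le> real j * r)"

lemma lipschitz_functionalD:
  assumes "lipschitz_functional j B g" "cadlag x"
  shows "\<bar>g x\<bar> \<le> B"
    and "cadlag y \<Longrightarrow> 0 \<le> r \<Longrightarrow> (\<And>t. t \<in> {0..real j} \<Longrightarrow> \<bar>x t - y t\<bar> \<le> r) \<Longrightarrow> \<bar>g x - g y\<bar> \<le> real j * r"
  using assms unfolding lipschitz_functional_def by blast+

text \<open>The infimum of this set is the inf-convolution of \<open>f\<close> with \<open>j\<close>
  times the uniform distance on \<open>{0..real j}\<close>; a bound \<open>r\<close> stands for the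
  distance, which avoids a supremum over times.\<close>

definition envelope_set :: "((real \<Rightarrow> real) \<Rightarrow> real) \<Rightarrow> nat \<Rightarrow> (real \<Rightarrow> real) \<Rightarrow> real set" where
  "envelope_set f j x = {f y + real j * r | y r. cadlag y \<and> 0 \<le> r \<and> (\<forall>t\<in>{0..real j}. \<bar>x t - y t\<bar> \<le> r)}"

definition envelope :: "((real \<Rightarrow> real) \<Rightarrow> real) \<Rightarrow> nat \<Rightarrow> (real \<Rightarrow> real) \<Rightarrow> real" where
  "envelope f j x = Inf (envelope_set f j x)"

lemma envelope_setI:
  "cadlag y \<Longrightarrow> 0 \<le> r \<Longrightarrow> (\<And>t. t \<in> {0..real j} \<Longrightarrow> \<bar>x t - y t\<bar> \<le> r) \<Longrightarrow> f y + real j * r \<in> envelope_set f j x"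
  unfolding envelope_set_def by blast

lemma envelope_set_self: "cadlag x \<Longrightarrow> f x \<in> envelope_set f j x"
  using envelope_setI[of x 0 j x f] by simp

context
  fixes f :: "(real \<Rightarrow> real) \<Rightarrow> real" and B :: real
  assumes bound: "\<And>x. cadlag x \<Longrightarrow> \<bar>f x\<bar> \<le> B"
begin

lemma envelope_set_ge: "z \<in> envelope_set f j x \<Longrightarrow> - B \<le> z"
proof -
  assume "z \<in> envelope_set f j x"
  then obtain y r where z: "z = f y + real j * r" "cadlag y" "0 \<le> r" unfolding envelope_set_def by blast
  have "0 \<le> real j * r" using z by simp
  then show ?thesis using bound[OF z(2)] z(1) by linarith
qed

lemma envelope_lower: "z \<in> envelope_set f j x \<Longrightarrow> envelope f j x \<le> z"
  unfolding envelope_def using envelope_set_ge by (intro cInf_lower bdd_belowI)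

lemma lipschitz_functional_envelope: "lipschitz_functional j B (envelope f j)"
proof -
  have ge: "- B \<le> envelope f j x" if "cadlag x" for x
    unfolding envelope_def using envelope_set_self[OF that, of f j] envelope_set_ge by (intro cInf_greatest) auto
  have le: "envelope f j x \<le> B" if "cadlag x" for x
    using envelope_lower[OF envelope_set_self[OF that], of j] bound[OF that] by linarith
  have half: "envelope f j x \<le> envelope f j y + real j * r"
    if "cadlag x" "cadlag y" "0 \<le> r" and xy: "\<And>t. t \<in> {0..real j} \<Longrightarrow> \<bar>x t - y t\<bar> \<le> r" for x y r
  proof -
    have "envelope f j x - real j * r \<le> z" if z: "z \<in> envelope_set f j y" for z
    proof -
      from z obtain u s where u: "z = f u + real j * s" "cadlag u" "0 \<le> s" "\<forall>t\<in>{0..real j}. \<bar>y t - u t\<bar> \<le> s"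
        unfolding envelope_set_def by blast
      have "\<bar>x t - u t\<bar> \<le> r + s" if "t \<in> {0..real j}" for t
        using xy[OF that] bspec[OF u(4) that] by linarith
      then have "f u + real j * (r + s) \<in> envelope_set f j x" using u \<open>0 \<le> r\<close> by (intro envelope_setI) auto
      from envelope_lower[OF this] show ?thesis using u(1) by (simp add: algebra_simps)
    qed
    then have "envelope f j x - real j * r \<le> envelope f j y"
      unfolding envelope_def[of f j y] using envelope_set_self[OF \<open>cadlag y\<close>, of f j] by (intro cInf_greatest) auto
    then show ?thesis by simp
  qed
  have "\<bar>envelope f j x - envelope f j y\<bar> \<le> real j * r"
    if "cadlag x" "cadlag y" "0 \<le> r" "\<forall>t\<in>{0..real j}. \<bar>x t - y t\<bar> \<le> r" for x y r
    using half[of x y r] half[of y x r] that by (auto simp: abs_minus_commute abs_le_iff)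
  moreover have "\<bar>envelope f j x\<bar> \<le> B" if "cadlag x" for x
    using ge[OF that] le[OF that] by (auto simp: abs_le_iff)
  ultimately show ?thesis unfolding lipschitz_functional_def by blast
qed

text \<open>A near-minimiser \<open>y j\<close> cannot pay a penalty above \<open>2 * B + 1\<close>,
  so it lies within \<open>(2 * B + 1) / j\<close> of \<open>x\<close> on
  \<open>{0..real j}\<close>. Hence the \<open>y j\<close> converge to \<open>x\<close> locally
  uniformly, thus in J1, and \<open>f (y j)\<close> squeezes the envelope from below, while
  \<open>f x\<close> itself bounds it from above.\<close>

lemma envelope_tendsto:
  assumes f: "J1_continuous f" and x: "cadlag x"
  shows "(\<lambda>j. envelope f j x) \<longlonglongrightarrow> f x"
proof -
  have B0: "0 \<le> B" using bound[OF x] by simp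
  have "\<exists>y. cadlag y \<and> (\<forall>t\<in>{0..real j}. real j * \<bar>x t - y t\<bar> \<le> 2 * B + 1) \<and> f y - 1 / (real j + 1) \<le> envelope f j x" for j
  proof -
    have "\<exists>z\<in>envelope_set f j x. z < envelope f j x + 1 / (real j + 1)"
      unfolding envelope_def using envelope_set_self[OF x] by (intro cInf_lessD) auto
    then obtain y r where y: "cadlag y" "0 \<le> r" "\<forall>t\<in>{0..real j}. \<bar>x t - y t\<bar> \<le> r"
      "f y + real j * r < envelope f j x + 1 / (real j + 1)" unfolding envelope_set_def by blast
    have "envelope f j x \<le> f x" by (intro envelope_lower envelope_set_self x)
    moreover have "1 / (real j + 1) \<le> 1" by simp
    ultimately have r: "real j * r \<le> 2 * B + 1" using y(4) bound[OF x] bound[OF y(1)] by linarith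
    have "real j * \<bar>x t - y t\<bar> \<le> 2 * B + 1" if "t \<in> {0..real j}" for t
      using mult_left_mono[OF bspec[OF y(3) that], of "real j"] r by linarith
    moreover have "0 \<le> real j * r" using y by simp
    then have "f y - 1 / (real j + 1) \<le> envelope f j x" using y(4) by linarith
    ultimately show ?thesis using y(1) by blast
  qed
  then obtain y where y: "\<And>j. cadlag (y j)" "\<And>j t. t \<in> {0..real j} \<Longrightarrow> real j * \<bar>x t - y j t\<bar> \<le> 2 * B + 1"
    "\<And>j. f (y j) - 1 / (real j + 1) \<le> envelope f j x" by metis
  have "J1_conv y x"
  proof (rule J1_conv_uniform)
    fix T e :: real assume "0 \<le> T" "0 < e"
    have "eventually (\<lambda>j. T \<le> real j) sequentially" "eventually (\<lambda>j. (2 * B + 1) / e \<le> real j) sequentially"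
      using filterlim_real_sequentially by (auto simp: filterlim_at_top)
    then show "eventually (\<lambda>j. \<forall>t\<in>{0..T}. \<bar>y j t - x t\<bar> \<le> e) sequentially"
      using eventually_gt_at_top[of 0]
    proof eventually_elim
      case (elim j)
      show ?case
      proof
        fix t assume "t \<in> {0..T}"
        then have "real j * \<bar>x t - y j t\<bar> \<le> 2 * B + 1" using y(2)[of t j] elim by auto
        also have "\<dots> \<le> real j * e" using elim \<open>0 < e\<close> by (simp add: field_simps)
        finally show "\<bar>y j t - x t\<bar> \<le> e" using elim by (simp add: abs_minus_commute)
      qed
    qed
  qed
  then have "(\<lambda>j. f (y j)) \<longlonglongrightarrow> f x" by (intro J1_continuousD[OF f x y(1)])
  moreover have "(\<lambda>j. 1 / (real j + 1)) \<longlonglongrightarrow> 0"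
    using LIMSEQ_inverse_real_of_nat by (simp add: inverse_eq_divide add.commute)
  ultimately have "(\<lambda>j. f (y j) - 1 / (real j + 1)) \<longlonglongrightarrow> f x - 0" by (rule tendsto_diff)
  then have lim: "(\<lambda>j. f (y j) - 1 / (real j + 1)) \<longlonglongrightarrow> f x" by simp
  show ?thesis
    by (rule tendsto_sandwich[OF _ _ lim tendsto_const])
      (auto intro!: always_eventually y(3) envelope_lower envelope_set_self x)
qed

end

text \<open>The envelopes lie below \<open>f\<close>, which gives only a lower bound for the
  integrals of \<open>f\<close>; the same bound for \<open>- f\<close> supplies the upper one. The
  limits are taken in a fixed order: the envelope index \<open>j\<close> is chosen first, then the
  scheme \<open>m\<close>, and only then is \<open>n\<close> large. The approximation may fail on an
  event of small probability, where boundedness is enough.\<close>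

lemma weak_conv_D_approx:
  fixes A :: "nat \<Rightarrow> nat \<Rightarrow> 'a \<Rightarrow> real \<Rightarrow> real" and A' :: "nat \<Rightarrow> 'b \<Rightarrow> real \<Rightarrow> real"
  assumes M: "\<And>n. prob_space (M n)" and N: "prob_space N"
    and Y: "\<And>n \<omega>. \<omega> \<in> space (M n) \<Longrightarrow> cadlag (Y n \<omega>)" "\<And>n t. (\<lambda>\<omega>. Y n \<omega> t) \<in> borel_measurable (M n)"
    and Z: "\<And>\<omega>. \<omega> \<in> space N \<Longrightarrow> cadlag (Z \<omega>)" "\<And>t. (\<lambda>\<omega>. Z \<omega> t) \<in> borel_measurable N"
    and A: "\<And>m n \<omega>. cadlag (A m n \<omega>)" and A': "\<And>m \<omega>. cadlag (A' m \<omega>)"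
    and A_meas: "\<And>m n j B g. lipschitz_functional j B g \<Longrightarrow> (\<lambda>\<omega>. g (A m n \<omega>)) \<in> borel_measurable (M n)"
    and A'_meas: "\<And>m j B g. lipschitz_functional j B g \<Longrightarrow> (\<lambda>\<omega>. g (A' m \<omega>)) \<in> borel_measurable N"
    and conv: "\<And>m j B g. lipschitz_functional j B g \<Longrightarrow>
       (\<lambda>n. \<integral>\<omega>. g (A m n \<omega>) \<partial>M n) \<longlonglongrightarrow> (\<integral>\<omega>. g (A' m \<omega>) \<partial>N)"
    and close: "\<And>T e. 0 \<le> T \<Longrightarrow> 0 < e \<Longrightarrow> eventually (\<lambda>m. eventually (\<lambda>n. \<exists>G\<in>sets (M n).
       1 - e \<le> measure (M n) G \<and> (\<forall>\<omega>\<in>G. \<forall>t\<in>{0..T}. \<bar>Y n \<omega> t - A m n \<omega> t\<bar> \<le> e)) sequentially) sequentially"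
    and lim: "AE \<omega> in N. \<forall>T\<ge>0. \<forall>e>0. eventually (\<lambda>m. \<forall>t\<in>{0..T}. \<bar>A' m \<omega> t - Z \<omega> t\<bar> \<le> e) sequentially"
  shows "weak_conv_D M Y N Z"
proof -
  interpret N: prob_space N by fact
  have lower: "eventually (\<lambda>n. (\<integral>\<omega>. f (Z \<omega>) \<partial>N) - e < (\<integral>\<omega>. f (Y n \<omega>) \<partial>M n)) sequentially"
    if f: "J1_continuous f" and bound: "\<And>x. cadlag x \<Longrightarrow> \<bar>f x\<bar> \<le> B" and e: "0 < e" for f B e
  proof -
    let ?g = "envelope f"
    have B0: "0 \<le> B" using bound[OF A[of 0 0 undefined]] by simp
    have lip: "lipschitz_functional j B (?g j)" for j using lipschitz_functional_envelope bound .
    \<comment> \<open>The envelope is an infimum over uncountably many paths, so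
      \<open>?g j (Z \<omega>)\<close> has no evident measurability; the measurable limit
      \<open>h j\<close> takes its place and agrees with it almost everywhere.\<close>
    define h where "h j \<omega> = Topological_Spaces.lim (\<lambda>m. ?g j (A' m \<omega>))" for j \<omega>
    have h_meas: "h j \<in> borel_measurable N" for j
      unfolding h_def using A'_meas[OF lip] by (intro borel_measurable_lim_metric)
    have AE_conv: "AE \<omega> in N. \<forall>j. (\<lambda>m. ?g j (A' m \<omega>)) \<longlonglongrightarrow> ?g j (Z \<omega>)"
      using lim AE_space
    proof eventually_elim
      case (elim \<omega>)
      show ?case
      proof
        fix j show "(\<lambda>m. ?g j (A' m \<omega>)) \<longlonglongrightarrow> ?g j (Z \<omega>)"
        proof (rule tendstoI)
          fix e :: real assume e: "0 < e"
          define d where "d = e / (real j + 1)"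
          have d: "0 < d" using e by (simp add: d_def)
          have "real j * d < e" using e by (simp add: d_def field_simps)
          from elim d have "eventually (\<lambda>m. \<forall>t\<in>{0..real j}. \<bar>A' m \<omega> t - Z \<omega> t\<bar> \<le> d) sequentially" by auto
          then show "eventually (\<lambda>m. dist (?g j (A' m \<omega>)) (?g j (Z \<omega>)) < e) sequentially"
          proof eventually_elim
            case (elim m)
            have "\<bar>?g j (A' m \<omega>) - ?g j (Z \<omega>)\<bar> \<le> real j * d"
              using elim d by (intro lipschitz_functionalD(2)[OF lip A' Z(1)[OF \<open>\<omega> \<in> space N\<close>]]) auto
            then show ?case using \<open>real j * d < e\<close> by (simp add: dist_real_def)
          qed
        qed
      qed
    qed
    have AE_h: "AE \<omega> in N. \<forall>j. h j \<omega> = ?g j (Z \<omega>)"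
      using AE_conv by eventually_elim (auto simp: h_def intro: limI)
    have int_h: "(\<lambda>m. \<integral>\<omega>. ?g j (A' m \<omega>) \<partial>N) \<longlonglongrightarrow> (\<integral>\<omega>. h j \<omega> \<partial>N)" for j
    proof (rule integral_dominated_convergence[where w = "\<lambda>_. B"])
      show "AE \<omega> in N. (\<lambda>m. ?g j (A' m \<omega>)) \<longlonglongrightarrow> h j \<omega>"
        using AE_conv AE_h by eventually_elim auto
    qed (use h_meas A'_meas[OF lip] lipschitz_functionalD(1)[OF lip A'] in auto)
    have "(\<lambda>j. \<integral>\<omega>. h j \<omega> \<partial>N) \<longlonglongrightarrow> (\<integral>\<omega>. f (Z \<omega>) \<partial>N)"
    proof (rule integral_dominated_convergence[where w = "\<lambda>_. B"])
      show "AE \<omega> in N. (\<lambda>j. h j \<omega>) \<longlonglongrightarrow> f (Z \<omega>)"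
        using AE_h AE_space by eventually_elim (simp add: envelope_tendsto[OF bound f] Z)
      show "AE \<omega> in N. norm (h j \<omega>) \<le> B" for j
        using AE_h AE_space by eventually_elim (simp add: lipschitz_functionalD(1)[OF lip] Z)
    qed (use h_meas J1_continuous_measurable[OF f Z] in auto)
    from order_tendstoD(1)[OF this, of "(\<integral>\<omega>. f (Z \<omega>) \<partial>N) - e / 4"] e
    obtain j where j: "(\<integral>\<omega>. f (Z \<omega>) \<partial>N) - e / 4 < (\<integral>\<omega>. h j \<omega> \<partial>N)"
      by (auto simp: eventually_sequentially)
    \<comment> \<open>\<open>e\<close> is spent in quarters: from \<open>f\<close> to the envelope,
      from its limit to \<open>A' m\<close>, from there to \<open>A m n\<close>, and on
      \<open>real j * d + 2 * B * d\<close>, the Lipschitz error on the good event plus the crude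
      bound off it.\<close>
    define c where "c = real j + 2 * B + 1"
    define d where "d = e / (4 * c)"
    have c: "0 < c" using B0 unfolding c_def by (smt (verit) of_nat_0_le_iff)
    have d: "0 < d" using e c by (simp add: d_def)
    have "d * (real j + 2 * B + 1) = e / 4" using c by (simp add: d_def flip: c_def)
    then have d_le: "real j * d + 2 * B * d \<le> e / 4" using d by (simp add: algebra_simps)
    have "eventually (\<lambda>m. (\<integral>\<omega>. h j \<omega> \<partial>N) - e / 4 < (\<integral>\<omega>. ?g j (A' m \<omega>) \<partial>N)) sequentially"
      using e by (intro order_tendstoD(1)[OF int_h]) auto
    from eventually_happens[OF eventually_conj[OF close[of "real j" d] this]] d
    obtain m where m: "(\<integral>\<omega>. h j \<omega> \<partial>N) - e / 4 < (\<integral>\<omega>. ?g j (A' m \<omega>) \<partial>N)"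
      "eventually (\<lambda>n. \<exists>G\<in>sets (M n). 1 - d \<le> measure (M n) G \<and>
         (\<forall>\<omega>\<in>G. \<forall>t\<in>{0..real j}. \<bar>Y n \<omega> t - A m n \<omega> t\<bar> \<le> d)) sequentially" by auto
    have "eventually (\<lambda>n. (\<integral>\<omega>. ?g j (A' m \<omega>) \<partial>N) - e / 4 < (\<integral>\<omega>. ?g j (A m n \<omega>) \<partial>M n)) sequentially"
      using e by (intro order_tendstoD(1)[OF conv[OF lip]]) auto
    with m(2) show ?thesis
    proof eventually_elim
      case (elim n)
      interpret Mn: prob_space "M n" by (rule M)
      from elim obtain G where G: "G \<in> sets (M n)" "1 - d \<le> measure (M n) G"
        "\<And>\<omega> t. \<omega> \<in> G \<Longrightarrow> t \<in> {0..real j} \<Longrightarrow> \<bar>Y n \<omega> t - A m n \<omega> t\<bar> \<le> d" by blast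
      let ?I = "indicator (space (M n) - G) :: 'a \<Rightarrow> real"
      have fY: "integrable (M n) (\<lambda>\<omega>. f (Y n \<omega>))"
        by (rule Mn.integrable_const_bound[of _ B])
          (use J1_continuous_measurable[OF f Y] bound Y in auto)
      have gA: "integrable (M n) (\<lambda>\<omega>. ?g j (A m n \<omega>))"
        by (rule Mn.integrable_const_bound[of _ B])
          (use A_meas[OF lip] lipschitz_functionalD(1)[OF lip A] in auto)
      have I: "integrable (M n) ?I" 
        by (rule Mn.integrable_const_bound[of _ 1]) (use G in \<open>auto simp: indicator_def\<close>)
      have "?g j (A m n \<omega>) \<le> f (Y n \<omega>) + real j * d + 2 * B * ?I \<omega>" if w: "\<omega> \<in> space (M n)" for \<omega>
      proof (cases "\<omega> \<in> G")
        case True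
        have "\<bar>?g j (A m n \<omega>) - ?g j (Y n \<omega>)\<bar> \<le> real j * d"
          using d G(3)[OF True] by (intro lipschitz_functionalD(2)[OF lip A Y(1)[OF w]]) (auto simp: abs_minus_commute)
        moreover have "?g j (Y n \<omega>) \<le> f (Y n \<omega>)"
          by (rule envelope_lower[OF bound]) (use Y w envelope_set_self in auto)
        ultimately show ?thesis using True by simp
      next
        case False
        have "?g j (A m n \<omega>) \<le> B" using lipschitz_functionalD(1)[OF lip A, of j m n \<omega>] by simp
        moreover have "- B \<le> f (Y n \<omega>)" using bound[OF Y(1)[OF w]] by simp
        moreover have "0 \<le> real j * d" using d by simp
        ultimately show ?thesis using False w by simp
      qed
      then have "(\<integral>\<omega>. ?g j (A m n \<omega>) \<partial>M n) \<le> (\<integral>\<omega>. f (Y n \<omega>) + real j * d + 2 * B * ?I \<omega> \<partial>M n)"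
        using fY gA I by (intro integral_mono) auto
      also have "\<dots> = (\<integral>\<omega>. f (Y n \<omega>) \<partial>M n) + real j * d + 2 * B * measure (M n) (space (M n) - G)"
      proof -
        have "(space (M n) - G) \<inter> space (M n) = space (M n) - G" by auto
        then show ?thesis using fY I by (simp add: Mn.prob_space)
      qed
      also have "measure (M n) (space (M n) - G) \<le> d" using Mn.prob_compl[OF G(1)] G(2) by simp
      finally have "(\<integral>\<omega>. ?g j (A m n \<omega>) \<partial>M n) \<le> (\<integral>\<omega>. f (Y n \<omega>) \<partial>M n) + real j * d + 2 * B * d"
        using B0 by (simp add: mult_left_mono)
      then show ?case using elim(2) m(1) j d_le by linarith
    qed
  qed
  show ?thesis unfolding weak_conv_D_def
  proof (intro allI impI, elim conjE)
    fix f :: "(real \<Rightarrow> real) \<Rightarrow> real" assume bdd: "bounded (f ` {x. cadlag x})" and f: "J1_continuous f"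
    from bdd obtain B where B: "\<And>x. cadlag x \<Longrightarrow> \<bar>f x\<bar> \<le> B" by (auto simp: bounded_iff)
    have f': "J1_continuous (\<lambda>x. - f x)" 
      unfolding J1_continuous_def by (intro allI impI tendsto_minus J1_continuousD[OF f]) auto
    show "(\<lambda>n. \<integral>\<omega>. f (Y n \<omega>) \<partial>M n) \<longlonglongrightarrow> (\<integral>\<omega>. f (Z \<omega>) \<partial>N)"
    proof (rule tendstoI)
      fix e :: real assume e: "0 < e"
      from lower[OF f B e] lower[OF f' _ e, of B] B
      have "eventually (\<lambda>n. (\<integral>\<omega>. f (Z \<omega>) \<partial>N) - e < (\<integral>\<omega>. f (Y n \<omega>) \<partial>M n)) sequentially"
        "eventually (\<lambda>n. (\<integral>\<omega>. - f (Z \<omega>) \<partial>N) - e < (\<integral>\<omega>. - f (Y n \<omega>) \<partial>M n)) sequentially" by auto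
      then show "eventually (\<lambda>n. dist (\<integral>\<omega>. f (Y n \<omega>) \<partial>M n) (\<integral>\<omega>. f (Z \<omega>) \<partial>N) < e) sequentially"
        by eventually_elim (simp add: dist_real_def abs_less_iff)
    qed
  qed
qed

section \<open>Triangular arrays and random walks\<close>

lemma abs_exp_minus_linear: 
  fixes y :: real
  assumes "0 \<le> y"
  shows "\<bar>exp (- y) - (1 - y)\<bar> \<le> y\<^sup>2"
proof -
  have "1 - y \<le> exp (- y)" using exp_ge_add_one_self[of "- y"] by simp
  moreover have "exp (- y) \<le> 1 / (1 + y)"
    using exp_ge_add_one_self[of y] assms by (simp add: exp_minus field_simps)
  moreover have "1 / (1 + y) \<le> 1 - y + y\<^sup>2"
  proof -
    have "(1 - y + y\<^sup>2) * (1 + y) = 1 + y ^ 3" by (simp add: algebra_simps power2_eq_square power3_eq_cube)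
    then show ?thesis using assms by (simp add: divide_le_eq)
  qed
  ultimately show ?thesis by (simp add: abs_le_iff)
qed

text \<open>Laws of the normalised interarrival times, abstracted so that both arrival streams share
  one limit theory. \<open>s n\<close> is a variance, and \<open>ui\<close> plays the role of the
  Lindeberg condition.\<close>

locale centred_laws =
  fixes \<nu> :: "nat \<Rightarrow> real measure" and s :: "nat \<Rightarrow> real" and s0 :: real
  assumes law: "\<And>n. real_distribution (\<nu> n)"
    and square_int: "\<And>n. integrable (\<nu> n) (\<lambda>x. x\<^sup>2)"
    and mean0: "\<And>n. (\<integral>x. x \<partial>\<nu> n) = 0"
    and second: "\<And>n. (\<integral>x. x\<^sup>2 \<partial>\<nu> n) = s n"
    and ui: "\<And>e. 0 < e \<Longrightarrow> \<exists>K\<ge>0. \<forall>n. (\<integral>x. x\<^sup>2 * indicator {x. K < \<bar>x\<bar>} x \<partial>\<nu> n) \<le> e"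
    and s_lim: "s \<longlonglongrightarrow> s0" and s0_pos: "0 < s0"
begin

lemma s_nonneg: "0 \<le> s n" unfolding second[symmetric] by (intro integral_nonneg_AE) auto

lemma integrable_id: "integrable (\<nu> n) (\<lambda>x. x)"
proof -
  interpret real_distribution "\<nu> n" by (rule law)
  show ?thesis by (rule square_integrable_imp_integrable[OF _ square_int]) simp
qed

text \<open>Both functions are compared with the quadratic
  \<open>1 - u\<^sup>2 * s n / 2\<close>.\<close>

lemma char_approx: "cmod (char (\<nu> n) u - exp (- (u\<^sup>2 * s n / 2))) \<le>
   u\<^sup>2 / 6 * (\<integral>x. min (6 * x\<^sup>2) (\<bar>u\<bar> * \<bar>x\<bar> ^ 3) \<partial>\<nu> n) + (u\<^sup>2 * s n / 2)\<^sup>2"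
proof -
  interpret real_distribution "\<nu> n" by (rule law)
  have "cmod (char (\<nu> n) u - (1 - u\<^sup>2 * s n / 2)) \<le> u\<^sup>2 / 6 * (\<integral>x. min (6 * x\<^sup>2) (\<bar>u\<bar> * \<bar>x\<bar> ^ 3) \<partial>\<nu> n)"
    using char_approx3[OF integrable_id mean0 square_int, of "s n" u] second by (simp add: mean0)
  moreover have "cmod ((1 - u\<^sup>2 * s n / 2) - exp (- (u\<^sup>2 * s n / 2))) \<le> (u\<^sup>2 * s n / 2)\<^sup>2"
  proof -
    have "(1 - u\<^sup>2 * s n / 2) - exp (- (u\<^sup>2 * s n / 2))
      = complex_of_real ((1 - u\<^sup>2 * s n / 2) - exp (- (u\<^sup>2 * s n / 2)))" by (simp add: exp_of_real)
    then have "cmod ((1 - u\<^sup>2 * s n / 2) - exp (- (u\<^sup>2 * s n / 2)))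
      = \<bar>exp (- (u\<^sup>2 * s n / 2)) - (1 - u\<^sup>2 * s n / 2)\<bar>"
      by (metis norm_of_real abs_minus_commute)
    then show ?thesis using abs_exp_minus_linear[of "u\<^sup>2 * s n / 2"] s_nonneg[of n] by simp
  qed
  ultimately show ?thesis
    using norm_triangle_ineq[of "char (\<nu> n) u - (1 - u\<^sup>2 * s n / 2)" "(1 - u\<^sup>2 * s n / 2) - exp (- (u\<^sup>2 * s n / 2))"]
    by (simp add: exp_of_real)
qed

text \<open>Lindeberg's splitting at a level \<open>K\<close>: above it the part
  \<open>6 * x\<^sup>2\<close> of the minimum is charged to uniform integrability, which uses
  \<open>6 * (e / 12)\<close>, and below it the cube is at most \<open>K * x\<^sup>2\<close>, so the
  factor \<open>u n\<close> makes it vanish.\<close>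

lemma truncated_third_moment:
  assumes u: "u \<longlonglongrightarrow> 0"
  shows "(\<lambda>n. \<integral>x. min (6 * x\<^sup>2) (\<bar>u n\<bar> * \<bar>x\<bar> ^ 3) \<partial>\<nu> n) \<longlonglongrightarrow> 0"
proof (rule tendstoI)
  fix e :: real assume e: "0 < e"
  then obtain K where K: "0 \<le> K" "\<And>n. (\<integral>x. x\<^sup>2 * indicator {x. K < \<bar>x\<bar>} x \<partial>\<nu> n) \<le> e / 12"
    using ui[of "e / 12"] by auto
  have "(\<lambda>n. \<bar>u n\<bar> * (K * s n)) \<longlonglongrightarrow> \<bar>0\<bar> * (K * s0)" by (intro tendsto_intros u s_lim)
  then have "eventually (\<lambda>n. \<bar>u n\<bar> * (K * s n) < e / 2) sequentially" using e by (intro order_tendstoD) auto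
  then show "eventually (\<lambda>n. dist (\<integral>x. min (6 * x\<^sup>2) (\<bar>u n\<bar> * \<bar>x\<bar> ^ 3) \<partial>\<nu> n) 0 < e) sequentially"
  proof eventually_elim
    case (elim n)
    interpret real_distribution "\<nu> n" by (rule law)
    let ?I = "\<lambda>x. x\<^sup>2 * indicator {x. K < \<bar>x\<bar>} x :: real"
    have I: "integrable (\<nu> n) ?I" by (rule Bochner_Integration.integrable_bound[OF square_int]) (auto simp: indicator_def)
    have min_int: "integrable (\<nu> n) (\<lambda>x. min (6 * x\<^sup>2) (\<bar>u n\<bar> * \<bar>x\<bar> ^ 3))"
      by (rule Bochner_Integration.integrable_bound[where f = "\<lambda>x. 6 * x\<^sup>2"]) (use square_int in auto)
    have le: "min (6 * x\<^sup>2) (\<bar>u n\<bar> * \<bar>x\<bar> ^ 3) \<le> 6 * ?I x + \<bar>u n\<bar> * K * x\<^sup>2" for x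
    proof (cases "K < \<bar>x\<bar>")
      case True
      have "0 \<le> \<bar>u n\<bar> * K * x\<^sup>2" using K by simp
      moreover have "min (6 * x\<^sup>2) (\<bar>u n\<bar> * \<bar>x\<bar> ^ 3) \<le> 6 * x\<^sup>2" by simp
      ultimately show ?thesis using True by simp
    next
      case False
      have "\<bar>x\<bar> ^ 3 = \<bar>x\<bar> * x\<^sup>2" by (simp add: power3_eq_cube power2_eq_square)
      also have "\<dots> \<le> K * x\<^sup>2" using False by (intro mult_right_mono) auto
      finally have "\<bar>u n\<bar> * \<bar>x\<bar> ^ 3 \<le> \<bar>u n\<bar> * (K * x\<^sup>2)" by (intro mult_left_mono) auto
      then show ?thesis using False by (simp add: mult.assoc)
    qed
    have "(\<integral>x. min (6 * x\<^sup>2) (\<bar>u n\<bar> * \<bar>x\<bar> ^ 3) \<partial>\<nu> n) \<le> (\<integral>x. 6 * ?I x + \<bar>u n\<bar> * K * x\<^sup>2 \<partial>\<nu> n)"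
      using le I square_int min_int by (intro integral_mono) auto
    also have "\<dots> = 6 * (\<integral>x. ?I x \<partial>\<nu> n) + \<bar>u n\<bar> * K * s n"
      using I square_int second by simp
    also have "\<dots> < e" using K(2)[of n] elim e by (simp add: mult.assoc)
    finally have "(\<integral>x. min (6 * x\<^sup>2) (\<bar>u n\<bar> * \<bar>x\<bar> ^ 3) \<partial>\<nu> n) < e" .
    moreover have "0 \<le> (\<integral>x. min (6 * x\<^sup>2) (\<bar>u n\<bar> * \<bar>x\<bar> ^ 3) \<partial>\<nu> n)" by (intro integral_nonneg_AE) auto
    ultimately show ?case by simp
  qed
qed

text \<open>Powers of numbers in the unit disc differ by at most the exponent times the difference
  of the bases. Here the exponent is of order \<open>n\<close> at most and the bases differ by
  \<open>o(1 / n)\<close>, since \<open>(u n)\<^sup>2 = t\<^sup>2 / n\<close>. The exponent is a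
  general \<open>k n\<close> because block lengths arise by rounding.\<close>

lemma char_power_tendsto:
  assumes k: "(\<lambda>n. real (k n) / real n) \<longlonglongrightarrow> d"
  shows "(\<lambda>n. char (\<nu> n) (t / sqrt (real n)) ^ k n) \<longlonglongrightarrow> complex_of_real (exp (- (t\<^sup>2 * s0 * d / 2)))"
proof -
  define u where "u n = t / sqrt (real n)" for n
  define m3 where "m3 n = (\<integral>x. min (6 * x\<^sup>2) (\<bar>u n\<bar> * \<bar>x\<bar> ^ 3) \<partial>\<nu> n)" for n
  have u: "u \<longlonglongrightarrow> 0" unfolding u_def
    by (intro tendsto_divide_0[OF tendsto_const] filterlim_at_top_imp_at_infinity
        filterlim_compose[OF sqrt_at_top filterlim_real_sequentially])
  have u2: "(u n)\<^sup>2 = t\<^sup>2 / real n" for n by (simp add: u_def power_divide)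
  have m3: "m3 \<longlonglongrightarrow> 0" unfolding m3_def using u by (rule truncated_third_moment)
  let ?E = "\<lambda>n. complex_of_real (exp (- ((u n)\<^sup>2 * s n / 2))) ^ k n"
  let ?b = "\<lambda>n. real (k n) / real n * (t\<^sup>2 / 6 * m3 n + t ^ 4 * (s n)\<^sup>2 / 4 * (1 / real n))"
  have bound: "norm (char (\<nu> n) (u n) ^ k n - ?E n) \<le> ?b n" for n
  proof -
    interpret real_distribution "\<nu> n" by (rule law)
    have "norm (char (\<nu> n) (u n) ^ k n - ?E n) \<le> k n * norm (char (\<nu> n) (u n) - complex_of_real (exp (- ((u n)\<^sup>2 * s n / 2))))"
      using s_nonneg by (intro norm_power_diff cmod_char_le_1) simp
    also have "\<dots> \<le> k n * ((u n)\<^sup>2 / 6 * m3 n + ((u n)\<^sup>2 * s n / 2)\<^sup>2)"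
      unfolding m3_def by (intro mult_left_mono char_approx) auto
    also have "\<dots> = ?b n" unfolding u2
      by (cases "n = 0") (auto simp: field_simps power2_eq_square power4_eq_xxxx)
    finally show ?thesis .
  qed
  have "?b \<longlonglongrightarrow> d * (t\<^sup>2 / 6 * 0 + t ^ 4 * s0\<^sup>2 / 4 * 0)"
    by (intro tendsto_intros k m3 s_lim lim_1_over_n) auto
  then have b0: "?b \<longlonglongrightarrow> 0" by simp
  have diff: "(\<lambda>n. char (\<nu> n) (u n) ^ k n - ?E n) \<longlonglongrightarrow> 0"
    by (rule Lim_null_comparison[OF _ b0]) (use bound in auto)
  have "(\<lambda>n. complex_of_real (exp (- (t\<^sup>2 * s n * (real (k n) / real n) / 2)))) \<longlonglongrightarrow> complex_of_real (exp (- (t\<^sup>2 * s0 * d / 2)))"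
    by (intro tendsto_intros s_lim k) auto
  moreover have "complex_of_real (exp (- (t\<^sup>2 * s n * (real (k n) / real n) / 2))) = ?E n" for n
    unfolding of_real_power[symmetric] u2 exp_of_nat_mult[symmetric] by (simp add: field_simps)
  ultimately have "?E \<longlonglongrightarrow> complex_of_real (exp (- (t\<^sup>2 * s0 * d / 2)))" by simp
  from tendsto_add[OF diff this] show ?thesis by (simp add: u_def)
qed

end

lemma (in prob_space) char_iid_sum:
  assumes "indep_vars (\<lambda>_. borel) X I" "\<And>i. i \<in> I \<Longrightarrow> distr M borel (X i) = \<nu>"
  shows "char (distr M borel (\<lambda>\<omega>. (\<Sum>i\<in>I. X i \<omega>) / c)) t = char \<nu> (t / c) ^ card I"
proof -
  have rv: "random_variable borel (X i)" if "i \<in> I" for i using assms that by (auto simp: indep_vars_def)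
  have sum: "(\<lambda>\<omega>. \<Sum>i\<in>I. X i \<omega>) \<in> borel_measurable M" using rv by measurable
  have "char (distr M borel (\<lambda>\<omega>. (\<Sum>i\<in>I. X i \<omega>) / c)) t = char (distr M borel (\<lambda>\<omega>. \<Sum>i\<in>I. X i \<omega>)) (t / c)"
    unfolding char_def using sum by (simp add: integral_distr mult.commute)
  also have "\<dots> = (\<Prod>i\<in>I. char (distr M borel (X i)) (t / c))" by (rule char_distr_sum[OF assms(1)])
  also have "\<dots> = char \<nu> (t / c) ^ card I" using assms(2) by simp
  finally show ?thesis .
qed

lemma (in prob_space) second_moment_indep_sum:
  fixes X :: "'i \<Rightarrow> 'a \<Rightarrow> real"
  assumes "finite I" "indep_vars (\<lambda>_. borel) X I"
    and "\<And>i. i \<in> I \<Longrightarrow> integrable M (\<lambda>\<omega>. (X i \<omega>)\<^sup>2)" and "\<And>i. i \<in> I \<Longrightarrow> expectation (X i) = 0"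
  shows "integrable M (\<lambda>\<omega>. (\<Sum>i\<in>I. X i \<omega>)\<^sup>2)"
    and "expectation (\<lambda>\<omega>. (\<Sum>i\<in>I. X i \<omega>)\<^sup>2) = (\<Sum>i\<in>I. expectation (\<lambda>\<omega>. (X i \<omega>)\<^sup>2))"
proof -
  have "integrable M (\<lambda>\<omega>. (\<Sum>i\<in>I. X i \<omega>)\<^sup>2) \<and>
     expectation (\<lambda>\<omega>. (\<Sum>i\<in>I. X i \<omega>)\<^sup>2) = (\<Sum>i\<in>I. expectation (\<lambda>\<omega>. (X i \<omega>)\<^sup>2))"
    using assms
  proof (induction I rule: finite_induct)
    case (insert i J)
    let ?S = "\<lambda>\<omega>. \<Sum>j\<in>J. X j \<omega>"
    have IH: "integrable M (\<lambda>\<omega>. (?S \<omega>)\<^sup>2)" "expectation (\<lambda>\<omega>. (?S \<omega>)\<^sup>2) = (\<Sum>i\<in>J. expectation (\<lambda>\<omega>. (X i \<omega>)\<^sup>2))"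
      using insert.IH insert.prems indep_vars_subset[OF insert.prems(1), of J] by auto
    have rv[measurable]: "random_variable borel (X j)" if "j \<in> insert i J" for j
      using insert.prems(1) that unfolding indep_vars_def by auto
    have X1: "integrable M (X j)" if "j \<in> insert i J" for j
      by (rule square_integrable_imp_integrable[OF rv[OF that] insert.prems(2)[OF that]])
    have S1: "integrable M ?S" using X1 by (intro Bochner_Integration.integrable_sum) auto
    have ind: "indep_var borel (X i) borel ?S" using insert.hyps insert.prems(1) by (intro indep_vars_sum) auto
    have XS: "integrable M (\<lambda>\<omega>. X i \<omega> * ?S \<omega>)" using indep_var_integrable[OF ind X1 S1] by simp
    have XS0: "expectation (\<lambda>\<omega>. X i \<omega> * ?S \<omega>) = 0"
      using indep_var_lebesgue_integral[OF ind X1 S1] insert.prems(3)[of i] by simp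
    have eq: "(\<Sum>j\<in>insert i J. X j \<omega>)\<^sup>2 = (X i \<omega>)\<^sup>2 + 2 * (X i \<omega> * ?S \<omega>) + (?S \<omega>)\<^sup>2" for \<omega>
      using insert.hyps by (simp add: power2_sum algebra_simps)
    have i2: "integrable M (\<lambda>\<omega>. (X i \<omega>)\<^sup>2)" using insert.prems(2) by simp
    show ?case unfolding eq using IH XS i2 XS0 insert.hyps by (simp add: sum.insert)
  qed (simp add: prob_space)
  then show "integrable M (\<lambda>\<omega>. (\<Sum>i\<in>I. X i \<omega>)\<^sup>2)"
    "expectation (\<lambda>\<omega>. (\<Sum>i\<in>I. X i \<omega>)\<^sup>2) = (\<Sum>i\<in>I. expectation (\<lambda>\<omega>. (X i \<omega>)\<^sup>2))" by auto
qed

text \<open>Decomposition over the first index with \<open>\<bar>S k\<bar> > 2 \<lambda>\<close>.\<close>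

lemma (in prob_space) ottaviani:
  fixes X :: "nat \<Rightarrow> 'a \<Rightarrow> real" and l :: real and a b :: nat
  defines "S \<equiv> \<lambda>k \<omega>. \<Sum>i\<in>{a<..k}. X i \<omega>"
  assumes ind: "indep_vars (\<lambda>_. borel) X {a<..b}"
    and half: "\<And>k. k \<in> {a..b} \<Longrightarrow> prob {\<omega>\<in>space M. l < \<bar>\<Sum>i\<in>{k<..b}. X i \<omega>\<bar>} \<le> 1 / 2"
  shows "prob {\<omega>\<in>space M. \<exists>k\<in>{a..b}. 2 * l < \<bar>S k \<omega>\<bar>} \<le> 2 * prob {\<omega>\<in>space M. l < \<bar>S b \<omega>\<bar>}"
proof -
  have rv: "random_variable borel (X i)" if "i \<in> {a<..b}" for i
    using ind that unfolding indep_vars_def by auto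
  have sum_rv: "(\<lambda>\<omega>. \<Sum>i\<in>{c<..d}. X i \<omega>) \<in> borel_measurable M" if "a \<le> c" "d \<le> b" for c d
    using that by (intro borel_measurable_sum rv) auto
  have S_rv: "S k \<in> borel_measurable M" if "k \<le> b" for k unfolding S_def using sum_rv[of a k] that by simp
  define A where "A k = {\<omega>\<in>space M. 2 * l < \<bar>S k \<omega>\<bar> \<and> (\<forall>j\<in>{a..<k}. \<bar>S j \<omega>\<bar> \<le> 2 * l)}" for k
  define B where "B k = {\<omega>\<in>space M. \<bar>\<Sum>i\<in>{k<..b}. X i \<omega>\<bar> \<le> l}" for k
  have A: "A k \<in> events" if "k \<in> {a..b}" for k
  proof -
    \<comment> \<open>Inserting \<open>a\<close> keeps the index set nonempty when
      \<open>k = a\<close>, as a finite intersection of events requires.\<close>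
    have e1: "A k = {\<omega>\<in>space M. 2 * l < \<bar>S k \<omega>\<bar>} \<inter> (\<Inter>j\<in>insert a {a..<k}. {\<omega>\<in>space M. j \<in> {a..<k} \<longrightarrow> \<bar>S j \<omega>\<bar> \<le> 2 * l})"
      by (auto simp: A_def)
    have e2: "{\<omega>\<in>space M. j \<in> {a..<k} \<longrightarrow> \<bar>S j \<omega>\<bar> \<le> 2 * l} \<in> events" for j
      using S_rv[of j] that by (cases "j \<in> {a..<k}") auto
    have e3: "{\<omega>\<in>space M. 2 * l < \<bar>S k \<omega>\<bar>} \<in> events" using S_rv[of k] that by auto
    show ?thesis unfolding e1 by (intro sets.Int sets.finite_INT e2 e3 finite.insertI finite_atLeastLessThan) blast
  qed
  have B: "B k \<in> events" if "k \<in> {a..b}" for k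
    unfolding B_def using sum_rv[of k b] that by auto
  have AB: "prob (A k \<inter> B k) = prob (A k) * prob (B k)" if k: "k \<in> {a..b}" for k
  proof -
    \<comment> \<open>\<open>A k\<close> depends on the variables up to \<open>k\<close> and
      \<open>B k\<close> on those after \<open>k\<close>. Both are written as preimages of sets in
      product spaces, the form in which independence of blocks of variables is available.\<close>
    let ?P = "\<lambda>I. Pi\<^sub>M I (\<lambda>_. borel :: real measure)"
    define A' where "A' = {x\<in>space (?P {a<..k}). 2 * l < \<bar>\<Sum>i\<in>{a<..k}. x i\<bar> \<and> (\<forall>j\<in>{a..<k}. \<bar>\<Sum>i\<in>{a<..j}. x i\<bar> \<le> 2 * l)}"
    define B' where "B' = {x\<in>space (?P {k<..b}). \<bar>\<Sum>i\<in>{k<..b}. x i\<bar> \<le> l}"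
    have sm: "(\<lambda>x. \<Sum>i\<in>{c<..d}. x i) \<in> borel_measurable (?P I)" if "{c<..d} \<subseteq> I" for c d I
      using that by (intro borel_measurable_sum measurable_component_singleton) auto
    have A': "A' \<in> sets (?P {a<..k})"
    proof -
      have e1: "A' = {x\<in>space (?P {a<..k}). 2 * l < \<bar>\<Sum>i\<in>{a<..k}. x i\<bar>} \<inter>
        (\<Inter>j\<in>insert a {a..<k}. {x\<in>space (?P {a<..k}). j \<in> {a..<k} \<longrightarrow> \<bar>\<Sum>i\<in>{a<..j}. x i\<bar> \<le> 2 * l})"
        by (auto simp: A'_def)
      have e2: "{x\<in>space (?P {a<..k}). j \<in> {a..<k} \<longrightarrow> \<bar>\<Sum>i\<in>{a<..j}. x i\<bar> \<le> 2 * l} \<in> sets (?P {a<..k})" for j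
        using sm[of a j "{a<..k}"] by (cases "j \<in> {a..<k}") auto
      have e3: "{x\<in>space (?P {a<..k}). 2 * l < \<bar>\<Sum>i\<in>{a<..k}. x i\<bar>} \<in> sets (?P {a<..k})"
        using sm[of a k "{a<..k}"] by auto
      show ?thesis unfolding e1 by (intro sets.Int sets.finite_INT e2 e3 finite.insertI finite_atLeastLessThan) blast
    qed
    have B': "B' \<in> sets (?P {k<..b})" unfolding B'_def using sm[of k b "{k<..b}"] by auto
    have "indep_var (?P {a<..k}) (\<lambda>\<omega>. restrict (\<lambda>i. X i \<omega>) {a<..k}) (?P {k<..b}) (\<lambda>\<omega>. restrict (\<lambda>i. X i \<omega>) {k<..b})"
      using k by (intro indep_var_restrict[OF ind]) auto
    from indep_varD[OF this A' B']
    have *: "prob ((\<lambda>\<omega>. (restrict (\<lambda>i. X i \<omega>) {a<..k}, restrict (\<lambda>i. X i \<omega>) {k<..b})) -` (A' \<times> B') \<inter> space M)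
      = prob ((\<lambda>\<omega>. restrict (\<lambda>i. X i \<omega>) {a<..k}) -` A' \<inter> space M) * prob ((\<lambda>\<omega>. restrict (\<lambda>i. X i \<omega>) {k<..b}) -` B' \<inter> space M)" .
    have r: "(\<Sum>i\<in>{c<..d}. restrict (\<lambda>i. X i \<omega>) I i) = (\<Sum>i\<in>{c<..d}. X i \<omega>)" if "{c<..d} \<subseteq> I" for c d I \<omega>
      using that by (intro sum.cong) auto
    have sA: "(restrict (\<lambda>i. X i \<omega>) {a<..k} \<in> A') \<longleftrightarrow> (2 * l < \<bar>S k \<omega>\<bar> \<and> (\<forall>j\<in>{a..<k}. \<bar>S j \<omega>\<bar> \<le> 2 * l))" for \<omega>
    proof -
      have "(\<Sum>i\<in>{a<..j}. restrict (\<lambda>i. X i \<omega>) {a<..k} i) = S j \<omega>" if "j \<le> k" for j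
        using that unfolding S_def by (intro r) auto
      then show ?thesis unfolding A'_def by (auto simp: space_PiM)
    qed
    have sB: "(restrict (\<lambda>i. X i \<omega>) {k<..b} \<in> B') \<longleftrightarrow> \<bar>\<Sum>i\<in>{k<..b}. X i \<omega>\<bar> \<le> l" for \<omega>
      unfolding B'_def by (auto simp: space_PiM r)
    show ?thesis using * unfolding A_def B_def by (simp add: vimage_def sA sB Int_def conj_ac)
  qed
  have "prob {\<omega>\<in>space M. \<exists>k\<in>{a..b}. 2 * l < \<bar>S k \<omega>\<bar>} \<le> prob (\<Union>k\<in>{a..b}. A k)"
  proof (rule finite_measure_mono)
    show "{\<omega>\<in>space M. \<exists>k\<in>{a..b}. 2 * l < \<bar>S k \<omega>\<bar>} \<subseteq> (\<Union>k\<in>{a..b}. A k)"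
    proof
      fix \<omega> assume w: "\<omega> \<in> {\<omega>\<in>space M. \<exists>k\<in>{a..b}. 2 * l < \<bar>S k \<omega>\<bar>}"
      define k where "k = (LEAST k. k \<in> {a..b} \<and> 2 * l < \<bar>S k \<omega>\<bar>)"
      have k: "k \<in> {a..b} \<and> 2 * l < \<bar>S k \<omega>\<bar>" unfolding k_def by (rule LeastI_ex) (use w in blast)
      have "\<bar>S j \<omega>\<bar> \<le> 2 * l" if j: "j \<in> {a..<k}" for j
        using not_less_Least[of j "\<lambda>k. k \<in> {a..b} \<and> 2 * l < \<bar>S k \<omega>\<bar>"] j k unfolding k_def[symmetric] by force
      then show "\<omega> \<in> (\<Union>k\<in>{a..b}. A k)" using k w unfolding A_def by blast
    qed
  qed (use A in auto)
  also have "\<dots> \<le> (\<Sum>k\<in>{a..b}. prob (A k))" using A by (intro finite_measure_subadditive_finite) auto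
  also have "\<dots> \<le> (\<Sum>k\<in>{a..b}. 2 * prob (A k \<inter> B k))"
  proof (rule sum_mono)
    fix k assume k: "k \<in> {a..b}"
    have "space M - B k = {\<omega>\<in>space M. l < \<bar>\<Sum>i\<in>{k<..b}. X i \<omega>\<bar>}" by (auto simp: B_def)
    then have "1 - prob (B k) \<le> 1 / 2" using half[OF k] prob_compl[OF B[OF k]] by simp
    then have "1 \<le> 2 * prob (B k)" by simp
    then have "prob (A k) * 1 \<le> prob (A k) * (2 * prob (B k))" by (intro mult_left_mono) auto
    then show "prob (A k) \<le> 2 * prob (A k \<inter> B k)" unfolding AB[OF k] by simp
  qed
  also have "\<dots> = 2 * (\<Sum>k\<in>{a..b}. prob (A k \<inter> B k))" by (simp add: sum_distrib_left)
  also have "(\<Sum>k\<in>{a..b}. prob (A k \<inter> B k)) = prob (\<Union>k\<in>{a..b}. A k \<inter> B k)"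
  proof (rule finite_measure_finite_Union[symmetric])
    have lt: "A i \<inter> A j = {}" if "i < j" "i \<in> {a..b}" for i j
    proof -
      have "i \<in> {a..<j}" using that by auto
      then show ?thesis unfolding A_def by force
    qed
    have "A i \<inter> A j = {}" if "i \<noteq> j" "i \<in> {a..b}" "j \<in> {a..b}" for i j
      using that lt[of i j] lt[of j i] by (cases "i < j") (auto simp: Int_commute)
    then show "disjoint_family_on (\<lambda>k. A k \<inter> B k) {a..b}" unfolding disjoint_family_on_def by blast
  qed (use A B in auto)
  also have "\<dots> \<le> prob {\<omega>\<in>space M. l < \<bar>S b \<omega>\<bar>}"
  proof (rule finite_measure_mono)
    show "(\<Union>k\<in>{a..b}. A k \<inter> B k) \<subseteq> {\<omega>\<in>space M. l < \<bar>S b \<omega>\<bar>}"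
    proof
      fix \<omega> assume "\<omega> \<in> (\<Union>k\<in>{a..b}. A k \<inter> B k)"
      then obtain k where k: "k \<in> {a..b}" "\<omega> \<in> A k" "\<omega> \<in> B k" by blast
      have "S b \<omega> = S k \<omega> + (\<Sum>i\<in>{k<..b}. X i \<omega>)"
        unfolding S_def using k by (subst sum.union_disjoint[symmetric]) (auto intro!: sum.cong)
      then show "\<omega> \<in> {\<omega>\<in>space M. l < \<bar>S b \<omega>\<bar>}" using k by (auto simp: A_def B_def)
    qed
  qed (use S_rv[of b] in auto)
  finally show ?thesis by simp
qed

text \<open>The fourth power gives block probabilities quadratic in the block length
  \<open>d\<close>, so that about \<open>1 / d\<close> blocks contribute only order
  \<open>d\<close>; a second-moment bound would not become small. The minimum with 1 makes the
  function a bounded test function that still dominates the indicator of a tail.\<close>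

lemma integral_min_fourth_std_normal:
  assumes c: "0 < c"
  shows "(\<integral>x. min 1 ((x / c) ^ 4) \<partial>std_normal_distribution) \<le> 3 / c ^ 4"
proof -
  interpret real_distribution std_normal_distribution by (rule real_dist_normal_dist)
  have i4: "integrable std_normal_distribution (\<lambda>x. x ^ 4)" and e4: "(\<integral>x. x ^ 4 \<partial>std_normal_distribution) = 3"
    using integrable_std_normal_distribution_moment[of 4] std_normal_distribution_even_moments[of 2]
    by (auto simp: fact_numeral)
  have "(\<integral>x. min 1 ((x / c) ^ 4) \<partial>std_normal_distribution) \<le> (\<integral>x. x ^ 4 / c ^ 4 \<partial>std_normal_distribution)"
  proof (rule integral_mono)
    show "integrable std_normal_distribution (\<lambda>x. min 1 ((x / c) ^ 4))"
      by (rule integrable_const_bound[of _ 1]) auto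
  qed (use i4 in \<open>auto simp: power_divide\<close>)
  also have "\<dots> = 3 / c ^ 4" by (simp add: e4)
  finally show ?thesis .
qed

context centred_laws
begin

lemma normalized_sum_weak_conv:
  fixes X :: "nat \<Rightarrow> 'i \<Rightarrow> 'a \<Rightarrow> real"
  assumes M: "\<And>n. prob_space (M n)" and ind: "\<And>n. prob_space.indep_vars (M n) (\<lambda>_. borel) (X n) (I n)"
    and law_X: "\<And>n i. i \<in> I n \<Longrightarrow> distr (M n) borel (X n i) = \<nu> n"
    and card: "(\<lambda>n. real (card (I n)) / real n) \<longlonglongrightarrow> d" and d: "0 < d"
  shows "weak_conv_m (\<lambda>n. distr (M n) borel (\<lambda>\<omega>. (\<Sum>i\<in>I n. X n i \<omega>) / (sqrt (real n) * sqrt (s0 * d)))) std_normal_distribution"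
proof (rule levy_continuity)
  fix n
  interpret prob_space "M n" by (rule M)
  have "random_variable borel (X n i)" if "i \<in> I n" for i using ind[of n] that by (auto simp: indep_vars_def)
  then have "(\<lambda>\<omega>. (\<Sum>i\<in>I n. X n i \<omega>) / (sqrt (real n) * sqrt (s0 * d))) \<in> borel_measurable (M n)"
    by (intro borel_measurable_divide borel_measurable_sum) auto
  then show "real_distribution (distr (M n) borel (\<lambda>\<omega>. (\<Sum>i\<in>I n. X n i \<omega>) / (sqrt (real n) * sqrt (s0 * d))))"
    by (rule real_distribution_distr)
next
  fix t
  have "char (distr (M n) borel (\<lambda>\<omega>. (\<Sum>i\<in>I n. X n i \<omega>) / (sqrt (real n) * sqrt (s0 * d)))) t
     = char (\<nu> n) (t / sqrt (s0 * d) / sqrt (real n)) ^ card (I n)" for n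
    using prob_space.char_iid_sum[OF M ind law_X, of n] by (simp add: mult.commute)
  moreover have "(\<lambda>n. char (\<nu> n) (t / sqrt (s0 * d) / sqrt (real n)) ^ card (I n)) \<longlonglongrightarrow>
     complex_of_real (exp (- ((t / sqrt (s0 * d))\<^sup>2 * s0 * d / 2)))" by (rule char_power_tendsto[OF card])
  moreover have "(t / sqrt (s0 * d))\<^sup>2 * s0 * d = t\<^sup>2"
    using s0_pos d by (simp add: power_divide field_simps)
  ultimately show "(\<lambda>n. char (distr (M n) borel (\<lambda>\<omega>. (\<Sum>i\<in>I n. X n i \<omega>) / (sqrt (real n) * sqrt (s0 * d)))) t)
     \<longlonglongrightarrow> char std_normal_distribution t" by (simp add: char_std_normal_distribution)
qed (rule real_dist_normal_dist)

text \<open>The summands have only two moments, so a bound of fourth order is taken from the normal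
  limit by testing weak convergence with \<open>min 1 ((x / c) ^ 4)\<close> up to scale. The
  constant 6 in place of the Gaussian 3 leaves the strict inequality that makes it hold
  eventually.\<close>

lemma eventually_sum_tail:
  fixes X :: "nat \<Rightarrow> 'i \<Rightarrow> 'a \<Rightarrow> real"
  assumes M: "\<And>n. prob_space (M n)" and ind: "\<And>n. prob_space.indep_vars (M n) (\<lambda>_. borel) (X n) (I n)"
    and law_X: "\<And>n i. i \<in> I n \<Longrightarrow> distr (M n) borel (X n i) = \<nu> n"
    and card: "(\<lambda>n. real (card (I n)) / real n) \<longlonglongrightarrow> d" and d: "0 < d" and c: "0 < c"
  shows "eventually (\<lambda>n. measure (M n) {\<omega>\<in>space (M n). c * sqrt (real n) < \<bar>\<Sum>i\<in>I n. X n i \<omega>\<bar>} \<le> 6 * (s0 * d)\<^sup>2 / c ^ 4) sequentially"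
proof -
  define r where "r = sqrt (s0 * d)"
  have r: "0 < r" using s0_pos d by (simp add: r_def)
  have r4: "r ^ 4 = (s0 * d)\<^sup>2"
  proof -
    have "r ^ 4 = (r\<^sup>2)\<^sup>2" by simp
    then show ?thesis using s0_pos d by (simp add: r_def)
  qed
  define \<mu> where "\<mu> n = distr (M n) borel (\<lambda>\<omega>. (\<Sum>i\<in>I n. X n i \<omega>) / (sqrt (real n) * r))" for n
  have rv: "(\<lambda>\<omega>. \<Sum>i\<in>I n. X n i \<omega>) \<in> borel_measurable (M n)" for n
  proof -
    interpret prob_space "M n" by (rule M)
    show ?thesis using ind[of n] by (intro borel_measurable_sum) (auto simp: indep_vars_def)
  qed
  have \<mu>: "real_distribution (\<mu> n)" for n
    unfolding \<mu>_def by (intro prob_space.real_distribution_distr M borel_measurable_divide rv) auto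
  let ?g = "\<lambda>x::real. min 1 ((x / (c / r)) ^ 4)"
  have "weak_conv_m \<mu> std_normal_distribution"
    unfolding \<mu>_def r_def by (rule normalized_sum_weak_conv[OF M ind law_X card d])
  then have "(\<lambda>n. \<integral>x. ?g x \<partial>\<mu> n) \<longlonglongrightarrow> (\<integral>x. ?g x \<partial>std_normal_distribution)"
    by (rule weak_conv_imp_integral_bdd_continuous_conv[OF \<mu> real_dist_normal_dist, where B = 1])
      (use c r in \<open>auto intro!: continuous_intros\<close>)
  moreover have "(\<integral>x. ?g x \<partial>std_normal_distribution) < 6 * (s0 * d)\<^sup>2 / c ^ 4"
  proof -
    have "(\<integral>x. ?g x \<partial>std_normal_distribution) \<le> 3 / (c / r) ^ 4"
      using c r by (intro integral_min_fourth_std_normal) simp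
    also have "\<dots> < 6 * r ^ 4 / c ^ 4" using c r by (simp add: power_divide divide_strict_right_mono)
    finally show ?thesis by (simp add: r4)
  qed
  ultimately have "eventually (\<lambda>n. (\<integral>x. ?g x \<partial>\<mu> n) < 6 * (s0 * d)\<^sup>2 / c ^ 4) sequentially"
    by (rule order_tendstoD(2))
  then show ?thesis using eventually_gt_at_top[of 0]
  proof eventually_elim
    case (elim n)
    interpret prob_space "M n" by (rule M)
    let ?S = "\<lambda>\<omega>. \<Sum>i\<in>I n. X n i \<omega>"
    let ?A = "{\<omega>\<in>space (M n). c * sqrt (real n) < \<bar>?S \<omega>\<bar>}"
    have A: "?A \<in> events" using rv[of n] by measurable
    have "prob ?A = (\<integral>\<omega>. indicator ?A \<omega> \<partial>M n)" using A by simp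
    also have "\<dots> \<le> (\<integral>\<omega>. ?g (?S \<omega> / (sqrt (real n) * r)) \<partial>M n)"
    proof (rule integral_mono)
      show "integrable (M n) (indicat_real ?A)" using A by (intro integrable_const_bound[of _ 1]) auto
      show "integrable (M n) (\<lambda>\<omega>. ?g (?S \<omega> / (sqrt (real n) * r)))"
        using rv[of n] by (intro integrable_const_bound[of _ 1]) auto
      fix \<omega> assume "\<omega> \<in> space (M n)"
      show "indicator ?A \<omega> \<le> ?g (?S \<omega> / (sqrt (real n) * r))"
      proof (cases "\<omega> \<in> ?A")
        case True
        have "?S \<omega> / (sqrt (real n) * r) / (c / r) = ?S \<omega> / (c * sqrt (real n))" using r by (simp add: field_simps)
        moreover have "1 \<le> (?S \<omega> / (c * sqrt (real n))) ^ 4"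
        proof -
          have "1 \<le> \<bar>?S \<omega> / (c * sqrt (real n))\<bar>" using True c elim by (simp add: field_simps abs_mult)
          then have "1 \<le> \<bar>?S \<omega> / (c * sqrt (real n))\<bar> ^ 4" by simp
          also have "\<dots> = (?S \<omega> / (c * sqrt (real n))) ^ 4" by (rule power_even_abs) simp
          finally show ?thesis .
        qed
        ultimately show ?thesis using True by simp
      qed simp
    qed
    also have "\<dots> = (\<integral>x. ?g x \<partial>\<mu> n)" unfolding \<mu>_def using rv[of n] by (subst integral_distr) auto
    finally show ?case using elim by simp
  qed
qed

text \<open>Ottaviani's inequality doubles the tail bound of the full block sum. Its hypothesis that
  every remaining sum be small with probability one half is Chebyshev's inequality, and
  \<open>small\<close> is the condition for this in the limit.\<close>

lemma eventually_block_oscillation: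
  fixes X :: "nat \<Rightarrow> nat \<Rightarrow> 'a \<Rightarrow> real" and a b :: "nat \<Rightarrow> nat"
  assumes M: "\<And>n. prob_space (M n)" and ind: "\<And>n. prob_space.indep_vars (M n) (\<lambda>_. borel) (X n) {a n<..b n}"
    and law_X: "\<And>n i. i \<in> {a n<..b n} \<Longrightarrow> distr (M n) borel (X n i) = \<nu> n"
    and len: "(\<lambda>n. real (b n - a n) / real n) \<longlonglongrightarrow> d" and d: "0 < d" and c: "0 < c" and small: "2 * s0 * d < c\<^sup>2"
  shows "eventually (\<lambda>n. measure (M n) {\<omega>\<in>space (M n). \<exists>k\<in>{a n..b n}. 2 * c * sqrt (real n) < \<bar>\<Sum>i\<in>{a n<..k}. X n i \<omega>\<bar>}
     \<le> 12 * (s0 * d)\<^sup>2 / c ^ 4) sequentially"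
proof -
  have card: "(\<lambda>n. real (card {a n<..b n}) / real n) \<longlonglongrightarrow> d" using len by simp
  have "(\<lambda>n. real (b n - a n) / real n * s n) \<longlonglongrightarrow> d * s0" by (intro tendsto_intros len s_lim)
  moreover have "d * s0 < c\<^sup>2 / 2" using small by (simp add: mult_ac)
  ultimately have "eventually (\<lambda>n. real (b n - a n) / real n * s n < c\<^sup>2 / 2) sequentially" by (rule order_tendstoD(2))
  moreover have "eventually (\<lambda>n. measure (M n) {\<omega>\<in>space (M n). c * sqrt (real n) < \<bar>\<Sum>i\<in>{a n<..b n}. X n i \<omega>\<bar>}
     \<le> 6 * (s0 * d)\<^sup>2 / c ^ 4) sequentially"
    by (rule eventually_sum_tail[OF M ind law_X card d c])
  ultimately show ?thesis using eventually_gt_at_top[of 0]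
  proof eventually_elim
    case (elim n)
    interpret prob_space "M n" by (rule M)
    have rv: "random_variable borel (X n i)" if "i \<in> {a n<..b n}" for i
      using ind[of n] that by (auto simp: indep_vars_def)
    have moments: "integrable (M n) (\<lambda>\<omega>. (X n i \<omega>)\<^sup>2)" "expectation (X n i) = 0" "expectation (\<lambda>\<omega>. (X n i \<omega>)\<^sup>2) = s n"
      if i: "i \<in> {a n<..b n}" for i
    proof -
      show "integrable (M n) (\<lambda>\<omega>. (X n i \<omega>)\<^sup>2)"
        using square_int[of n] unfolding law_X[OF i, symmetric] by (subst (asm) integrable_distr_eq) (use rv[OF i] in auto)
      show "expectation (X n i) = 0"
        using mean0[of n] unfolding law_X[OF i, symmetric] by (subst (asm) integral_distr) (use rv[OF i] in auto)
      show "expectation (\<lambda>\<omega>. (X n i \<omega>)\<^sup>2) = s n"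
        using second[of n] unfolding law_X[OF i, symmetric] by (subst (asm) integral_distr) (use rv[OF i] in auto)
    qed
    have half: "prob {\<omega>\<in>space (M n). c * sqrt (real n) < \<bar>\<Sum>i\<in>{k<..b n}. X n i \<omega>\<bar>} \<le> 1 / 2" if k: "k \<in> {a n..b n}" for k
    proof -
      let ?S = "\<lambda>\<omega>. \<Sum>i\<in>{k<..b n}. X n i \<omega>"
      have sub: "{k<..b n} \<subseteq> {a n<..b n}" using k by auto
      have S2: "integrable (M n) (\<lambda>\<omega>. (?S \<omega>)\<^sup>2)" "expectation (\<lambda>\<omega>. (?S \<omega>)\<^sup>2) = (\<Sum>i\<in>{k<..b n}. expectation (\<lambda>\<omega>. (X n i \<omega>)\<^sup>2))"
        by (rule second_moment_indep_sum[OF _ indep_vars_subset[OF ind sub]]; use moments(1,2) sub in auto)+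
      have rvS: "?S \<in> borel_measurable (M n)" using rv sub by (intro borel_measurable_sum) auto
      have "(\<Sum>i\<in>{k<..b n}. expectation (\<lambda>\<omega>. (X n i \<omega>)\<^sup>2)) = real (b n - k) * s n"
        using moments(3) sub by (subst sum.cong[OF refl, of _ _ "\<lambda>_. s n"]) auto
      also have "\<dots> \<le> real (b n - a n) * s n" using k s_nonneg by (intro mult_right_mono) auto
      finally have le: "expectation (\<lambda>\<omega>. (?S \<omega>)\<^sup>2) \<le> real (b n - a n) * s n" using S2 by simp
      have "prob {\<omega>\<in>space (M n). c * sqrt (real n) < \<bar>?S \<omega>\<bar>} \<le> prob {\<omega>\<in>space (M n). c\<^sup>2 * real n \<le> (?S \<omega>)\<^sup>2}"
      proof (rule finite_measure_mono)
        show "{\<omega>\<in>space (M n). c * sqrt (real n) < \<bar>?S \<omega>\<bar>} \<subseteq> {\<omega>\<in>space (M n). c\<^sup>2 * real n \<le> (?S \<omega>)\<^sup>2}"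
        proof safe
          fix \<omega> assume "c * sqrt (real n) < \<bar>?S \<omega>\<bar>"
          then have "(c * sqrt (real n))\<^sup>2 \<le> \<bar>?S \<omega>\<bar>\<^sup>2" using c by (intro power_mono) auto
          then show "c\<^sup>2 * real n \<le> (?S \<omega>)\<^sup>2" by (simp add: power_mult_distrib)
        qed
      qed (use rvS in measurable)
      also have "\<dots> \<le> expectation (\<lambda>\<omega>. (?S \<omega>)\<^sup>2) / (c\<^sup>2 * real n)"
        using c elim by (intro integral_Markov_inequality_measure[OF S2(1), where A = "{}"]) auto
      also have "\<dots> \<le> real (b n - a n) * s n / (c\<^sup>2 * real n)" using le c by (intro divide_right_mono) auto
      also have "\<dots> = (real (b n - a n) / real n * s n) / c\<^sup>2" by simp
      also have "\<dots> \<le> (c\<^sup>2 / 2) / c\<^sup>2" using elim c by (intro divide_right_mono) auto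
      also have "\<dots> = 1 / 2" using c by simp
      finally show ?thesis .
    qed
    have "prob {\<omega>\<in>space (M n). \<exists>k\<in>{a n..b n}. 2 * (c * sqrt (real n)) < \<bar>\<Sum>i\<in>{a n<..k}. X n i \<omega>\<bar>}
       \<le> 2 * prob {\<omega>\<in>space (M n). c * sqrt (real n) < \<bar>\<Sum>i\<in>{a n<..b n}. X n i \<omega>\<bar>}"
      by (rule ottaviani[OF ind half])
    then show ?case using elim by (simp add: mult.assoc)
  qed
qed

text \<open>The indices up to \<open>K * n\<close> are cut into blocks of length about
  \<open>\<delta> * n\<close>. Each block oscillates too much with probability of order
  \<open>\<delta>\<^sup>2\<close>, there are of order \<open>1 / \<delta>\<close> blocks, and two
  indices within \<open>\<delta> * n\<close> lie in the same block or in adjacent ones.\<close>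

theorem walk_tightness:
  fixes X :: "nat \<Rightarrow> nat \<Rightarrow> 'a \<Rightarrow> real"
  defines "D \<equiv> \<lambda>n k \<omega>. \<Sum>i\<in>{1..k}. X n i \<omega>"
  assumes M: "\<And>n. prob_space (M n)" and ind: "\<And>n. prob_space.indep_vars (M n) (\<lambda>_. borel) (X n) {1..}"
    and law_X: "\<And>n i. 1 \<le> i \<Longrightarrow> distr (M n) borel (X n i) = \<nu> n"
    and K: "0 \<le> K" and e: "0 < e" and \<eta>: "0 < \<eta>"
  obtains \<delta> where "0 < \<delta>"
    "eventually (\<lambda>n. \<exists>G\<in>sets (M n). 1 - \<eta> \<le> measure (M n) G \<and> (\<forall>\<omega>\<in>G. \<forall>i j.
        real i \<le> K * real n \<longrightarrow> real j \<le> K * real n \<longrightarrow> \<bar>real i - real j\<bar> \<le> \<delta> * real n \<longrightarrow>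
        \<bar>D n i \<omega> - D n j \<omega>\<bar> \<le> e * sqrt (real n))) sequentially"
proof -
  \<comment> \<open>Three oscillations of at most \<open>2 * c\<close> from block starts are added
    below.\<close>
  define c where "c = e / 6"
  have c: "0 < c" using e by (simp add: c_def)
  define C where "C = 12 * s0\<^sup>2 / c ^ 4"
  have C: "0 < C" using s0_pos c by (simp add: C_def)
  \<comment> \<open>The three terms serve the count of blocks, the hypothesis \<open>small\<close>
    of the block estimate, and the union bound.\<close>
  define \<delta> where "\<delta> = min 1 (min (c\<^sup>2 / (4 * s0)) (\<eta> / (C * (K + 3))))"
  have \<delta>: "0 < \<delta>" "\<delta> \<le> 1" using c s0_pos C K \<eta> by (auto simp: \<delta>_def)
  have small: "2 * s0 * \<delta> < c\<^sup>2"
  proof -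
    have "\<delta> \<le> c\<^sup>2 / (4 * s0)" by (simp add: \<delta>_def)
    then have "4 * s0 * \<delta> \<le> c\<^sup>2" using s0_pos by (simp add: field_simps)
    moreover have "0 < s0 * \<delta>" using s0_pos \<delta> by simp
    ultimately show ?thesis by linarith
  qed
  have \<delta>_C: "(K + 3) * C * \<delta> \<le> \<eta>"
  proof -
    have "\<delta> \<le> \<eta> / (C * (K + 3))" by (simp add: \<delta>_def)
    then have "\<delta> * (C * (K + 3)) \<le> \<eta>" using C K by (subst (asm) pos_le_divide_eq) auto
    then show ?thesis by (simp add: mult_ac)
  qed
  define l where "l n = nat \<lceil>\<delta> * real n\<rceil>" for n
  \<comment> \<open>Block numbers up to \<open>J\<close> cover all indices up to
    \<open>K * n\<close>; together with \<open>\<delta> \<le> 1\<close> the number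
    \<open>J + 1\<close> of blocks stays below \<open>(K + 3) / \<delta>\<close>.\<close>
  define J where "J = nat \<lceil>K / \<delta>\<rceil> + 1"
  have l_ge: "\<delta> * real n \<le> real (l n)" and l_le: "real (l n) \<le> \<delta> * real n + 1" for n
    using \<delta> by (auto simp: l_def)
  have J: "K / \<delta> + 1 \<le> real J" "real J \<le> K / \<delta> + 2"
    using K \<delta> divide_nonneg_pos[OF K \<delta>(1)] unfolding J_def by linarith+
  have l_lim: "(\<lambda>n. real (l n) / real n) \<longlonglongrightarrow> \<delta>"
  proof (rule tendsto_sandwich[of "\<lambda>_. \<delta>" _ _ "\<lambda>n. \<delta> + 1 / real n"])
    show "eventually (\<lambda>n. \<delta> \<le> real (l n) / real n) sequentially"
      using eventually_gt_at_top[of 0] by eventually_elim (use l_ge in \<open>auto simp: field_simps\<close>)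
    show "eventually (\<lambda>n. real (l n) / real n \<le> \<delta> + 1 / real n) sequentially"
      using eventually_gt_at_top[of 0] by eventually_elim (use l_le in \<open>auto simp: field_simps\<close>)
    show "(\<lambda>n. \<delta> + 1 / real n) \<longlonglongrightarrow> \<delta>" using tendsto_add[OF tendsto_const lim_1_over_n, of \<delta>] by simp
  qed simp
  define F where "F n b = {\<omega>\<in>space (M n). \<exists>k\<in>{b * l n..Suc b * l n}. 2 * c * sqrt (real n) < \<bar>\<Sum>i\<in>{b * l n<..k}. X n i \<omega>\<bar>}" for n b
  have ev: "eventually (\<lambda>n. \<forall>b\<in>{..J}. measure (M n) (F n b) \<le> C * \<delta>\<^sup>2) sequentially"
  proof (rule eventually_ball_finite)
    show "\<forall>b\<in>{..J}. eventually (\<lambda>n. measure (M n) (F n b) \<le> C * \<delta>\<^sup>2) sequentially"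
    proof
      fix b assume "b \<in> {..J}"
      have sub: "{b * l n<..Suc b * l n} \<subseteq> {1..}" for n by auto
      have "eventually (\<lambda>n. measure (M n) (F n b) \<le> 12 * (s0 * \<delta>)\<^sup>2 / c ^ 4) sequentially"
        unfolding F_def
        by (rule eventually_block_oscillation[OF M prob_space.indep_vars_subset[OF M ind sub] _ _ \<delta>(1) c small])
          (use law_X l_lim in auto)
      then show "eventually (\<lambda>n. measure (M n) (F n b) \<le> C * \<delta>\<^sup>2) sequentially"
        by (simp add: C_def power_mult_distrib mult.assoc)
    qed
  qed simp
  have F_meas: "F n b \<in> sets (M n)" for n b
  proof -
    interpret prob_space "M n" by (rule M)
    have rv: "random_variable borel (X n i)" if "1 \<le> i" for i using ind[of n] that by (auto simp: indep_vars_def)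
    have "(\<lambda>\<omega>. \<Sum>i\<in>{b * l n<..k}. X n i \<omega>) \<in> borel_measurable (M n)" for k
      by (intro borel_measurable_sum rv) auto
    then show ?thesis unfolding F_def by measurable
  qed
  show ?thesis
  proof (rule that[OF \<delta>(1)])
    show "eventually (\<lambda>n. \<exists>G\<in>sets (M n). 1 - \<eta> \<le> measure (M n) G \<and> (\<forall>\<omega>\<in>G. \<forall>i j.
        real i \<le> K * real n \<longrightarrow> real j \<le> K * real n \<longrightarrow> \<bar>real i - real j\<bar> \<le> \<delta> * real n \<longrightarrow>
        \<bar>D n i \<omega> - D n j \<omega>\<bar> \<le> e * sqrt (real n))) sequentially"
      using ev eventually_gt_at_top[of 0]
    proof eventually_elim
      case (elim n)
      interpret prob_space "M n" by (rule M)
      define G where "G = space (M n) - (\<Union>b\<in>{..J}. F n b)"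
      have U: "(\<Union>b\<in>{..J}. F n b) \<in> events" using F_meas by auto
      have "prob (\<Union>b\<in>{..J}. F n b) \<le> (\<Sum>b\<in>{..J}. prob (F n b))"
        using F_meas by (intro finite_measure_subadditive_finite) auto
      also have "\<dots> \<le> (\<Sum>b\<in>{..J}. C * \<delta>\<^sup>2)" using elim by (intro sum_mono) auto
      also have "\<dots> = (real J + 1) * (C * \<delta>\<^sup>2)" by simp
      also have "\<dots> \<le> ((K + 3) / \<delta>) * (C * \<delta>\<^sup>2)"
      proof (rule mult_right_mono)
        have "3 \<le> 3 / \<delta>" using \<delta> by (simp add: field_simps)
        then show "real J + 1 \<le> (K + 3) / \<delta>" using J by (simp add: add_divide_distrib)
      qed (use C in simp)
      also have "\<dots> = (K + 3) * C * \<delta>" using \<delta> by (simp add: power2_eq_square)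
      finally have "prob (\<Union>b\<in>{..J}. F n b) \<le> \<eta>" using \<delta>_C by linarith
      then have PG: "1 - \<eta> \<le> prob G" unfolding G_def using prob_compl[OF U] by simp
      have l0: "0 < l n" using elim \<delta> by (simp add: l_def)
      have main: "\<bar>D n j \<omega> - D n i \<omega>\<bar> \<le> e * sqrt (real n)"
        if w: "\<omega> \<in> G" and ij: "i \<le> j" "real j \<le> K * real n" "real j - real i \<le> \<delta> * real n" for \<omega> i j
      proof -
        have blk: "\<bar>D n k \<omega> - D n (b * l n) \<omega>\<bar> \<le> 2 * c * sqrt (real n)"
          if "b \<le> J" "b * l n \<le> k" "k \<le> Suc b * l n" for b k
        proof -
          have "\<omega> \<notin> F n b" "\<omega> \<in> space (M n)" using w that by (auto simp: G_def)
          then have "\<bar>\<Sum>i\<in>{b * l n<..k}. X n i \<omega>\<bar> \<le> 2 * c * sqrt (real n)"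
            using that unfolding F_def by (auto simp: not_less)
          moreover have "D n k \<omega> = D n (b * l n) \<omega> + (\<Sum>i\<in>{b * l n<..k}. X n i \<omega>)"
            unfolding D_def using that by (subst sum.union_disjoint[symmetric]) (auto intro!: sum.cong)
          ultimately show ?thesis by simp
        qed
        define b where "b = i div l n"
        define b' where "b' = j div l n"
        have bi: "b * l n \<le> i" "i < Suc b * l n" and bj: "b' * l n \<le> j" "j < Suc b' * l n"
          using l0 div_mult_mod_eq[of i "l n"] div_mult_mod_eq[of j "l n"] mod_less_divisor[OF l0, of i] mod_less_divisor[OF l0, of j]
          unfolding b_def b'_def mult_Suc by linarith+
        have "real j \<le> (K / \<delta>) * (\<delta> * real n)" using ij \<delta> by simp
        also have "\<dots> \<le> real J * real (l n)" using J l_ge[of n] K \<delta> by (intro mult_mono) auto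
        finally have "j \<le> J * l n" by (metis of_nat_le_iff of_nat_mult)
        then have b'J: "b' \<le> J" unfolding b'_def using l0 by (metis div_le_mono nonzero_mult_div_cancel_right less_not_refl)
        have bb': "b \<le> b'" unfolding b_def b'_def using ij by (simp add: div_le_mono)
        \<comment> \<open>A block is at least \<open>\<delta> * n\<close> long, so the block numbers
          of \<open>i\<close> and \<open>j\<close> differ by at most one.\<close>
        have "real j \<le> real i + real (l n)" using ij l_ge[of n] by linarith
        then have "j \<le> i + l n" by linarith
        then have "b' * l n < (b + 2) * l n" using bj bi by simp
        then have "b' < b + 2" by (metis mult_less_cancel2)
        with bb' consider "b' = b" | "b' = Suc b" by linarith
        then have "\<bar>D n j \<omega> - D n i \<omega>\<bar> \<le> 3 * (2 * c * sqrt (real n))"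
        proof cases
          case 1
          have "\<bar>D n i \<omega> - D n (b * l n) \<omega>\<bar> \<le> 2 * c * sqrt (real n)" "\<bar>D n j \<omega> - D n (b * l n) \<omega>\<bar> \<le> 2 * c * sqrt (real n)"
            using blk[of b i] blk[of b j] bi bj b'J 1 by auto
          moreover have "0 \<le> 2 * c * sqrt (real n)" using c by simp
          ultimately show ?thesis by linarith
        next
          case 2
          have "\<bar>D n i \<omega> - D n (b * l n) \<omega>\<bar> \<le> 2 * c * sqrt (real n)" "\<bar>D n (b' * l n) \<omega> - D n (b * l n) \<omega>\<bar> \<le> 2 * c * sqrt (real n)"
            "\<bar>D n j \<omega> - D n (b' * l n) \<omega>\<bar> \<le> 2 * c * sqrt (real n)"
            using blk[of b i] blk[of b "b' * l n"] blk[of b' j] bi bj b'J 2 by auto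
          then show ?thesis by linarith
        qed
        then show ?thesis by (simp add: c_def)
      qed
      have "\<bar>D n i \<omega> - D n j \<omega>\<bar> \<le> e * sqrt (real n)"
        if "\<omega> \<in> G" "real i \<le> K * real n" "real j \<le> K * real n" "\<bar>real i - real j\<bar> \<le> \<delta> * real n" for \<omega> i j
        using main[of \<omega> i j] main[of \<omega> j i] that by (cases "i \<le> j") (auto simp: abs_minus_commute)
      moreover have "G \<in> events" using U by (auto simp: G_def)
      ultimately show ?case using PG by blast
    qed
  qed
qed

end

section \<open>Poisson processes\<close>

text \<open>The variance of the Poisson law from its factorial moments: a factor \<open>k\<close>
  cancels against the factorial and shifts the series by one index.\<close>

lemma poisson_sums:
  fixes y :: real
  shows "(\<lambda>k. (real k - y)\<^sup>2 * (y ^ k / fact k * exp (- y))) sums y"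
proof -
  define f where "f k = y ^ k / fact k" for k :: nat
  have f: "f sums exp y" unfolding f_def using exp_converges[of y] by (simp add: scaleR_conv_of_real field_simps)
  have fS: "real (Suc k) * f (Suc k) = y * f k" for k by (simp add: f_def del: of_nat_Suc)
  have f1: "(\<lambda>k. real k * f k) sums (y * exp y)"
  proof -
    have "(\<lambda>k. real (Suc k) * f (Suc k)) = (\<lambda>k. y * f k)" by (simp only: fS)
    moreover have "(\<lambda>k. y * f k) sums (y * exp y)" by (intro sums_mult f)
    ultimately show ?thesis using sums_Suc_iff[of "\<lambda>k. real k * f k" "y * exp y"] by simp
  qed
  have f2: "(\<lambda>k. real k * (real k - 1) * f k) sums (y\<^sup>2 * exp y)"
  proof -
    have "(\<lambda>k. real (Suc k) * (real (Suc k) - 1) * f (Suc k)) = (\<lambda>k. y * (real k * f k))"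
    proof
      fix k
      have "real (Suc k) * (real (Suc k) - 1) * f (Suc k) = real k * (real (Suc k) * f (Suc k))" by simp
      also have "\<dots> = y * (real k * f k)" unfolding fS by simp
      finally show "real (Suc k) * (real (Suc k) - 1) * f (Suc k) = y * (real k * f k)" .
    qed
    moreover have "(\<lambda>k. y * (real k * f k)) sums (y * (y * exp y))" by (intro sums_mult f1)
    ultimately show ?thesis
      using sums_Suc_iff[of "\<lambda>k. real k * (real k - 1) * f k" "y * (y * exp y)"] by (simp add: power2_eq_square mult.assoc)
  qed
  have "(\<lambda>k. real k * (real k - 1) * f k + (1 - 2 * y) * (real k * f k) + y\<^sup>2 * f k) sums
      (y\<^sup>2 * exp y + (1 - 2 * y) * (y * exp y) + y\<^sup>2 * exp y)"
    by (intro sums_add sums_mult f f1 f2)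
  then have "(\<lambda>k. exp (- y) * (real k * (real k - 1) * f k + (1 - 2 * y) * (real k * f k) + y\<^sup>2 * f k)) sums
      (exp (- y) * (y\<^sup>2 * exp y + (1 - 2 * y) * (y * exp y) + y\<^sup>2 * exp y))" by (rule sums_mult)
  moreover have "exp (- y) * (y\<^sup>2 * exp y + (1 - 2 * y) * (y * exp y) + y\<^sup>2 * exp y) = y"
  proof -
    have "exp (- y) * (y\<^sup>2 * exp y + (1 - 2 * y) * (y * exp y) + y\<^sup>2 * exp y) = y * (exp (- y) * exp y)"
      by (simp add: algebra_simps power2_eq_square)
    then show ?thesis by (simp flip: exp_add)
  qed
  moreover have "exp (- y) * (real k * (real k - 1) * f k + (1 - 2 * y) * (real k * f k) + y\<^sup>2 * f k)
     = (real k - y)\<^sup>2 * (y ^ k / fact k * exp (- y))" for k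
    unfolding f_def[symmetric] by (simp add: algebra_simps power2_eq_square)
  ultimately show ?thesis by simp
qed

text \<open>Chebyshev's inequality with variance \<open>y\<close>. For \<open>y\<close> of order
  \<open>sqrt n\<close> and a deviation of order \<open>sqrt n\<close> the bound is of order
  \<open>1 / sqrt n\<close>, which is why the departures contribute no noise in the limit.\<close>

lemma poisson_process_deviation:
  assumes P: "unit_poisson_process M P" and y: "0 < y" and a: "0 < a"
  shows "measure M {\<omega>\<in>space M. a < \<bar>real (P \<omega> y) - y\<bar>} \<le> y / a\<^sup>2"
proof -
  interpret prob_space M using P by (simp add: unit_poisson_process_def)
  have rv[measurable]: "(\<lambda>\<omega>. P \<omega> t) \<in> measurable M (count_space UNIV)" for t
    using P by (simp add: unit_poisson_process_def)
  have P0: "AE \<omega> in M. P \<omega> 0 = 0"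
  proof -
    have "AE \<omega> in M. P \<omega> 0 = 0 \<and> mono_on {0..} (P \<omega>) \<and> (\<forall>t\<ge>0. ((\<lambda>s. real (P \<omega> s)) \<longlongrightarrow> real (P \<omega> t)) (at_right t))"
      using P by (simp add: unit_poisson_process_def)
    then show ?thesis by eventually_elim simp
  qed
  have pk: "prob {\<omega>\<in>space M. P \<omega> y = k} = y ^ k / fact k * exp (- y)" for k
  proof -
    have "\<forall>s t k. 0 \<le> s \<and> s < t \<longrightarrow> measure M {\<omega> \<in> space M. real (P \<omega> t) - real (P \<omega> s) = real k} = (t - s) ^ k / fact k * exp (- (t - s))"
      using P by (simp add: unit_poisson_process_def)
    from this[rule_format, of 0 y k] y
    have "prob {\<omega>\<in>space M. real (P \<omega> y) - real (P \<omega> 0) = real k} = y ^ k / fact k * exp (- y)" by simp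
    \<comment> \<open>The law is given for increments, and the process starts at 0 only almost
      surely.\<close>
    also have "prob {\<omega>\<in>space M. real (P \<omega> y) - real (P \<omega> 0) = real k} = prob {\<omega>\<in>space M. P \<omega> y = k}"
      using P0 by (intro finite_measure_eq_AE) auto
    finally show ?thesis .
  qed
  have dist: "distr M (count_space UNIV) (\<lambda>\<omega>. P \<omega> y) = measure_pmf (poisson_pmf y)"
  proof (rule measure_eqI_countable[of _ UNIV])
    fix k :: nat
    have "emeasure (distr M (count_space UNIV) (\<lambda>\<omega>. P \<omega> y)) {k} = emeasure M ((\<lambda>\<omega>. P \<omega> y) -` {k} \<inter> space M)"
      by (rule emeasure_distr) auto
    also have "(\<lambda>\<omega>. P \<omega> y) -` {k} \<inter> space M = {\<omega>\<in>space M. P \<omega> y = k}" by auto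
    also have "emeasure M \<dots> = ennreal (pmf (poisson_pmf y) k)"
      unfolding emeasure_eq_measure pk pmf_poisson[OF y] ..
    finally show "emeasure (distr M (count_space UNIV) (\<lambda>\<omega>. P \<omega> y)) {k} = emeasure (measure_pmf (poisson_pmf y)) {k}"
      by (simp add: emeasure_pmf_single)
  qed auto
  have "(\<integral>\<^sup>+\<omega>. ennreal ((real (P \<omega> y) - y)\<^sup>2) \<partial>M) = (\<integral>\<^sup>+k. ennreal ((real k - y)\<^sup>2) \<partial>distr M (count_space UNIV) (\<lambda>\<omega>. P \<omega> y))"
    by (subst nn_integral_distr) auto
  also have "\<dots> = (\<integral>\<^sup>+k. ennreal (pmf (poisson_pmf y) k) * ennreal ((real k - y)\<^sup>2) \<partial>count_space UNIV)"
    unfolding dist by (rule nn_integral_measure_pmf)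
  also have "\<dots> = (\<Sum>k. ennreal ((real k - y)\<^sup>2 * (y ^ k / fact k * exp (- y))))"
    unfolding nn_integral_count_space_nat using y
    by (intro suminf_cong) (simp add: pmf_poisson ennreal_mult'[symmetric] mult.commute)
  also have "\<dots> = ennreal y"
    by (rule suminf_ennreal_eq[OF _ poisson_sums]) (use y in auto)
  finally have m2: "(\<integral>\<^sup>+\<omega>. ennreal ((real (P \<omega> y) - y)\<^sup>2) \<partial>M) = ennreal y" .
  then have int: "integrable M (\<lambda>\<omega>. (real (P \<omega> y) - y)\<^sup>2)" by (intro integrableI_nonneg) auto
  have Em: "expectation (\<lambda>\<omega>. (real (P \<omega> y) - y)\<^sup>2) = y"
    using m2 y by (subst integral_eq_nn_integral) auto
  have "prob {\<omega>\<in>space M. a < \<bar>real (P \<omega> y) - y\<bar>} \<le> prob {\<omega>\<in>space M. a\<^sup>2 \<le> (real (P \<omega> y) - y)\<^sup>2}"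
  proof (rule finite_measure_mono)
    show "{\<omega>\<in>space M. a < \<bar>real (P \<omega> y) - y\<bar>} \<subseteq> {\<omega>\<in>space M. a\<^sup>2 \<le> (real (P \<omega> y) - y)\<^sup>2}"
    proof safe
      fix \<omega> assume "a < \<bar>real (P \<omega> y) - y\<bar>"
      then have "a\<^sup>2 \<le> \<bar>real (P \<omega> y) - y\<bar>\<^sup>2" using a by (intro power_mono) auto
      then show "a\<^sup>2 \<le> (real (P \<omega> y) - y)\<^sup>2" by simp
    qed
  qed measurable
  also have "\<dots> \<le> expectation (\<lambda>\<omega>. (real (P \<omega> y) - y)\<^sup>2) / a\<^sup>2"
    using a by (intro integral_Markov_inequality_measure[OF int, where A = "{}"]) auto
  finally show ?thesis unfolding Em .
qed

text \<open>Monotone paths reduce uniform closeness to finitely many grid points.\<close>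

lemma poisson_process_uniform:
  assumes P: "\<And>n. unit_poisson_process (M n) (P n)" and C: "0 < C" and e: "0 < e" and \<eta>: "0 < \<eta>"
  shows "eventually (\<lambda>n. \<exists>G\<in>sets (M n). 1 - \<eta> \<le> measure (M n) G \<and> (\<forall>\<omega>\<in>G. \<forall>y.
      0 \<le> y \<longrightarrow> y \<le> C * sqrt (real n) \<longrightarrow> \<bar>real (P n \<omega> y) - y\<bar> \<le> e * sqrt (real n))) sequentially"
proof -
  \<comment> \<open>With \<open>J\<close> grid cells the spacing is at most
    \<open>e / 2 * r\<close>; the other \<open>e / 2 * r\<close> is the error allowed at grid
    points.\<close>
  obtain J :: nat where J: "2 * C / e < real J" using reals_Archimedean2 by blast
  have J0: "0 < J" using J C e by (cases J) (auto simp: divide_less_0_iff)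
  have CJ: "C / J \<le> e / 2" using J J0 e by (simp add: field_simps)
  \<comment> \<open>The union bound over \<open>J\<close> grid points, each with argument at most
    \<open>C * r\<close> and allowed deviation \<open>e / 2 * r\<close>, where
    \<open>r = sqrt n\<close>.\<close>
  have "(\<lambda>n. 4 * J * C / e\<^sup>2 * (1 / sqrt (real n))) \<longlonglongrightarrow> 4 * J * C / e\<^sup>2 * 0"
    by (intro tendsto_intros tendsto_divide_0[OF tendsto_const] filterlim_at_top_imp_at_infinity
        filterlim_compose[OF sqrt_at_top filterlim_real_sequentially])
  then have "eventually (\<lambda>n. 4 * J * C / e\<^sup>2 * (1 / sqrt (real n)) < \<eta>) sequentially"
    using \<eta> by (intro order_tendstoD(2)) auto
  then show ?thesis using eventually_gt_at_top[of 0]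
  proof eventually_elim
    case (elim n)
    interpret prob_space "M n" using P[of n] by (simp add: unit_poisson_process_def)
    define r where "r = sqrt (real n)"
    have r: "0 < r" "r * r = real n" using elim by (auto simp: r_def)
    define z where "z j = real j * (C * r / J)" for j
    have rv[measurable]: "(\<lambda>\<omega>. P n \<omega> t) \<in> measurable (M n) (count_space UNIV)" for t
      using P[of n] by (simp add: unit_poisson_process_def)
    have "AE \<omega> in M n. P n \<omega> 0 = 0 \<and> mono_on {0..} (P n \<omega>) \<and> (\<forall>t\<ge>0. ((\<lambda>s. real (P n \<omega> s)) \<longlongrightarrow> real (P n \<omega> t)) (at_right t))"
      using P[of n] by (simp add: unit_poisson_process_def)
    then obtain N where N: "N \<in> null_sets (M n)" "\<And>\<omega>. \<omega> \<in> space (M n) - N \<Longrightarrow> P n \<omega> 0 = 0 \<and> mono_on {0..} (P n \<omega>)"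
      by (elim AE_E3) blast
    define F where "F j = {\<omega>\<in>space (M n). e / 2 * r < \<bar>real (P n \<omega> (z j)) - z j\<bar>}" for j
    have F: "F j \<in> events" for j unfolding F_def by measurable
    define G where "G = space (M n) - (N \<union> (\<Union>j\<in>{1..J}. F j))"
    have U: "N \<union> (\<Union>j\<in>{1..J}. F j) \<in> events" using N F by auto
    have pF: "prob (F j) \<le> 4 * C / e\<^sup>2 * (1 / r)" if "j \<in> {1..J}" for j
    proof -
      have zj: "0 < z j" using that C r J0 by (simp add: z_def)
      have "z j \<le> real J * (C * r / J)" unfolding z_def using that C r J0 by (intro mult_right_mono) auto
      then have zC: "z j \<le> C * r" using J0 by simp
      have "prob (F j) \<le> z j / (e / 2 * r)\<^sup>2" unfolding F_def
        using e r by (intro poisson_process_deviation[OF P zj]) auto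
      also have "\<dots> \<le> C * r / (e / 2 * r)\<^sup>2" by (intro divide_right_mono zC) auto
      also have "\<dots> = 4 * C / e\<^sup>2 * (1 / r)" using r(1) e by (simp add: field_simps power2_eq_square)
      finally show ?thesis .
    qed
    have "prob (N \<union> (\<Union>j\<in>{1..J}. F j)) \<le> prob N + prob (\<Union>j\<in>{1..J}. F j)"
      using N F by (intro measure_Un_le) auto
    also have "prob N = 0" using N by (simp add: measure_eq_0_null_sets)
    also have "prob (\<Union>j\<in>{1..J}. F j) \<le> (\<Sum>j\<in>{1..J}. prob (F j))"
      using F by (intro finite_measure_subadditive_finite) auto
    also have "\<dots> \<le> (\<Sum>j\<in>{1..J}. 4 * C / e\<^sup>2 * (1 / r))" by (intro sum_mono pF)
    also have "\<dots> = 4 * J * C / e\<^sup>2 * (1 / r)" by simp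
    also have "\<dots> < \<eta>" using elim by (simp add: r_def)
    finally have "1 - \<eta> \<le> prob G" unfolding G_def using prob_compl[OF U] by simp
    moreover have "G \<in> events" using U by (auto simp: G_def)
    moreover have "\<bar>real (P n \<omega> y) - y\<bar> \<le> e * r" if w: "\<omega> \<in> G" and y: "0 \<le> y" "y \<le> C * r" for \<omega> y
    proof -
      have P0: "P n \<omega> 0 = 0" and mono: "mono_on {0..} (P n \<omega>)" using N(2)[of \<omega>] w by (auto simp: G_def)
      have grid: "\<bar>real (P n \<omega> (z j)) - z j\<bar> \<le> e / 2 * r" if "j \<le> J" for j
      proof (cases "j = 0")
        case True
        then show ?thesis using P0 e r by (simp add: z_def)
      next
        case False
        then have "\<omega> \<notin> F j" "\<omega> \<in> space (M n)" using w that by (auto simp: G_def)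
        then show ?thesis by (auto simp: F_def not_less)
      qed
      define h where "h = C * r / J"
      have h: "0 < h" using C r J0 by (simp add: h_def)
      have hz: "z j = real j * h" for j by (simp add: z_def h_def)
      have h_le: "h \<le> e / 2 * r" using mult_right_mono[OF CJ, of r] r by (simp add: h_def)
      have Jh: "real J * h = C * r" using J0 by (simp add: h_def)
      define j where "j = nat \<lfloor>y / h\<rfloor>"
      have "0 \<le> y / h" using y h by simp
      then have "real j \<le> y / h" "y / h < real j + 1" unfolding j_def by linarith+
      then have j: "z j \<le> y" "y < z (Suc j)" using h by (auto simp: hz field_simps)
      have zj0: "0 \<le> z j" using h by (simp add: hz)
      have "real j * h \<le> real J * h" using j(1) y Jh by (simp add: hz)
      then have jJ: "j \<le> J" using h by simp
      have low: "z j - e / 2 * r \<le> real (P n \<omega> y)"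
      proof -
        have "P n \<omega> (z j) \<le> P n \<omega> y" using j zj0 y by (intro mono_onD[OF mono]) auto
        then show ?thesis using grid[OF jJ] by linarith
      qed
      have "z (Suc j) = z j + h" by (simp add: hz algebra_simps)
      have up: "real (P n \<omega> y) \<le> z j + h + e / 2 * r"
      \<comment> \<open>There is no grid point after \<open>z J\<close>, but then \<open>y\<close>
        is \<open>z J\<close> itself.\<close>
      proof (cases "j = J")
        case True
        then have "y = z J" using j y Jh by (simp add: hz)
        then show ?thesis using abs_le_D1[OF grid[of J]] True h by simp
      next
        case False
        have "P n \<omega> y \<le> P n \<omega> (z (Suc j))" using j y by (intro mono_onD[OF mono]) auto
        moreover have "\<bar>real (P n \<omega> (z (Suc j))) - z (Suc j)\<bar> \<le> e / 2 * r" using False jJ by (intro grid) auto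
        ultimately show ?thesis using \<open>z (Suc j) = z j + h\<close> by linarith
      qed
      show ?thesis using low up j h_le \<open>z (Suc j) = z j + h\<close> unfolding abs_le_iff by (auto simp: field_simps)
    qed
    ultimately show ?case unfolding r_def by blast
  qed
qed

section \<open>Independent sequences\<close>

text \<open>Used to combine representations that live on a separate probability space for each
  coordinate.\<close>

lemma distr_PiM_coordinatewise:
  fixes \<Omega> :: "'i \<Rightarrow> 'a measure" and f :: "'i \<Rightarrow> 'a \<Rightarrow> 'b"
  assumes \<Omega>: "\<And>i. prob_space (\<Omega> i)" and f: "\<And>i. f i \<in> measurable (\<Omega> i) (Q i)"
  shows "distr (Pi\<^sub>M UNIV \<Omega>) (Pi\<^sub>M UNIV Q) (\<lambda>\<omega> i. f i (\<omega> i)) = Pi\<^sub>M UNIV (\<lambda>i. distr (\<Omega> i) (Q i) (f i))"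
proof -
  interpret P: prob_space "Pi\<^sub>M UNIV \<Omega>" by (intro prob_space_PiM \<Omega>)
  have comp: "distr (Pi\<^sub>M UNIV \<Omega>) (\<Omega> i) (\<lambda>\<omega>. \<omega> i) = \<Omega> i" for i
    by (rule distr_PiM_component) (use \<Omega> in auto)
  have "P.indep_vars \<Omega> (\<lambda>i \<omega>. \<omega> i) UNIV"
  proof (subst P.indep_vars_iff_distr_eq_PiM)
    show "distr (Pi\<^sub>M UNIV \<Omega>) (Pi\<^sub>M UNIV \<Omega>) (\<lambda>\<omega>. \<lambda>i\<in>UNIV. \<omega> i) = Pi\<^sub>M UNIV (\<lambda>i. distr (Pi\<^sub>M UNIV \<Omega>) (\<Omega> i) (\<lambda>\<omega>. \<omega> i))"
      
      unfolding comp by (simp add: restrict_def distr_id)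
  qed (auto intro: measurable_component_singleton)
  then have "P.indep_vars Q (\<lambda>i \<omega>. f i (\<omega> i)) UNIV" by (rule P.indep_vars_compose2) (use f in auto)
  moreover have "(\<lambda>\<omega>. f i (\<omega> i)) \<in> measurable (Pi\<^sub>M UNIV \<Omega>) (Q i)" for i
    by (rule measurable_compose[OF measurable_component_singleton[of i UNIV \<Omega>] f[of i]]) auto
  ultimately have "distr (Pi\<^sub>M UNIV \<Omega>) (Pi\<^sub>M UNIV Q) (\<lambda>\<omega>. \<lambda>i\<in>UNIV. f i (\<omega> i)) = Pi\<^sub>M UNIV (\<lambda>i. distr (Pi\<^sub>M UNIV \<Omega>) (Q i) (\<lambda>\<omega>. f i (\<omega> i)))"
    by (subst (asm) P.indep_vars_iff_distr_eq_PiM) auto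
  moreover have "distr (Pi\<^sub>M UNIV \<Omega>) (Q i) (\<lambda>\<omega>. f i (\<omega> i)) = distr (\<Omega> i) (Q i) (f i)" for i
  proof -
    have "distr (\<Omega> i) (Q i) (f i) = distr (distr (Pi\<^sub>M UNIV \<Omega>) (\<Omega> i) (\<lambda>\<omega>. \<omega> i)) (Q i) (f i)" unfolding comp ..
    also have "\<dots> = distr (Pi\<^sub>M UNIV \<Omega>) (Q i) (\<lambda>\<omega>. f i (\<omega> i))"
      by (subst distr_distr[OF f]) (auto simp: comp_def)
    finally show ?thesis ..
  qed
  ultimately show ?thesis by (simp add: restrict_def)
qed

lemma (in prob_space) integral_indep_sequence:
  fixes x :: "nat \<Rightarrow> 'a \<Rightarrow> real" and h :: "(nat \<Rightarrow> real) \<Rightarrow> real"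
  assumes ind: "indep_vars (\<lambda>_. borel) x UNIV" and h: "h \<in> borel_measurable (Pi\<^sub>M UNIV (\<lambda>_. borel))"
  shows "(\<integral>\<omega>. h (\<lambda>k. x k \<omega>) \<partial>M) = (\<integral>v. h v \<partial>Pi\<^sub>M UNIV (\<lambda>k. distr M borel (x k)))"
proof -
  have rv: "x k \<in> borel_measurable M" for k using ind by (auto simp: indep_vars_def)
  have meas: "(\<lambda>\<omega> k. x k \<omega>) \<in> measurable M (Pi\<^sub>M UNIV (\<lambda>_. borel))"
    by (intro measurable_PiM_single') (use rv in auto)
  have "(\<lambda>\<omega>. \<lambda>k\<in>UNIV. x k \<omega>) = (\<lambda>\<omega> k. x k \<omega>)" by (simp add: restrict_def)
  then have "distr M (Pi\<^sub>M UNIV (\<lambda>_. borel)) (\<lambda>\<omega> k. x k \<omega>) = Pi\<^sub>M UNIV (\<lambda>k. distr M borel (x k))"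
    using ind indep_vars_iff_distr_eq_PiM[of UNIV x "\<lambda>_. borel"] rv by simp
  then show ?thesis using integral_distr[OF meas h] by simp
qed

text \<open>Coordinatewise Skorohod representations on a product space replace a multivariate
  continuity theorem.\<close>

lemma indep_sequences_weak_conv:
  fixes \<xi> :: "nat \<Rightarrow> nat \<Rightarrow> 'a \<Rightarrow> real" and \<zeta> :: "nat \<Rightarrow> 'b \<Rightarrow> real" and h :: "(nat \<Rightarrow> real) \<Rightarrow> real"
  assumes M: "\<And>n. prob_space (M n)" and N: "prob_space N"
    and \<xi>: "\<And>n. prob_space.indep_vars (M n) (\<lambda>_. borel) (\<xi> n) UNIV"
    and \<zeta>: "prob_space.indep_vars N (\<lambda>_. borel) \<zeta> UNIV"
    and conv: "\<And>k. weak_conv_m (\<lambda>n. distr (M n) borel (\<xi> n k)) (distr N borel (\<zeta> k))"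
    and h: "h \<in> borel_measurable (Pi\<^sub>M UNIV (\<lambda>_. borel))"
      "\<And>vs v. (\<And>k. (\<lambda>j. vs j k) \<longlonglongrightarrow> v k) \<Longrightarrow> (\<lambda>j. h (vs j)) \<longlonglongrightarrow> h v"
    and bound: "\<And>v. \<bar>h v\<bar> \<le> B"
  shows "(\<lambda>n. \<integral>\<omega>. h (\<lambda>k. \<xi> n k \<omega>) \<partial>M n) \<longlonglongrightarrow> (\<integral>\<omega>. h (\<lambda>k. \<zeta> k \<omega>) \<partial>N)"
proof -
  let ?P = "Pi\<^sub>M UNIV (\<lambda>_::nat. borel :: real measure)"
  have \<xi>_rv: "\<xi> n k \<in> borel_measurable (M n)" for n k using \<xi>[of n] M[of n] by (auto simp: prob_space.indep_vars_def)
  have \<zeta>_rv: "\<zeta> k \<in> borel_measurable N" for k using \<zeta> N by (auto simp: prob_space.indep_vars_def)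
  have "\<exists>(\<Omega> :: real measure) Yn Y. prob_space \<Omega> \<and> (\<forall>n. Yn n \<in> measurable \<Omega> borel) \<and>
     (\<forall>n. distr \<Omega> borel (Yn n) = distr (M n) borel (\<xi> n k)) \<and> Y \<in> measurable \<Omega> lborel \<and>
     distr \<Omega> borel Y = distr N borel (\<zeta> k) \<and> (\<forall>x\<in>space \<Omega>. (\<lambda>n. Yn n x) \<longlonglongrightarrow> Y x)" for k
    using Skorohod[OF _ _ conv[of k]] prob_space.real_distribution_distr[OF M \<xi>_rv] prob_space.real_distribution_distr[OF N \<zeta>_rv]
    by auto
  then obtain \<Omega> :: "nat \<Rightarrow> real measure" and Yn Y where \<Omega>: "\<And>k. prob_space (\<Omega> k)"
    and Yn: "\<And>k n. Yn k n \<in> borel_measurable (\<Omega> k)" "\<And>k n. distr (\<Omega> k) borel (Yn k n) = distr (M n) borel (\<xi> n k)"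
    and Y: "\<And>k. Y k \<in> borel_measurable (\<Omega> k)" "\<And>k. distr (\<Omega> k) borel (Y k) = distr N borel (\<zeta> k)"
    and lim: "\<And>k x. x \<in> space (\<Omega> k) \<Longrightarrow> (\<lambda>n. Yn k n x) \<longlonglongrightarrow> Y k x" by (simp add: measurable_lborel1) metis
  \<comment> \<open>On the product space the coordinates are independent with the prescribed
    marginals, so the sequences keep their joint laws, while convergence now holds at every point in
    every coordinate. Only expectations are compared, so this change of space is harmless.\<close>
  interpret P: prob_space "Pi\<^sub>M UNIV \<Omega>" by (intro prob_space_PiM \<Omega>)
  have coord: "(\<lambda>\<omega> k. f k (\<omega> k)) \<in> measurable (Pi\<^sub>M UNIV \<Omega>) ?P" if "\<And>k. f k \<in> borel_measurable (\<Omega> k)" for f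
  proof (rule measurable_PiM_single')
    fix k show "(\<lambda>\<omega>. f k (\<omega> k)) \<in> borel_measurable (Pi\<^sub>M UNIV \<Omega>)"
      by (rule measurable_compose[OF measurable_component_singleton[of k UNIV \<Omega>] that[of k]]) auto
  qed auto
  have law: "(\<integral>v. h v \<partial>Pi\<^sub>M UNIV (\<lambda>k. distr (\<Omega> k) borel (f k))) = (\<integral>\<omega>. h (\<lambda>k. f k (\<omega> k)) \<partial>Pi\<^sub>M UNIV \<Omega>)"
    if f: "\<And>k. f k \<in> borel_measurable (\<Omega> k)" for f
    unfolding distr_PiM_coordinatewise[OF \<Omega> f, symmetric]
    by (rule integral_distr[OF coord[OF f] h(1)])
  have h_meas: "(\<lambda>\<omega>. h (\<lambda>k. f k (\<omega> k))) \<in> borel_measurable (Pi\<^sub>M UNIV \<Omega>)" if "\<And>k. f k \<in> borel_measurable (\<Omega> k)" for f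
    by (rule measurable_compose[OF coord[OF that] h(1)])
  have "(\<lambda>n. \<integral>\<omega>. h (\<lambda>k. Yn k n (\<omega> k)) \<partial>Pi\<^sub>M UNIV \<Omega>) \<longlonglongrightarrow> (\<integral>\<omega>. h (\<lambda>k. Y k (\<omega> k)) \<partial>Pi\<^sub>M UNIV \<Omega>)"
  proof (rule integral_dominated_convergence[where w = "\<lambda>_. B"])
    show "AE \<omega> in Pi\<^sub>M UNIV \<Omega>. (\<lambda>n. h (\<lambda>k. Yn k n (\<omega> k))) \<longlonglongrightarrow> h (\<lambda>k. Y k (\<omega> k))"
      by (intro AE_I2 h(2) lim) (auto simp: space_PiM)
  qed (use h_meas Y Yn bound in auto)
  then show ?thesis
    unfolding prob_space.integral_indep_sequence[OF M \<xi> h(1)] prob_space.integral_indep_sequence[OF N \<zeta> h(1)]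
    by (simp add: law[OF Yn(1), symmetric] law[OF Y(1), symmetric] Yn Y)
qed

context prob_space
begin

text \<open>A finite intersection over \<open>I <+> J\<close> splits into an event of
  \<open>S\<close> and an event of \<open>T\<close>. Independence of the two sigma-algebras
  factorises the pair, and each family factorises its own half.\<close>

lemma indep_vars_join:
  assumes ind: "indep_set (sets S) (sets T)" and space: "space S = space M" "space T = space M"
    and X: "indep_vars (\<lambda>_. Q) X I" "\<And>i. i \<in> I \<Longrightarrow> X i \<in> measurable S Q"
    and Y: "indep_vars (\<lambda>_. Q) Y J" "\<And>j. j \<in> J \<Longrightarrow> Y j \<in> measurable T Q"
  shows "indep_vars (\<lambda>_. Q) (case_sum X Y) (I <+> J)"
  unfolding indep_vars_def2
proof (intro conjI ballI)
  fix k assume "k \<in> I <+> J"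
  then show "random_variable Q (case_sum X Y k)" using X(1) Y(1) unfolding indep_vars_def2 by auto
next
  let ?F = "\<lambda>Z i. {Z i -` A \<inter> space M |A. A \<in> sets Q}"
  have IX: "indep_sets (?F X) I" and IY: "indep_sets (?F Y) J" using X(1) Y(1) unfolding indep_vars_def2 by auto
  show "indep_sets (?F (case_sum X Y)) (I <+> J)"
  proof (rule indep_setsI)
    fix k assume "k \<in> I <+> J"
    then have "random_variable Q (case_sum X Y k)" using X(1) Y(1) unfolding indep_vars_def2 by auto
    then show "?F (case_sum X Y) k \<subseteq> events" by (auto intro: measurable_sets)
  next
    fix A K assume K: "K \<noteq> {}" "K \<subseteq> I <+> J" "finite K" and A: "\<forall>k\<in>K. A k \<in> ?F (case_sum X Y) k"
    define KI where "KI = {i. Inl i \<in> K}"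
    define KJ where "KJ = {j. Inr j \<in> K}"
    have fin: "finite KI" "finite KJ" unfolding KI_def KJ_def
      using K(3) by (auto intro: finite_vimageI[of K, unfolded vimage_def])
    have sub: "KI \<subseteq> I" "KJ \<subseteq> J" using K(2) by (auto simp: KI_def KJ_def)
    have AI: "A (Inl i) \<in> ?F X i" if "i \<in> KI" for i using A that by (force simp: KI_def)
    have AJ: "A (Inr j) \<in> ?F Y j" if "j \<in> KJ" for j using A that by (force simp: KJ_def)
    \<comment> \<open>Intersecting with the whole space gives the empty subfamily the value
      \<open>space M\<close>, hence probability 1, the empty product.\<close>
    define a where "a = space M \<inter> (\<Inter>i\<in>KI. A (Inl i))"
    define b where "b = space M \<inter> (\<Inter>j\<in>KJ. A (Inr j))"
    have aS: "a \<in> sets S"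
    proof -
      have "A (Inl i) \<in> sets S" if i: "i \<in> KI" for i
        using AI[OF i] X(2)[of i] sub i unfolding space(1)[symmetric] by (auto intro: measurable_sets)
      then show ?thesis unfolding a_def space(1)[symmetric] using fin by (cases "KI = {}") auto
    qed
    have bT: "b \<in> sets T"
    proof -
      have "A (Inr j) \<in> sets T" if j: "j \<in> KJ" for j
        using AJ[OF j] Y(2)[of j] sub j unfolding space(2)[symmetric] by (auto intro: measurable_sets)
      then show ?thesis unfolding b_def space(2)[symmetric] using fin by (cases "KJ = {}") auto
    qed
    have pa: "prob a = (\<Prod>i\<in>KI. prob (A (Inl i)))"
    proof (cases "KI = {}")
      case False
      have "(\<Inter>i\<in>KI. A (Inl i)) \<subseteq> space M" using False AI by fastforce
      then have "a = (\<Inter>i\<in>KI. A (Inl i))" by (auto simp: a_def)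
      then show ?thesis using indep_setsD[OF IX sub(1) False fin(1), of "\<lambda>i. A (Inl i)"] AI by auto
    qed (simp add: a_def prob_space)
    have pb: "prob b = (\<Prod>j\<in>KJ. prob (A (Inr j)))"
    proof (cases "KJ = {}")
      case False
      have "(\<Inter>j\<in>KJ. A (Inr j)) \<subseteq> space M" using False AJ by fastforce
      then have "b = (\<Inter>j\<in>KJ. A (Inr j))" by (auto simp: b_def)
      then show ?thesis using indep_setsD[OF IY sub(2) False fin(2), of "\<lambda>j. A (Inr j)"] AJ by auto
    qed (simp add: b_def prob_space)
    have K_eq: "K = Inl ` KI \<union> Inr ` KJ"
    proof
      show "K \<subseteq> Inl ` KI \<union> Inr ` KJ"
      proof
        fix k assume "k \<in> K" then show "k \<in> Inl ` KI \<union> Inr ` KJ" by (cases k) (auto simp: KI_def KJ_def)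
      qed
    qed (auto simp: KI_def KJ_def)
    have "(\<Inter>k\<in>K. A k) \<subseteq> space M"
    proof -
      obtain k where "k \<in> K" using K by auto
      then have "A k \<subseteq> space M" using A by fastforce
      then show ?thesis using \<open>k \<in> K\<close> by auto
    qed
    then have "(\<Inter>k\<in>K. A k) = a \<inter> b" unfolding a_def b_def K_eq by auto
    then have "prob (\<Inter>k\<in>K. A k) = prob a * prob b" using indep_setD[OF ind aS bT] by simp
    also have "\<dots> = (\<Prod>k\<in>K. prob (A k))" unfolding pa pb
      by (subst K_eq, subst prod.union_disjoint) (use fin in \<open>auto simp: prod.reindex\<close>)
    finally show "prob (\<Inter>k\<in>K. A k) = (\<Prod>k\<in>K. prob (A k))" .
  qed
qed

lemma indep_vars_singleton: "random_variable Q X \<Longrightarrow> indep_vars (\<lambda>_. Q) (\<lambda>_. X) {i}"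
proof -
  assume X: "random_variable Q X"
  have "indep_sets (\<lambda>j. {X -` A \<inter> space M |A. A \<in> sets Q}) {i}"
  proof (rule indep_setsI)
    fix A J assume "J \<noteq> {}" "J \<subseteq> {i}"
    then have "J = {i}" by auto
    then show "prob (\<Inter>j\<in>J. A j) = (\<Prod>j\<in>J. prob (A j))" by simp
  qed (use X in \<open>auto intro: measurable_sets\<close>)
  then show ?thesis using X unfolding indep_vars_def2 by simp
qed

lemma indep_vars_blocks:
  fixes X :: "'i \<Rightarrow> 'a \<Rightarrow> 'b"
  assumes X: "indep_vars (\<lambda>_. Q) X I" and K: "\<And>j. j \<in> L \<Longrightarrow> K j \<subseteq> I" "disjoint_family_on K L"
    and g: "\<And>j. j \<in> L \<Longrightarrow> g j \<in> measurable (Pi\<^sub>M (K j) (\<lambda>_. Q)) R"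
    and Y: "\<And>j \<omega>. j \<in> L \<Longrightarrow> Y j \<omega> = g j (restrict (\<lambda>i. X i \<omega>) (K j))"
  shows "indep_vars (\<lambda>_. R) Y L"
proof -
  have "indep_vars (\<lambda>_. R) (\<lambda>j \<omega>. g j (restrict (\<lambda>i. X i \<omega>) (K j))) L"
    by (rule indep_vars_compose2[OF indep_vars_restrict[OF X K]]) (use g in auto)
  then show ?thesis using Y by (subst indep_vars_cong[OF refl _ refl]) auto
qed

end

section \<open>Arrival streams\<close>

text \<open>All conditions except \<open>ui\<close> are affine computations. For \<open>ui\<close>,
  a large centred variable forces a large \<open>U n\<close>, and there its square is at most a
  fixed multiple of \<open>(U n \<omega>)\<^sup>2\<close>, so the integrability of the original
  squares transfers.\<close>

lemma arrival_centred_laws: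
  fixes U :: "nat \<Rightarrow> 'a \<Rightarrow> real" and a s :: "nat \<Rightarrow> real"
  assumes M: "\<And>n. prob_space (M n)" and rv: "\<And>n. U n \<in> borel_measurable (M n)"
    and sq: "\<And>n. integrable (M n) (\<lambda>\<omega>. (U n \<omega>)\<^sup>2)"
    and mean: "\<And>n. (\<integral>\<omega>. U n \<omega> \<partial>M n) = 1 / a n" and a0: "\<And>n. 0 < a n"
    and sd: "\<And>n. s n = sqrt (prob_space.variance (M n) (U n))"
    and ui: "((\<lambda>K::real. \<Squnion>n. \<integral>\<^sup>+\<omega>. (if (U n \<omega>)\<^sup>2 > K then ennreal ((U n \<omega>)\<^sup>2) else 0) \<partial>M n) \<longlongrightarrow> 0) at_top"
    and a: "a \<longlonglongrightarrow> a'" and s: "s \<longlonglongrightarrow> s'" and pos: "0 < a'" "0 < s'"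
  shows "centred_laws (\<lambda>n. distr (M n) borel (\<lambda>\<omega>. a n * U n \<omega> - 1)) (\<lambda>n. (a n * s n)\<^sup>2) ((a' * s')\<^sup>2)"
proof (rule centred_laws.intro)
  let ?X = "\<lambda>n \<omega>. a n * U n \<omega> - 1"
  have X: "?X n \<in> borel_measurable (M n)" for n using rv[of n] by measurable
  have int: "integrable (M n) (U n)" for n
  proof -
    interpret prob_space "M n" by (rule M)
    show ?thesis by (rule square_integrable_imp_integrable[OF rv sq])
  qed
  fix n
  interpret prob_space "M n" by (rule M)
  show "real_distribution (distr (M n) borel (?X n))" using X by (rule real_distribution_distr)
  have X2: "(?X n \<omega>)\<^sup>2 = (a n)\<^sup>2 * (U n \<omega>)\<^sup>2 - 2 * a n * U n \<omega> + 1" for \<omega>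
    by (simp add: power2_eq_square algebra_simps)
  show "integrable (distr (M n) borel (?X n)) (\<lambda>x. x\<^sup>2)"
    using sq[of n] int[of n] by (subst integrable_distr_eq[OF X]) (auto simp: X2)
  show "(\<integral>x. x \<partial>distr (M n) borel (?X n)) = 0"
    using int[of n] a0[of n] mean[of n] by (subst integral_distr[OF X]) (auto simp: prob_space)
  have "expectation (\<lambda>\<omega>. (?X n \<omega>)\<^sup>2) = (a n)\<^sup>2 * variance (U n)"
  proof -
    have "(?X n \<omega>)\<^sup>2 = (a n)\<^sup>2 * (U n \<omega> - expectation (U n))\<^sup>2" for \<omega>
      using a0[of n] unfolding mean power_mult_distrib[symmetric] by (simp add: right_diff_distrib)
    then show ?thesis by simp
  qed
  also have "variance (U n) = (s n)\<^sup>2" unfolding sd using variance_positive by simp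
  finally show "(\<integral>x. x\<^sup>2 \<partial>distr (M n) borel (?X n)) = (a n * s n)\<^sup>2"
    by (subst integral_distr[OF X]) (auto simp: power_mult_distrib)
next
  show "(\<lambda>n. (a n * s n)\<^sup>2) \<longlonglongrightarrow> (a' * s')\<^sup>2" by (intro tendsto_intros a s)
  show "0 < (a' * s')\<^sup>2" using pos by simp
next
  let ?X = "\<lambda>n \<omega>. a n * U n \<omega> - 1"
  have X: "?X n \<in> borel_measurable (M n)" for n using rv[of n] by measurable
  fix e :: real assume e: "0 < e"
  have "Bseq a" using a by (intro convergent_imp_Bseq convergentI)
  then obtain A0 where A0: "\<And>n. \<bar>a n\<bar> \<le> A0" by (auto simp: Bseq_def)
  define A where "A = max 1 A0"
  have A: "1 \<le> A" "\<And>n. a n \<le> A" using abs_le_D1[OF A0] by (auto simp: A_def intro: max.coboundedI2)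
  have "eventually (\<lambda>K::real. (\<Squnion>n. \<integral>\<^sup>+\<omega>. (if (U n \<omega>)\<^sup>2 > K then ennreal ((U n \<omega>)\<^sup>2) else 0) \<partial>M n) < ennreal (e / (4 * A\<^sup>2))) at_top"
    using ui by (rule order_tendstoD(2)) (use e A in auto)
  then have "eventually (\<lambda>K::real. 1 \<le> K \<and> (\<Squnion>n. \<integral>\<^sup>+\<omega>. (if (U n \<omega>)\<^sup>2 > K then ennreal ((U n \<omega>)\<^sup>2) else 0) \<partial>M n) < ennreal (e / (4 * A\<^sup>2))) at_top"
    using eventually_ge_at_top[of 1] by eventually_elim auto
  from eventually_happens[OF this] obtain K :: real where K: "1 \<le> K"
    "(\<Squnion>n. \<integral>\<^sup>+\<omega>. (if (U n \<omega>)\<^sup>2 > K then ennreal ((U n \<omega>)\<^sup>2) else 0) \<partial>M n) < ennreal (e / (4 * A\<^sup>2))" by auto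
  \<comment> \<open>Since \<open>\<bar>?X n \<omega>\<bar> \<le> A * \<bar>U n \<omega>\<bar> +
    1\<close>, exceeding \<open>K'\<close> forces \<open>sqrt K < \<bar>U n \<omega>\<bar>\<close>.
    With \<open>A\<close> and \<open>K\<close> at least 1 the added 1 is absorbed, which gives the
    factor \<open>2 * A\<close>, squared in the choice of \<open>K\<close>.\<close>
  define K' where "K' = A * sqrt K + 1"
  have "(\<integral>x. x\<^sup>2 * indicator {x. K' < \<bar>x\<bar>} x \<partial>distr (M n) borel (?X n)) \<le> e" for n
  proof -
    interpret prob_space "M n" by (rule M)
    have le: "ennreal ((?X n \<omega>)\<^sup>2 * indicator {x. K' < \<bar>x\<bar>} (?X n \<omega>)) \<le>
       ennreal (4 * A\<^sup>2) * (if (U n \<omega>)\<^sup>2 > K then ennreal ((U n \<omega>)\<^sup>2) else 0)" for \<omega>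
    proof (cases "K' < \<bar>?X n \<omega>\<bar>")
      case True
      have b: "\<bar>?X n \<omega>\<bar> \<le> A * \<bar>U n \<omega>\<bar> + 1"
      proof -
        have "\<bar>?X n \<omega>\<bar> \<le> \<bar>a n * U n \<omega>\<bar> + 1" by linarith
        also have "\<bar>a n * U n \<omega>\<bar> \<le> A * \<bar>U n \<omega>\<bar>" using A(2)[of n] a0[of n] by (auto simp: abs_mult intro!: mult_right_mono)
        finally show ?thesis by simp
      qed
      then have "A * sqrt K < A * \<bar>U n \<omega>\<bar>" using True by (simp add: K'_def)
      then have sK: "sqrt K < \<bar>U n \<omega>\<bar>" using A(1) by simp
      then have "(sqrt K)\<^sup>2 < \<bar>U n \<omega>\<bar>\<^sup>2" using K(1) by (intro power_strict_mono) auto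
      then have UK: "K < (U n \<omega>)\<^sup>2" using K(1) by simp
      have "1 \<le> sqrt K" using K(1) by simp
      then have "1 \<le> \<bar>U n \<omega>\<bar>" using sK by linarith
      then have "1 * 1 \<le> A * \<bar>U n \<omega>\<bar>" using A(1) by (intro mult_mono) auto
      then have "\<bar>?X n \<omega>\<bar> \<le> 2 * A * \<bar>U n \<omega>\<bar>" using b by simp
      then have "\<bar>?X n \<omega>\<bar>\<^sup>2 \<le> (2 * A * \<bar>U n \<omega>\<bar>)\<^sup>2" by (intro power_mono) auto
      then have "(?X n \<omega>)\<^sup>2 \<le> 4 * A\<^sup>2 * (U n \<omega>)\<^sup>2" by (simp add: power_mult_distrib)
      then show ?thesis using UK True by (simp add: ennreal_mult'[symmetric] ennreal_leI)
    qed simp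
    have meas: "(\<lambda>\<omega>. (?X n \<omega>)\<^sup>2 * indicator {x. K' < \<bar>x\<bar>} (?X n \<omega>)) \<in> borel_measurable (M n)" using rv[of n] by measurable
    have "(\<integral>\<^sup>+\<omega>. ennreal ((?X n \<omega>)\<^sup>2 * indicator {x. K' < \<bar>x\<bar>} (?X n \<omega>)) \<partial>M n)
      \<le> (\<integral>\<^sup>+\<omega>. ennreal (4 * A\<^sup>2) * (if (U n \<omega>)\<^sup>2 > K then ennreal ((U n \<omega>)\<^sup>2) else 0) \<partial>M n)"
      by (intro nn_integral_mono le)
    also have "\<dots> = ennreal (4 * A\<^sup>2) * (\<integral>\<^sup>+\<omega>. (if (U n \<omega>)\<^sup>2 > K then ennreal ((U n \<omega>)\<^sup>2) else 0) \<partial>M n)"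
    proof -
      have [measurable]: "U n \<in> borel_measurable (M n)" by (rule rv)
      show ?thesis by (intro nn_integral_cmult) measurable
    qed
    also have "\<dots> \<le> ennreal (4 * A\<^sup>2) * ennreal (e / (4 * A\<^sup>2))"
      by (intro mult_left_mono order_trans[OF SUP_upper less_imp_le[OF K(2)]]) auto
    also have "\<dots> = ennreal e" using A(1) e by (simp add: ennreal_mult'[symmetric])
    finally have "enn2real (\<integral>\<^sup>+\<omega>. ennreal ((?X n \<omega>)\<^sup>2 * indicator {x. K' < \<bar>x\<bar>} (?X n \<omega>)) \<partial>M n) \<le> e"
      using e by (intro enn2real_leI) auto
    then show ?thesis
      using meas by (subst integral_distr[OF X]) (auto simp: integral_eq_nn_integral)
  qed
  moreover have "0 \<le> K'" using A(1) K(1) by (simp add: K'_def)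
  ultimately show "\<exists>K\<ge>0. \<forall>n. (\<integral>x. x\<^sup>2 * indicator {x. K < \<bar>x\<bar>} x \<partial>distr (M n) borel (?X n)) \<le> e" by blast
qed

text \<open>Independence between the inputs is given for generated sigma-algebras, and within a
  stream for single variables. One jointly independent family is formed from both, so that
  increments of the driving path become functions of disjoint blocks.\<close>

lemma (in prob_space) indep_vars_queue_input:
  fixes U V :: "nat \<Rightarrow> 'a \<Rightarrow> real" and X0 :: "'a \<Rightarrow> int" and F :: "nat \<Rightarrow> 'a set set"
  assumes ind: "indep_sets F {0..4}"
    and F: "F 0 = gen_sets M (\<lambda>\<omega> k. U k \<omega>) (Pi\<^sub>M UNIV (\<lambda>_. borel))"
      "F 1 = gen_sets M (\<lambda>\<omega> k. V k \<omega>) (Pi\<^sub>M UNIV (\<lambda>_. borel))"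
      "F 4 = gen_sets M X0 (count_space UNIV)"
    and U: "indep_vars (\<lambda>_. borel) U I" and V: "indep_vars (\<lambda>_. borel) V J" and X0: "X0 \<in> measurable M (count_space UNIV)"
  shows "indep_vars (\<lambda>_. borel) (case_sum (case_sum U V) (\<lambda>_ \<omega>. real_of_int (X0 \<omega>))) ((I <+> J) <+> {()})"
proof -
  let ?P = "Pi\<^sub>M UNIV (\<lambda>_::nat. borel :: real measure)"
  define SU where "SU = vimage_algebra (space M) (\<lambda>\<omega> k. U k \<omega>) ?P"
  define SV where "SV = vimage_algebra (space M) (\<lambda>\<omega> k. V k \<omega>) ?P"
  define SX where "SX = vimage_algebra (space M) X0 (count_space UNIV)"
  have eq: "sets SU = F 0" "sets SV = F 1" "sets SX = F 4" 
    unfolding F gen_sets_def SU_def SV_def SX_def by (rule refl)+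
  have Uk: "U k \<in> borel_measurable SU" for k
  proof -
    have "(\<lambda>\<omega> k. U k \<omega>) \<in> measurable SU ?P" unfolding SU_def by (rule measurable_vimage_algebra1) (auto simp: space_PiM)
    from measurable_compose[OF this measurable_component_singleton[of k UNIV "\<lambda>_. borel"]] show ?thesis by simp
  qed
  have Vk: "V k \<in> borel_measurable SV" for k
  proof -
    have "(\<lambda>\<omega> k. V k \<omega>) \<in> measurable SV ?P" unfolding SV_def by (rule measurable_vimage_algebra1) (auto simp: space_PiM)
    from measurable_compose[OF this measurable_component_singleton[of k UNIV "\<lambda>_. borel"]] show ?thesis by simp
  qed
  have X0k: "(\<lambda>\<omega>. real_of_int (X0 \<omega>)) \<in> borel_measurable SX"
  proof -
    have "X0 \<in> measurable SX (count_space UNIV)" unfolding SX_def by (rule measurable_vimage_algebra1) auto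
    then show ?thesis by measurable
  qed
  have ev: "F i \<subseteq> events" if "i \<in> {0..4}" for i using ind that unfolding indep_sets_def by auto
  have UV: "indep_set (sets SU) (sets SV)"
    unfolding indep_sets2_eq
  proof (intro conjI ballI)
    fix a b assume ab: "a \<in> sets SU" "b \<in> sets SV"
    have "prob (\<Inter>j\<in>{0,1::nat}. (if j = 0 then a else b)) = (\<Prod>j\<in>{0,1::nat}. prob (if j = 0 then a else b))"
      using ab eq by (intro indep_setsD[OF ind, of "{0, 1}" "\<lambda>j. if j = 0 then a else b"]) auto
    then show "prob (a \<inter> b) = prob a * prob b" by (simp add: Int_commute)
  qed (use ev eq in auto)
  define S where "S = sigma (space M) (F 0 \<union> F 1)"
  have sub: "F 0 \<union> F 1 \<subseteq> Pow (space M)" using ev[of 0] ev[of 1] sets.space_closed[of M] by auto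
  have S: "sets S = sigma_sets (space M) (F 0 \<union> F 1)" "space S = space M" unfolding S_def using sub by auto
  have UVX: "indep_set (sets S) (sets SX)"
  proof -
    \<comment> \<open>The two streams are first merged into one sigma-algebra, which is then
      independent of that of the initial value.\<close>
    let ?I = "\<lambda>j::nat. if j = 0 then {0, 1} else {4::nat}"
    have *: "indep_sets (\<lambda>j. sigma_sets (space M) (\<Union>i\<in>?I j. F i)) {0, 1}"
    proof (rule indep_sets_collect_sigma)
      show "indep_sets F (\<Union>j\<in>{0, 1}. ?I j)" by (rule indep_sets_mono_index[OF _ ind]) auto
      show "Int_stable (F i)" if "j \<in> {0, 1}" "i \<in> ?I j" for i j
      proof -
        have "i \<in> {0, 1, 4}" using that by (auto split: if_splits)
        then have "\<exists>R. F i = sets R" using eq by (auto intro: sym)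
        then show ?thesis by (auto simp: Int_stable_def)
      qed
    qed (auto simp: disjoint_family_on_def)
    show ?thesis unfolding indep_sets2_eq
    proof (intro conjI ballI)
      fix a b assume ab: "a \<in> sets S" "b \<in> sets SX"
      have "prob (\<Inter>j\<in>{0,1::nat}. (if j = 0 then a else b)) = (\<Prod>j\<in>{0,1::nat}. prob (if j = 0 then a else b))"
        using ab eq S by (intro indep_setsD[OF *, of "{0, 1}" "\<lambda>j. if j = 0 then a else b"]) auto
      then show "prob (a \<inter> b) = prob a * prob b" by (simp add: Int_commute)
    next
      show "sets S \<subseteq> events" unfolding S using ev[of 0] ev[of 1] by (intro sets.sigma_sets_subset) auto
    qed (use ev[of 4] eq in auto)
  qed
  have joined: "indep_vars (\<lambda>_. borel) (case_sum U V) (I <+> J)"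
    by (rule indep_vars_join[OF UV _ _ U Uk V Vk]) (auto simp: SU_def SV_def)
  have joined_meas: "case_sum U V k \<in> borel_measurable S" for k
  proof -
    have up: "f \<in> borel_measurable S" if "f \<in> borel_measurable R" "sets R \<subseteq> sets S" "space R = space M" for f :: "'a \<Rightarrow> real" and R
    proof (rule measurableI)
      fix A :: "real set" assume "A \<in> sets borel"
      then have "f -` A \<inter> space R \<in> sets R" by (rule measurable_sets[OF that(1)])
      then show "f -` A \<inter> space S \<in> sets S" using that S by auto
    qed auto
    have "sets SU \<subseteq> sets S" "sets SV \<subseteq> sets S" unfolding S eq by (auto intro: sigma_sets.Basic)
    then show ?thesis using up[OF Uk] up[OF Vk] by (cases k) (auto simp: SU_def SV_def)
  qed
  have initial: "indep_vars (\<lambda>_. borel) (\<lambda>_ \<omega>. real_of_int (X0 \<omega>)) {()}"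
    by (rule indep_vars_singleton) (use X0 in measurable)
  show ?thesis
    by (rule indep_vars_join[OF UVX S(2) _ joined joined_meas initial X0k]) (auto simp: SX_def)
qed

section \<open>Continuity of the Euler scheme and preparations for its increments\<close>

text \<open>Up to the horizon \<open>j\<close> only finitely many Euler values occur, each a
  continuous function of finitely many increments; coordinatewise convergence is therefore uniform
  on \<open>{0..real j}\<close>.\<close>

lemma euler_functional:
  assumes m: "0 < m" and b: "continuous_on UNIV b" and g: "lipschitz_functional j B g"
    and v: "\<And>k. (\<lambda>i. vs i k) \<longlonglongrightarrow> v k"
  shows "(\<lambda>i. g (euler_path b m (vs i))) \<longlonglongrightarrow> g (euler_path b m v)"
proof (rule tendstoI)
  fix e :: real assume e: "0 < e"
  have conv: "(\<lambda>i. euler b m (vs i) k) \<longlonglongrightarrow> euler b m v k" for k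
  proof (induction k)
    case (Suc k)
    have "isCont b x" for x using b by (simp add: continuous_on_eq_continuous_at)
    then have "(\<lambda>i. b (euler b m (vs i) k)) \<longlonglongrightarrow> b (euler b m v k)" using Suc by (rule isCont_tendsto_compose)
    then show ?case using m by (auto intro!: tendsto_intros Suc v)
  qed (simp add: v)
  define d where "d = e / (real j + 1)"
  have d: "0 < d" using e by (simp add: d_def)
  have jd: "real j * d < e" using e by (simp add: d_def field_simps)
  have "eventually (\<lambda>i. \<forall>k\<in>{..nat \<lfloor>real m * real j\<rfloor>}. dist (euler b m (vs i) k) (euler b m v k) < d) sequentially"
    by (intro eventually_ball_finite ballI tendstoD[OF conv d]) auto
  then show "eventually (\<lambda>i. dist (g (euler_path b m (vs i))) (g (euler_path b m v)) < e) sequentially"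
  proof eventually_elim
    case (elim i)
    have "\<bar>euler_path b m (vs i) t - euler_path b m v t\<bar> \<le> d" if t: "t \<in> {0..real j}" for t
    proof -
      have "nat \<lfloor>real m * t\<rfloor> \<le> nat \<lfloor>real m * real j\<rfloor>"
        using t by (intro nat_mono floor_mono mult_left_mono) auto
      then show ?thesis using elim by (auto simp: euler_path_def dist_real_def intro: less_imp_le)
    qed
    then have "\<bar>g (euler_path b m (vs i)) - g (euler_path b m v)\<bar> \<le> real j * d"
      using d m by (intro lipschitz_functionalD(2)[OF g]) (auto intro: cadlag_euler_path)
    then show ?case using jd by (simp add: dist_real_def)
  qed
qed

lemma floor_ratio_tendsto:
  assumes "0 \<le> y"
  shows "(\<lambda>n. real (nat \<lfloor>y * real n\<rfloor>) / real n) \<longlonglongrightarrow> y"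
proof (rule tendsto_sandwich[of "\<lambda>n. y - 1 / real n" _ _ "\<lambda>_. y"])
  have b: "y * real n - 1 \<le> real (nat \<lfloor>y * real n\<rfloor>) \<and> real (nat \<lfloor>y * real n\<rfloor>) \<le> y * real n" for n
  proof -
    have "0 \<le> y * real n" using assms by simp
    then show ?thesis by linarith
  qed
  show "eventually (\<lambda>n. y - 1 / real n \<le> real (nat \<lfloor>y * real n\<rfloor>) / real n) sequentially"
    using eventually_gt_at_top[of 0]
  proof eventually_elim
    case (elim n)
    then have "y - 1 / real n = (y * real n - 1) / real n" by (simp add: diff_divide_distrib)
    also have "\<dots> \<le> real (nat \<lfloor>y * real n\<rfloor>) / real n" using b[of n] by (intro divide_right_mono) auto
    finally show ?case .
  qed
  show "eventually (\<lambda>n. real (nat \<lfloor>y * real n\<rfloor>) / real n \<le> y) sequentially"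
    using eventually_gt_at_top[of 0] by eventually_elim (use b in \<open>auto simp: divide_le_eq\<close>)
  show "(\<lambda>n. y - 1 / real n) \<longlonglongrightarrow> y" using tendsto_diff[OF tendsto_const lim_1_over_n, of y] by simp
qed simp

lemma (in prob_space) char_indep_combination:
  fixes A B :: "'a \<Rightarrow> real"
  assumes ind: "indep_var borel A borel B"
  shows "char (distr M borel (\<lambda>\<omega>. (- A \<omega> + B \<omega>) / r + e)) t
     = iexp (t * e) * (char (distr M borel A) (- t / r) * char (distr M borel B) (t / r))"
proof -
  have A: "A \<in> borel_measurable M" and B: "B \<in> borel_measurable M"
    using ind by (auto dest: indep_var_rv1 indep_var_rv2)
  have cA: "(\<lambda>x::real. iexp (- t / r * x)) \<in> borel_measurable borel" and cB: "(\<lambda>x::real. iexp (t / r * x)) \<in> borel_measurable borel"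
    by measurable
  have ind': "indep_var borel (\<lambda>\<omega>. iexp (- t / r * A \<omega>)) borel (\<lambda>\<omega>. iexp (t / r * B \<omega>))"
    using indep_var_compose[OF ind cA cB] by (simp add: comp_def)
  have iA: "integrable M (\<lambda>\<omega>. iexp (- t / r * A \<omega>))" and iB: "integrable M (\<lambda>\<omega>. iexp (t / r * B \<omega>))"
    using A B by (auto intro!: integrable_const_bound[of _ 1])
  have "char (distr M borel (\<lambda>\<omega>. (- A \<omega> + B \<omega>) / r + e)) t = expectation (\<lambda>\<omega>. iexp (t * ((- A \<omega> + B \<omega>) / r + e)))"
    unfolding char_def using A B by (subst integral_distr) auto
  also have "(\<lambda>\<omega>. iexp (t * ((- A \<omega> + B \<omega>) / r + e))) = (\<lambda>\<omega>. iexp (t * e) * (iexp (- t / r * A \<omega>) * iexp (t / r * B \<omega>)))"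
    unfolding exp_add[symmetric] of_real_mult[symmetric] of_real_add[symmetric] distrib_left[symmetric]
    by (rule ext) (simp add: algebra_simps add_divide_distrib diff_divide_distrib)
  also have "expectation \<dots> = iexp (t * e) * expectation (\<lambda>\<omega>. iexp (- t / r * A \<omega>) * iexp (t / r * B \<omega>))" by simp
  also have "expectation (\<lambda>\<omega>. iexp (- t / r * A \<omega>) * iexp (t / r * B \<omega>))
     = expectation (\<lambda>\<omega>. iexp (- t / r * A \<omega>)) * expectation (\<lambda>\<omega>. iexp (t / r * B \<omega>))"
    by (rule indep_var_lebesgue_integral[OF ind' iA iB])
  also have "expectation (\<lambda>\<omega>. iexp (- t / r * A \<omega>)) = char (distr M borel A) (- t / r)"
    unfolding char_def using A by (subst integral_distr) auto
  also have "expectation (\<lambda>\<omega>. iexp (t / r * B \<omega>)) = char (distr M borel B) (t / r)"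
    unfolding char_def using B by (subst integral_distr) auto
  finally show ?thesis .
qed

lemma char_affine_normal:
  assumes N: "prob_space N" and d: "distributed N lborel Y (normal_density 0 s)" and s: "0 < s"
  shows "char (distr N borel (\<lambda>\<omega>. a * Y \<omega> + e)) t = iexp (t * e) * complex_of_real (exp (- ((t * a * s)\<^sup>2 / 2)))"
proof -
  interpret prob_space N by fact
  have Y: "Y \<in> borel_measurable N" using distributed_measurable[OF d] by simp
  have "distributed N lborel (\<lambda>\<omega>. (Y \<omega> - 0) / s) std_normal_density"
    using normal_standard_normal_convert[OF s, of Y 0] d by simp
  then have law: "distr N lborel (\<lambda>\<omega>. Y \<omega> / s) = std_normal_distribution" using distributed_distr_eq_density by fastforce
  have "char (distr N borel (\<lambda>\<omega>. a * Y \<omega> + e)) t = expectation (\<lambda>\<omega>. iexp (t * e) * iexp ((t * a * s) * (Y \<omega> / s)))"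
    unfolding char_def using Y s by (subst integral_distr) (auto simp: algebra_simps exp_add)
  also have "\<dots> = iexp (t * e) * expectation (\<lambda>\<omega>. iexp ((t * a * s) * (Y \<omega> / s)))" by simp
  also have "expectation (\<lambda>\<omega>. iexp ((t * a * s) * (Y \<omega> / s))) = (\<integral>x. iexp ((t * a * s) * x) \<partial>distr N lborel (\<lambda>\<omega>. Y \<omega> / s))"
    using Y by (subst integral_distr) auto
  also have "\<dots> = char std_normal_distribution (t * a * s)" unfolding law char_def by simp
  finally show ?thesis by (simp add: char_std_normal_distribution)
qed

text \<open>The rate enters only through \<open>1 / a\<close>. The mean of an almost surely positive
  variable is not negative, and it is not zero since otherwise the variable would vanish almost
  surely; this also excludes \<open>a = 0\<close>, for which \<open>1 / a\<close> is 0.\<close>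

lemma (in prob_space) rate_pos_of_pos_interarrival:
  fixes T :: "'a \<Rightarrow> real"
  assumes T: "T \<in> borel_measurable M" "integrable M (\<lambda>\<omega>. (T \<omega>)\<^sup>2)" and mean: "expectation T = 1 / a"
    and pos: "prob {\<omega>\<in>space M. 0 < T \<omega>} = 1"
  shows "AE \<omega> in M. 0 < T \<omega>" and "0 < a"
proof -
  show AE: "AE \<omega> in M. 0 < T \<omega>"
    using pos T(1) by (subst (asm) prob_Collect_eq_1) auto
  have int: "integrable M T" by (rule square_integrable_imp_integrable[OF T])
  have nn: "AE \<omega> in M. 0 \<le> T \<omega>" using AE by eventually_elim simp
  then have "0 \<le> expectation T" by (rule integral_nonneg_AE)
  moreover have "expectation T \<noteq> 0"
  proof
    assume "expectation T = 0"
    then have "AE \<omega> in M. T \<omega> = 0" using integral_nonneg_eq_0_iff_AE[OF int nn] by simp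
    with AE have "AE \<omega> in M. False" by eventually_elim simp
    then show False by (simp add: AE_False)
  qed
  ultimately show "0 < a" unfolding mean by (simp add: less_le)
qed

lemma (in prob_space) AE_pos_of_law:
  fixes T :: "nat \<Rightarrow> 'a \<Rightarrow> real"
  assumes T: "\<And>k. 1 \<le> k \<Longrightarrow> T k \<in> borel_measurable M" and law: "\<And>k. 1 \<le> k \<Longrightarrow> distr M borel (T k) = distr M borel (T 1)"
    and AE: "AE \<omega> in M. 0 < T 1 \<omega>"
  shows "AE \<omega> in M. \<forall>k\<ge>1. 0 < T k \<omega>"
proof -
  have "AE \<omega> in M. 1 \<le> k \<longrightarrow> 0 < T k \<omega>" for k
  proof (cases "1 \<le> k")
    case True
    have "AE x in distr M borel (T 1). 0 < x" using AE T[of 1] by (subst AE_distr_iff) auto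
    then have "AE x in distr M borel (T k). 0 < x" unfolding law[OF True] .
    then have "AE \<omega> in M. 0 < T k \<omega>" using T[OF True] by (subst (asm) AE_distr_iff) auto
    then show ?thesis by eventually_elim simp
  qed simp
  then show ?thesis by (simp add: AE_all_countable)
qed

lemma renewal_count_0:
  assumes "\<And>k. 1 \<le> k \<Longrightarrow> 0 < u k"
  shows "renewal_count u 0 = 0"
proof -
  have "0 < (\<Sum>i\<in>{1..1}. u i)" using assms[of 1] by simp
  from renewal_count_bounds(1)[OF assms _ this] show ?thesis by simp
qed

text \<open>The number of arrivals to be expected at rate \<open>y\<close> up to time
  \<open>n * k / m\<close>. It is deterministic, so walk increments between consecutive indices are
  independent.\<close>

definition grid_index :: "real \<Rightarrow> nat \<Rightarrow> nat \<Rightarrow> nat \<Rightarrow> nat" where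
  "grid_index y m n k = nat \<lfloor>y * (real k / real m) * real n\<rfloor>"

lemma grid_index_mono:
  assumes "0 \<le> y" "k \<le> l" shows "grid_index y m n k \<le> grid_index y m n l"
  unfolding grid_index_def using assms
  by (intro nat_mono floor_mono mult_right_mono mult_left_mono divide_right_mono) auto

lemma grid_index_diff_tendsto:
  assumes "0 \<le> y" "0 < m"
  shows "(\<lambda>n. real (card {grid_index y m n k<..grid_index y m n (Suc k)}) / real n) \<longlonglongrightarrow> y / real m"
proof -
  have "(\<lambda>n. real (grid_index y m n l) / real n) \<longlonglongrightarrow> y * (real l / real m)" for l
    unfolding grid_index_def using assms by (intro floor_ratio_tendsto) auto
  from tendsto_diff[OF this[of "Suc k"] this[of k]]
  have "(\<lambda>n. real (grid_index y m n (Suc k)) / real n - real (grid_index y m n k) / real n) \<longlonglongrightarrow> y / real m"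
    using assms by (simp add: add_divide_distrib distrib_left)
  moreover have "real (card {grid_index y m n k<..grid_index y m n (Suc k)}) / real n
     = real (grid_index y m n (Suc k)) / real n - real (grid_index y m n k) / real n" for n
    using grid_index_mono[OF assms(1), of k "Suc k" m n] by (simp add: of_nat_diff diff_divide_distrib)
  ultimately show ?thesis by simp
qed

lemma (in prob_space) distr_affine_cong:
  fixes T :: "nat \<Rightarrow> 'a \<Rightarrow> real"
  assumes "\<And>k. 1 \<le> k \<Longrightarrow> T k \<in> borel_measurable M" "\<And>k. 1 \<le> k \<Longrightarrow> distr M borel (T k) = distr M borel (T 1)" "1 \<le> i"
  shows "distr M borel (\<lambda>\<omega>. a * T i \<omega> - 1) = distr M borel (\<lambda>\<omega>. a * T 1 \<omega> - 1)"
proof -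
  have "distr M borel (\<lambda>\<omega>. a * T k \<omega> - 1) = distr (distr M borel (T k)) borel (\<lambda>x. a * x - 1)" if "1 \<le> k" for k
    using assms(1)[OF that] by (subst distr_distr) (auto simp: comp_def)
  from this[OF assms(3)] this[of 1] show ?thesis unfolding assms(2)[OF assms(3)] by simp
qed

section \<open>Events of high probability and bounds for random walks\<close>

text \<open>The property is asked only on a measurable event \<open>G\<close>: the properties
  concerned quantify over uncountably many times and need not be measurable themselves.\<close>

definition whp :: "(nat \<Rightarrow> 'a measure) \<Rightarrow> real \<Rightarrow> (nat \<Rightarrow> 'a \<Rightarrow> bool) \<Rightarrow> bool" where
  "whp M \<eta> P \<longleftrightarrow> eventually (\<lambda>n. \<exists>G\<in>sets (M n). 1 - \<eta> \<le> measure (M n) G \<and> (\<forall>\<omega>\<in>G. P n \<omega>)) sequentially"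

lemma whp_conj:
  assumes M: "\<And>n. prob_space (M n)" and "whp M \<eta> P" "whp M \<epsilon> Q"
  shows "whp M (\<eta> + \<epsilon>) (\<lambda>n \<omega>. P n \<omega> \<and> Q n \<omega>)"
  using assms(2,3) unfolding whp_def
proof eventually_elim
  case (elim n)
  interpret prob_space "M n" by (rule M)
  from elim obtain G H where G: "G \<in> events" "1 - \<eta> \<le> prob G" "\<forall>\<omega>\<in>G. P n \<omega>"
    and H: "H \<in> events" "1 - \<epsilon> \<le> prob H" "\<forall>\<omega>\<in>H. Q n \<omega>" by blast
  have "prob (space (M n) - G \<inter> H) \<le> prob (space (M n) - G) + prob (space (M n) - H)"
    using measure_Un_le[of "space (M n) - G" "M n" "space (M n) - H"] G H by (simp add: Diff_Int)
  then have "1 - (\<eta> + \<epsilon>) \<le> prob (G \<inter> H)"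
    using G H by (simp add: prob_compl)
  then show ?case using G H by (intro bexI[of _ "G \<inter> H"]) auto
qed

lemma whp_AE:
  assumes M: "\<And>n. prob_space (M n)" and AE: "\<And>n. AE \<omega> in M n. P n \<omega>"
  shows "whp M 0 (\<lambda>n \<omega>. \<omega> \<in> space (M n) \<and> P n \<omega>)"
  unfolding whp_def
proof (rule always_eventually, rule allI)
  fix n
  interpret prob_space "M n" by (rule M)
  obtain N where N: "N \<in> null_sets (M n)" "\<And>\<omega>. \<omega> \<in> space (M n) - N \<Longrightarrow> P n \<omega>"
    using AE[of n] by (elim AE_E3) blast
  have "prob (space (M n) - N) = 1" using N prob_compl[of N] by (simp add: measure_eq_0_null_sets null_setsD2)
  then show "\<exists>G\<in>events. 1 - 0 \<le> prob G \<and> (\<forall>\<omega>\<in>G. \<omega> \<in> space (M n) \<and> P n \<omega>)"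
    using N by (intro bexI[of _ "space (M n) - N"]) auto
qed

lemma whp_mono_eventually:
  assumes "whp M \<eta> P" "eventually (\<lambda>n. \<forall>\<omega>. P n \<omega> \<longrightarrow> Q n \<omega>) sequentially" "\<eta> \<le> \<epsilon>"
  shows "whp M \<epsilon> Q"
  using assms(1,2) unfolding whp_def
proof eventually_elim
  case (elim n)
  then obtain G where "G \<in> sets (M n)" "1 - \<eta> \<le> measure (M n) G" "\<forall>\<omega>\<in>G. P n \<omega>" by blast
  with elim(2) assms(3) show ?case by (intro bexI[of _ G]) auto
qed

text \<open>\<open>min 1 (\<bar>x\<bar> / R)\<close> is continuous, bounded and dominates the
  indicator of \<open>\<bar>x\<bar> > R\<close>, and its integral under the limit law vanishes as
  \<open>R\<close> grows, by dominated convergence.\<close>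

lemma weak_conv_tight:
  fixes Y :: "nat \<Rightarrow> 'a \<Rightarrow> real"
  assumes M: "\<And>n. prob_space (M n)" and Y: "\<And>n. Y n \<in> borel_measurable (M n)" and \<mu>: "real_distribution \<mu>"
    and conv: "weak_conv_m (\<lambda>n. distr (M n) borel (Y n)) \<mu>" and \<eta>: "0 < \<eta>"
  obtains R where "0 < R" "whp M \<eta> (\<lambda>n \<omega>. \<bar>Y n \<omega>\<bar> \<le> R)"
proof -
  interpret \<mu>: real_distribution \<mu> by fact
  let ?g = "\<lambda>i (x::real). min 1 (\<bar>x\<bar> * (1 / real (Suc i)))"
  have "(\<lambda>i. \<integral>x. ?g i x \<partial>\<mu>) \<longlonglongrightarrow> (\<integral>x. 0 \<partial>\<mu>)"
  proof (rule integral_dominated_convergence[where w = "\<lambda>_. 1"])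
    show "AE x in \<mu>. (\<lambda>i. ?g i x) \<longlonglongrightarrow> 0"
    proof (rule AE_I2)
      fix x
      have "(\<lambda>i. min 1 (\<bar>x\<bar> * (1 / real (Suc i)))) \<longlonglongrightarrow> min 1 (\<bar>x\<bar> * 0)"
        using LIMSEQ_inverse_real_of_nat by (intro tendsto_intros) (simp add: inverse_eq_divide)
      then show "(\<lambda>i. ?g i x) \<longlonglongrightarrow> 0" by simp
    qed
  qed auto
  then have "eventually (\<lambda>i. (\<integral>x. ?g i x \<partial>\<mu>) < \<eta>) sequentially" using \<eta> by (intro order_tendstoD(2)) auto
  from eventually_happens[OF this] obtain i where i: "(\<integral>x. ?g i x \<partial>\<mu>) < \<eta>" by auto
  define R where "R = real (Suc i)"
  have R: "0 < R" by (simp add: R_def)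
  have "(\<lambda>n. \<integral>x. ?g i x \<partial>distr (M n) borel (Y n)) \<longlonglongrightarrow> (\<integral>x. ?g i x \<partial>\<mu>)"
    by (rule weak_conv_imp_integral_bdd_continuous_conv[OF _ \<mu> conv, where B = 1])
      (auto intro!: prob_space.real_distribution_distr M Y continuous_intros)
  then have "eventually (\<lambda>n. (\<integral>x. ?g i x \<partial>distr (M n) borel (Y n)) < \<eta>) sequentially" using i by (rule order_tendstoD(2))
  then have "whp M \<eta> (\<lambda>n \<omega>. \<bar>Y n \<omega>\<bar> \<le> R)" unfolding whp_def
  proof eventually_elim
    case (elim n)
    interpret prob_space "M n" by (rule M)
    let ?A = "{\<omega>\<in>space (M n). \<bar>Y n \<omega>\<bar> \<le> R}"
    have A: "?A \<in> events" using Y[of n] by measurable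
    have "prob (space (M n) - ?A) = (\<integral>\<omega>. indicator (space (M n) - ?A) \<omega> \<partial>M n)" using A by (simp add: Int_absorb2)
    also have "\<dots> \<le> (\<integral>\<omega>. ?g i (Y n \<omega>) \<partial>M n)"
    proof (rule integral_mono)
      show "integrable (M n) (indicat_real (space (M n) - ?A))" using A by (intro integrable_const_bound[of _ 1]) auto
      show "integrable (M n) (\<lambda>\<omega>. ?g i (Y n \<omega>))" using Y[of n] by (intro integrable_const_bound[of _ 1]) auto
      show "indicator (space (M n) - ?A) \<omega> \<le> ?g i (Y n \<omega>)" if "\<omega> \<in> space (M n)" for \<omega>
        using that by (auto simp: indicator_def R_def field_simps)
    qed
    also have "\<dots> = (\<integral>x. ?g i x \<partial>distr (M n) borel (Y n))" using Y[of n] by (subst integral_distr) auto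
    finally have "1 - \<eta> \<le> prob ?A" using elim prob_compl[OF A] by linarith
    then show ?case using A by (intro bexI[of _ ?A]) auto
  qed
  then show ?thesis using that R by blast
qed

text \<open>The block estimate for a single block from 0 to \<open>K * n\<close>, whose oscillation
  from the start is the walk itself; now \<open>c\<close> is large instead of the block being
  short.\<close>

lemma (in centred_laws) walk_bounded:
  fixes X :: "nat \<Rightarrow> nat \<Rightarrow> 'a \<Rightarrow> real"
  assumes M: "\<And>n. prob_space (M n)" and ind: "\<And>n. prob_space.indep_vars (M n) (\<lambda>_. borel) (X n) {1..}"
    and law_X: "\<And>n i. 1 \<le> i \<Longrightarrow> distr (M n) borel (X n i) = \<nu> n" and K: "0 < K" and \<eta>: "0 < \<eta>"
  obtains R where "0 < R"
    "whp M \<eta> (\<lambda>n \<omega>. \<forall>i. real i \<le> K * real n \<longrightarrow> \<bar>\<Sum>i\<in>{1..i}. X n i \<omega>\<bar> \<le> R * sqrt (real n))"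
proof -
  \<comment> \<open>The entries provide the hypothesis of the block estimate, the bound
    \<open>1 \<le> c\<close>, by which \<open>c\<close> is below its powers, and a tail of at most
    \<open>\<eta>\<close>.\<close>
  define c where "c = max (2 * s0 * K + 1) (max 1 (12 * (s0 * K)\<^sup>2 / \<eta>))"
  have c1: "1 \<le> c" "2 * s0 * K < c" "12 * (s0 * K)\<^sup>2 / \<eta> \<le> c" by (auto simp: c_def)
  have cc: "c \<le> c\<^sup>2" "c \<le> c ^ 4" using c1(1) by (auto intro: self_le_power)
  have tail: "12 * (s0 * K)\<^sup>2 / c ^ 4 \<le> \<eta>"
  proof -
    have "12 * (s0 * K)\<^sup>2 \<le> c * \<eta>" using c1(3) \<eta> by (simp add: field_simps)
    also have "\<dots> \<le> c ^ 4 * \<eta>" using cc \<eta> by (intro mult_right_mono) auto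
    finally show ?thesis using c1(1) by (simp add: field_simps)
  qed
  have sub: "{0<..nat \<lfloor>K * real n\<rfloor>} \<subseteq> {1..}" for n by auto
  have "(\<lambda>n. real (nat \<lfloor>K * real n\<rfloor> - 0) / real n) \<longlonglongrightarrow> K" using floor_ratio_tendsto[of K] K by simp
  from eventually_block_oscillation[OF M prob_space.indep_vars_subset[OF M ind sub] law_X this K, of c] c1 cc
  have ev: "eventually (\<lambda>n. measure (M n) {\<omega>\<in>space (M n). \<exists>k\<in>{0..nat \<lfloor>K * real n\<rfloor>}. 2 * c * sqrt (real n) < \<bar>\<Sum>i\<in>{0<..k}. X n i \<omega>\<bar>}
     \<le> 12 * (s0 * K)\<^sup>2 / c ^ 4) sequentially" by fastforce
  have "whp M \<eta> (\<lambda>n \<omega>. \<forall>i. real i \<le> K * real n \<longrightarrow> \<bar>\<Sum>i\<in>{1..i}. X n i \<omega>\<bar> \<le> (2 * c) * sqrt (real n))"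
    unfolding whp_def using ev
  proof eventually_elim
    case (elim n)
    interpret prob_space "M n" by (rule M)
    let ?F = "{\<omega>\<in>space (M n). \<exists>k\<in>{0..nat \<lfloor>K * real n\<rfloor>}. 2 * c * sqrt (real n) < \<bar>\<Sum>i\<in>{0<..k}. X n i \<omega>\<bar>}"
    have rv: "random_variable borel (X n i)" if "1 \<le> i" for i using ind[of n] that by (auto simp: indep_vars_def)
    have "(\<lambda>\<omega>. \<Sum>i\<in>{0<..k}. X n i \<omega>) \<in> borel_measurable (M n)" for k by (intro borel_measurable_sum rv) auto
    then have F: "?F \<in> events" by measurable
    have "1 - \<eta> \<le> prob (space (M n) - ?F)" using prob_compl[OF F] elim tail by simp
    moreover have "\<bar>\<Sum>i\<in>{1..i}. X n i \<omega>\<bar> \<le> (2 * c) * sqrt (real n)" if "\<omega> \<in> space (M n) - ?F" "real i \<le> K * real n" for \<omega> i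
    proof -
      have "i \<le> nat \<lfloor>K * real n\<rfloor>" using that(2) by (simp add: le_nat_floor)
      then have "\<bar>\<Sum>i\<in>{0<..i}. X n i \<omega>\<bar> \<le> 2 * c * sqrt (real n)" using that(1) by (auto simp: not_less)
      moreover have "{0<..i} = {1..i}" by auto
      ultimately show ?thesis by simp
    qed
    ultimately show ?case using F by (intro bexI[of _ "space (M n) - ?F"]) auto
  qed
  then show ?thesis using that[of "2 * c"] c1 by simp
qed

lemma integral_time_scale:
  fixes f :: "real \<Rightarrow> real"
  assumes f: "f integrable_on {0..a * t}" and a: "0 < a"
  shows "integral {0..a * t} f = a * integral {0..t} (\<lambda>u. f (a * u))"
proof -
  have "((\<lambda>u. f (a * u)) has_integral (1 / \<bar>a\<bar>) *\<^sub>R integral {0..a * t} f) ((\<lambda>x. x / a) ` {0..a * t})"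
    using has_integral_stretch_real[OF integrable_integral[OF f], of a] a by simp
  moreover have "(\<lambda>x. x / a) ` {0..a * t} = {0..t}"
  proof -
    have "x \<in> (\<lambda>x. x / a) ` {0..a * t}" if "x \<in> {0..t}" for x
      using that a by (intro image_eqI[of _ _ "a * x"]) auto
    then show ?thesis using a by (auto simp: divide_le_eq mult.commute)
  qed
  ultimately have "integral {0..t} (\<lambda>u. f (a * u)) = (1 / a) * integral {0..a * t} f"
    using a by (simp add: integral_unique)
  then show ?thesis using a by simp
qed

lemma cadlag_time_scale:
  assumes x: "cadlag x" and a: "0 < a"
  shows "cadlag (\<lambda>t. x (a * t))"
  unfolding cadlag_def
proof (intro conjI allI impI)
  fix t :: real assume t: "0 \<le> t"
  have "filterlim (\<lambda>s. a * s) (at_right (a * t)) (at_right t)"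
    using a by (auto simp: filterlim_at eventually_at_right_field intro!: tendsto_intros exI[of _ "t + 1"])
  moreover have "(x \<longlongrightarrow> x (a * t)) (at_right (a * t))" using x t a unfolding cadlag_def by simp
  ultimately show "((\<lambda>t. x (a * t)) \<longlongrightarrow> x (a * t)) (at_right t)" by (rule filterlim_compose[rotated])
next
  fix t :: real assume t: "0 < t"
  have "filterlim (\<lambda>s. a * s) (at_left (a * t)) (at_left t)"
    using a by (auto simp: filterlim_at eventually_at_left_field intro!: tendsto_intros exI[of _ "t - 1"])
  moreover obtain l where "(x \<longlongrightarrow> l) (at_left (a * t))" using x t a unfolding cadlag_def by (meson mult_pos_pos)
  ultimately show "\<exists>l. ((\<lambda>t. x (a * t)) \<longlongrightarrow> l) (at_left t)" by (blast intro: filterlim_compose[rotated])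
qed

lemma inverse_sqrt_tendsto_0: "(\<lambda>n. 1 / sqrt (real n)) \<longlonglongrightarrow> 0"
  by (intro tendsto_divide_0[OF tendsto_const] filterlim_at_top_imp_at_infinity
      filterlim_compose[OF sqrt_at_top filterlim_real_sequentially])

section \<open>A single arrival stream\<close>

locale arrivals =
  fixes M :: "nat \<Rightarrow> 'a measure" and A :: "nat \<Rightarrow> nat \<Rightarrow> 'a \<Rightarrow> real" and a s :: "nat \<Rightarrow> real" and a' s' :: real
  assumes prob: "\<And>n. prob_space (M n)"
    and iid: "\<And>n. prob_space.indep_vars (M n) (\<lambda>_. borel) (A n) {1..}"
    and id: "\<And>n k. k \<ge> 1 \<Longrightarrow> distr (M n) borel (A n k) = distr (M n) borel (A n 1)"
    and sq: "\<And>n. integrable (M n) (\<lambda>\<omega>. (A n 1 \<omega>)\<^sup>2)"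
    and mean: "\<And>n. (\<integral>\<omega>. A n 1 \<omega> \<partial>M n) = 1 / a n"
    and sd: "\<And>n. s n = sqrt (prob_space.variance (M n) (A n 1))"
    and pos: "\<And>n. measure (M n) {\<omega> \<in> space (M n). A n 1 \<omega> > 0} = 1"
    and ui: "((\<lambda>K::real. \<Squnion>n. \<integral>\<^sup>+\<omega>. (if (A n 1 \<omega>)\<^sup>2 > K then ennreal ((A n 1 \<omega>)\<^sup>2) else 0) \<partial>M n) \<longlongrightarrow> 0) at_top"
    and a_lim: "a \<longlonglongrightarrow> a'" and s_lim: "s \<longlonglongrightarrow> s'" and a'_pos: "0 < a'" and s'_pos: "0 < s'"
begin

lemma meas: "1 \<le> k \<Longrightarrow> A n k \<in> borel_measurable (M n)"
  using iid[of n] prob[of n] by (auto simp: prob_space.indep_vars_def)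

lemma AE_pos_1: "AE \<omega> in M n. 0 < A n 1 \<omega>" and rate_pos: "0 < a n"
  using prob_space.rate_pos_of_pos_interarrival[OF prob meas sq mean pos] by auto

lemma AE_pos: "AE \<omega> in M n. \<forall>k\<ge>1. 0 < A n k \<omega>"
  by (rule prob_space.AE_pos_of_law[where T = "A n", OF prob meas id AE_pos_1])

text \<open>Here \<open>(a' * s')\<^sup>2\<close> is the limiting variance of one step;
  \<open>a'\<close> steps per unit of time turn it into \<open>a' ^ 3 * s'\<^sup>2\<close>.\<close>

sublocale centred_laws "\<lambda>n. distr (M n) borel (\<lambda>\<omega>. a n * A n 1 \<omega> - 1)" "\<lambda>n. (a n * s n)\<^sup>2" "(a' * s')\<^sup>2"
  by (rule arrival_centred_laws[OF prob meas sq mean rate_pos sd ui a_lim s_lim a'_pos s'_pos]) simp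

lemma steps_indep: "prob_space.indep_vars (M n) (\<lambda>_. borel) (\<lambda>i \<omega>. a n * A n i \<omega> - 1) {1..}"
  by (rule prob_space.indep_vars_compose2[OF prob iid]) auto

lemma steps_law: "1 \<le> i \<Longrightarrow> distr (M n) borel (\<lambda>\<omega>. a n * A n i \<omega> - 1) = distr (M n) borel (\<lambda>\<omega>. a n * A n 1 \<omega> - 1)"
  by (rule prob_space.distr_affine_cong[where T = "A n", OF prob meas id])

lemma char_steps_sum:
  assumes "I \<subseteq> {1..}"
  shows "char (distr (M n) borel (\<lambda>\<omega>. \<Sum>i\<in>I. a n * A n i \<omega> - 1)) t
     = char (distr (M n) borel (\<lambda>\<omega>. a n * A n 1 \<omega> - 1)) t ^ card I"
  using prob_space.char_iid_sum[where c = 1 and t = t, OF prob prob_space.indep_vars_subset[OF prob steps_indep[of n] assms] steps_law] assms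
  by auto

definition walk :: "nat \<Rightarrow> nat \<Rightarrow> 'a \<Rightarrow> real" where
  "walk n k \<omega> = (\<Sum>i\<in>{1..k}. a n * A n i \<omega> - 1)"

definition count :: "nat \<Rightarrow> 'a \<Rightarrow> real \<Rightarrow> nat" where
  "count n \<omega> t = renewal_count (\<lambda>k. A n k \<omega>) t"

definition bounded_walk :: "real \<Rightarrow> real \<Rightarrow> nat \<Rightarrow> 'a \<Rightarrow> bool" where
  "bounded_walk K R n \<omega> \<longleftrightarrow> (\<forall>i. real i \<le> K * real n \<longrightarrow> \<bar>walk n i \<omega>\<bar> \<le> R * sqrt (real n))"

definition walk_oscillation :: "real \<Rightarrow> real \<Rightarrow> real \<Rightarrow> nat \<Rightarrow> 'a \<Rightarrow> bool" where
  "walk_oscillation K \<delta> e n \<omega> \<longleftrightarrow> (\<forall>i j. real i \<le> K * real n \<longrightarrow> real j \<le> K * real n \<longrightarrow>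
     \<bar>real i - real j\<bar> \<le> \<delta> * real n \<longrightarrow> \<bar>walk n i \<omega> - walk n j \<omega>\<bar> \<le> e * sqrt (real n))"

text \<open>Makes every index relevant for times up to \<open>T\<close> at most \<open>K n\<close>, and the random index of the
  renewal count within \<open>\<delta> n\<close> of the deterministic one.\<close>

definition large_index :: "real \<Rightarrow> real \<Rightarrow> real \<Rightarrow> real \<Rightarrow> nat \<Rightarrow> bool" where
  "large_index T K R \<delta> n \<longleftrightarrow> a n * (real n * T) < K * real n - 1 - R * sqrt (real n) \<and>
     \<bar>a' - a n\<bar> * (real n * T) + R * sqrt (real n) + 3 \<le> \<delta> * real n"

lemma whp_bounded_walk:
  assumes "0 < K" "0 < \<eta>"
  obtains R where "0 < R" "whp M \<eta> (bounded_walk K R)"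
  unfolding bounded_walk_def walk_def
  by (rule walk_bounded[OF prob steps_indep steps_law assms]) blast

lemma whp_walk_oscillation:
  assumes "0 \<le> K" "0 < e" "0 < \<eta>"
  obtains \<delta> where "0 < \<delta>" "whp M \<eta> (walk_oscillation K \<delta> e)"
  unfolding walk_oscillation_def walk_def whp_def
  by (rule walk_tightness[OF prob steps_indep steps_law assms]) blast

lemma walk_oscillation_mono:
  assumes "walk_oscillation K \<delta> e n \<omega>" "\<delta>' \<le> \<delta>"
  shows "walk_oscillation K \<delta>' e n \<omega>"
proof -
  have "\<delta>' * real n \<le> \<delta> * real n" using assms(2) by (intro mult_right_mono) auto
  then show ?thesis using assms(1) unfolding walk_oscillation_def by (meson order_trans)
qed

lemma eventually_large_index:
  assumes K: "a' * T < K" and \<delta>: "0 < \<delta>"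
  shows "eventually (large_index T K R \<delta>) sequentially"
proof -
  have "(\<lambda>n. a n * T + 1 / real n + R * (1 / sqrt (real n))) \<longlonglongrightarrow> a' * T + 0 + R * 0"
    by (intro tendsto_intros a_lim inverse_sqrt_tendsto_0 lim_1_over_n)
  then have 1: "eventually (\<lambda>n. a n * T + 1 / real n + R * (1 / sqrt (real n)) < K) sequentially"
    using K by (intro order_tendstoD(2)) auto
  have "(\<lambda>n. \<bar>a' - a n\<bar> * T + R * (1 / sqrt (real n)) + 3 * (1 / real n)) \<longlonglongrightarrow> \<bar>a' - a'\<bar> * T + R * 0 + 3 * 0"
    by (intro tendsto_intros a_lim inverse_sqrt_tendsto_0 lim_1_over_n)
  then have 2: "eventually (\<lambda>n. \<bar>a' - a n\<bar> * T + R * (1 / sqrt (real n)) + 3 * (1 / real n) < \<delta>) sequentially"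
    using \<delta> by (intro order_tendstoD(2)) auto
  show ?thesis using 1 2 eventually_gt_at_top[of 0]
  proof eventually_elim
    case (elim n)
    have sn: "real n * (R * (1 / sqrt (real n))) = R * sqrt (real n)"
    proof -
      have "real n / sqrt (real n) = sqrt (real n)" by (rule real_div_sqrt) simp
      moreover have "real n * (R * (1 / sqrt (real n))) = R * (real n / sqrt (real n))" by simp
      ultimately show ?thesis by simp
    qed
    have "real n * (a n * T + 1 / real n + R * (1 / sqrt (real n))) < real n * K"
      using elim by (intro mult_strict_left_mono) auto
    then have "a n * (real n * T) + 1 + R * sqrt (real n) < K * real n"
      using elim sn by (simp add: distrib_left mult_ac)
    moreover have "real n * (\<bar>a' - a n\<bar> * T + R * (1 / sqrt (real n)) + 3 * (1 / real n)) \<le> real n * \<delta>"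
      using elim by (intro mult_left_mono) auto
    then have "\<bar>a' - a n\<bar> * (real n * T) + R * sqrt (real n) + 3 \<le> \<delta> * real n"
      using elim sn by (simp add: distrib_left mult_ac)
    ultimately show ?case unfolding large_index_def by linarith
  qed
qed

lemma index_bounds:
  assumes K: "a' * T \<le> K" and t: "t \<in> {0..T}"
  shows "nat \<lfloor>a' * t * real n\<rfloor> \<le> nat \<lfloor>K * real n\<rfloor>" "real (nat \<lfloor>a' * t * real n\<rfloor>) \<le> K * real n"
    "\<bar>real (nat \<lfloor>a' * t * real n\<rfloor>) - a' * t * real n\<bar> \<le> 1"
proof -
  have "a' * t \<le> a' * T" using t a'_pos by (intro mult_left_mono) auto
  then have le: "a' * t * real n \<le> K * real n" using K by (intro mult_right_mono) auto
  then show "nat \<lfloor>a' * t * real n\<rfloor> \<le> nat \<lfloor>K * real n\<rfloor>" by (intro nat_mono floor_mono)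
  have "0 \<le> a' * t * real n" using t a'_pos by simp
  then show "\<bar>real (nat \<lfloor>a' * t * real n\<rfloor>) - a' * t * real n\<bar> \<le> 1" "real (nat \<lfloor>a' * t * real n\<rfloor>) \<le> K * real n"
    using le by linarith+
qed

text \<open>To leading order a renewal count is its mean minus the walk at a deterministic index;
  the error is \<open>e * sqrt n\<close> up to a constant, on events of high probability and
  uniformly for times up to \<open>T\<close>.\<close>

lemma count_approx:
  assumes pos: "\<And>k. 1 \<le> k \<Longrightarrow> 0 < A n k \<omega>" and bd: "bounded_walk K R n \<omega>" and osc: "walk_oscillation K \<delta> e n \<omega>"
    and large: "large_index T K R \<delta> n" and K: "a' * T \<le> K" and t: "t \<in> {0..T}"
  shows "\<bar>real (count n \<omega> (real n * t)) - a n * (real n * t) + walk n (nat \<lfloor>a' * t * real n\<rfloor>) \<omega>\<bar> \<le> 1 + e * sqrt (real n)"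
  unfolding count_def
proof (rule renewal_count_approx[where K = "nat \<lfloor>K * real n\<rfloor>" and B = "R * sqrt (real n)" and \<delta> = "\<delta> * real n"])
  have "0 \<le> a' * T" using a'_pos t by auto
  then have K0: "0 \<le> K * real n" using K by (intro mult_nonneg_nonneg) auto
  have KI: "real i \<le> K * real n" if "i \<le> nat \<lfloor>K * real n\<rfloor>" for i using that K0 by linarith
  show "\<bar>walk n i \<omega>\<bar> \<le> R * sqrt (real n)" if "i \<le> nat \<lfloor>K * real n\<rfloor>" for i
    using bd KI[OF that] by (simp add: bounded_walk_def)
  show "\<bar>walk n i \<omega> - walk n j \<omega>\<bar> \<le> e * sqrt (real n)"
    if "i \<le> nat \<lfloor>K * real n\<rfloor>" "j \<le> nat \<lfloor>K * real n\<rfloor>" "\<bar>real i - real j\<bar> \<le> \<delta> * real n" for i j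
    using osc KI[OF that(1)] KI[OF that(2)] that(3) by (simp add: walk_oscillation_def)
  have "a n * (real n * t) \<le> a n * (real n * T)" using t rate_pos[of n] by (intro mult_left_mono) auto
  \<comment> \<open>Rounding down \<open>K * n\<close> costs at most 1, which is the
    \<open>1\<close> in \<open>large_index\<close>.\<close>
  moreover have "K * real n - 1 < real (nat \<lfloor>K * real n\<rfloor>)" using K0 by linarith
  ultimately show "a n * (real n * t) < real (nat \<lfloor>K * real n\<rfloor>) - R * sqrt (real n)"
    using large unfolding large_index_def by linarith
  have "\<bar>a' * t * real n - a n * (real n * t)\<bar> = \<bar>a' - a n\<bar> * (real n * t)"
  proof -
    have "a' * t * real n - a n * (real n * t) = (a' - a n) * (real n * t)" by (simp add: algebra_simps)
    then show ?thesis using t by (simp add: abs_mult)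
  qed
  also have "\<dots> \<le> \<bar>a' - a n\<bar> * (real n * T)" using t by (intro mult_left_mono) auto
  \<comment> \<open>The \<open>3\<close> in \<open>large_index\<close> is the \<open>2\<close>
    required here plus 1 for rounding the index.\<close>
  finally show "\<bar>real (nat \<lfloor>a' * t * real n\<rfloor>) - a n * (real n * t)\<bar> + R * sqrt (real n) + 2 \<le> \<delta> * real n"
    using large index_bounds(3)[OF K t, of n] unfolding large_index_def by linarith
qed (use pos rate_pos t index_bounds(1)[OF K t, of n] in \<open>auto simp: walk_def\<close>)

text \<open>Times within \<open>h\<close> have indices within \<open>a' * h * n\<close>, up to 1 for
  rounding, so the modulus of the walk applies once the mesh is fine enough.\<close>

lemma walk_mesh_oscillation:
  assumes osc: "walk_oscillation K \<delta> e n \<omega>" and K: "a' * T \<le> K" and st: "q \<in> {0..T}" "t \<in> {0..T}"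
    and mesh: "q \<le> t" "t \<le> q + h" "a' * h * real n + 1 \<le> \<delta> * real n"
  shows "\<bar>walk n (nat \<lfloor>a' * t * real n\<rfloor>) \<omega> - walk n (nat \<lfloor>a' * q * real n\<rfloor>) \<omega>\<bar> \<le> e * sqrt (real n)"
proof -
  have "a' * t * real n - a' * q * real n = a' * (t - q) * real n" by (simp add: algebra_simps)
  also have "\<dots> \<le> a' * h * real n" using mesh a'_pos by (intro mult_right_mono mult_left_mono) auto
  finally have "a' * t * real n - a' * q * real n \<le> a' * h * real n" .
  moreover have "a' * q * real n \<le> a' * t * real n" using mesh a'_pos by (intro mult_right_mono mult_left_mono) auto
  moreover have "0 \<le> a' * q * real n" using st a'_pos by simp
  ultimately have "\<bar>real (nat \<lfloor>a' * t * real n\<rfloor>) - real (nat \<lfloor>a' * q * real n\<rfloor>)\<bar> \<le> a' * h * real n + 1" by linarith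
  then show ?thesis using osc mesh(3) index_bounds(2)[OF K st(1), of n] index_bounds(2)[OF K st(2), of n]
    unfolding walk_oscillation_def by auto
qed

end

section \<open>The double-ended queue\<close>

locale double_ended_queue =
  AU: arrivals M U \<alpha>n \<sigma>n \<alpha> \<sigma> + AV: arrivals M V \<beta>n \<zeta>n \<beta> \<zeta>
  for M :: "nat \<Rightarrow> 'a measure" and U V \<alpha>n \<beta>n \<sigma>n \<zeta>n and \<alpha> \<beta> \<sigma> \<zeta> +
  fixes Nsr Nbr :: "nat \<Rightarrow> 'a \<Rightarrow> real \<Rightarrow> nat" and X0 :: "nat \<Rightarrow> 'a \<Rightarrow> int" and X :: "nat \<Rightarrow> 'a \<Rightarrow> real \<Rightarrow> int"
    and \<theta>n \<gamma>n :: "nat \<Rightarrow> real" and \<theta> \<gamma> c :: real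
  assumes Psr: "\<And>n. unit_poisson_process (M n) (Nsr n)"
    and Pbr: "\<And>n. unit_poisson_process (M n) (Nbr n)"
    and X0_meas: "\<And>n. X0 n \<in> measurable (M n) (count_space UNIV)"
    and indep: "\<And>n. prob_space.indep_sets (M n)
        (\<lambda>i::nat. if i = 0 then gen_sets (M n) (\<lambda>\<omega> k. U n k \<omega>) (Pi\<^sub>M UNIV (\<lambda>_. borel))
              else if i = 1 then gen_sets (M n) (\<lambda>\<omega> k. V n k \<omega>) (Pi\<^sub>M UNIV (\<lambda>_. borel))
              else if i = 2 then gen_sets (M n) (\<lambda>\<omega> t. real (Nsr n \<omega> t)) (Pi\<^sub>M UNIV (\<lambda>_. borel))
              else if i = 3 then gen_sets (M n) (\<lambda>\<omega> t. real (Nbr n \<omega> t)) (Pi\<^sub>M UNIV (\<lambda>_. borel))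
              else gen_sets (M n) (X0 n) (count_space UNIV))
        {0..4}"
    and \<theta>n_pos: "\<And>n. \<theta>n n > 0"
    and \<gamma>n_pos: "\<And>n. \<gamma>n n > 0"
    and X_meas: "\<And>n t. (\<lambda>\<omega>. X n \<omega> t) \<in> measurable (M n) (count_space UNIV)"
    and X_cadlag: "\<And>n \<omega>. \<omega> \<in> space (M n) \<Longrightarrow> cadlag (\<lambda>t. real_of_int (X n \<omega> t))"
    and X_eq: "\<And>n. AE \<omega> in M n. \<forall>t\<ge>0. X n \<omega> t =
        X0 n \<omega> + int (renewal_count (\<lambda>k. U n k \<omega>) t) - int (renewal_count (\<lambda>k. V n k \<omega>) t)
        - int (Nsr n \<omega> (\<theta>n n * integral {0..t} (\<lambda>s. real_of_int (max (X n \<omega> s) 0))))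
        + int (Nbr n \<omega> (\<gamma>n n * integral {0..t} (\<lambda>s. real_of_int (max (- X n \<omega> s) 0))))"
    and \<theta>_lim: "(\<lambda>n. real n * \<theta>n n) \<longlonglongrightarrow> \<theta>" and \<theta>_pos: "\<theta> > 0"
    and \<gamma>_lim: "(\<lambda>n. real n * \<gamma>n n) \<longlonglongrightarrow> \<gamma>" and \<gamma>_pos: "\<gamma> > 0"
    and diff_lim: "(\<lambda>n. sqrt (real n) * (\<alpha>n n - \<beta>n n)) \<longlonglongrightarrow> c"
begin

lemmas prob = AU.prob and U_AE_all_pos = AU.AE_pos and V_AE_all_pos = AV.AE_pos

lemmas pos = AU.a'_pos AV.a'_pos AU.s'_pos AV.s'_pos

text \<open>Weak convergence is assumed for the queue at time 0, while independence is known for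
  \<open>X0\<close>; the two have to be identified almost surely.\<close>

lemma X_initial: "AE \<omega> in M n. X n \<omega> 0 = X0 n \<omega>"
proof -
  have sr: "AE \<omega> in M n. Nsr n \<omega> 0 = 0 \<and> mono_on {0..} (Nsr n \<omega>) \<and> (\<forall>t\<ge>0. ((\<lambda>s. real (Nsr n \<omega> s)) \<longlongrightarrow> real (Nsr n \<omega> t)) (at_right t))"
    using Psr[of n] by (simp add: unit_poisson_process_def)
  have br: "AE \<omega> in M n. Nbr n \<omega> 0 = 0 \<and> mono_on {0..} (Nbr n \<omega>) \<and> (\<forall>t\<ge>0. ((\<lambda>s. real (Nbr n \<omega> s)) \<longlongrightarrow> real (Nbr n \<omega> t)) (at_right t))"
    using Pbr[of n] by (simp add: unit_poisson_process_def)
  show ?thesis using X_eq[of n] U_AE_all_pos[of n] V_AE_all_pos[of n] sr br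
  proof eventually_elim
    case (elim \<omega>)
    have "renewal_count (\<lambda>k. U n k \<omega>) 0 = 0" "renewal_count (\<lambda>k. V n k \<omega>) 0 = 0"
      using elim by (auto intro: renewal_count_0)
    then show ?case using elim(1)[rule_format, of 0] elim(4,5) by simp
  qed
qed

text \<open>Increments over the grid \<open>k/m\<close> of the driving path of the diffusively scaled queue, preceded
  by the initial value.\<close>

definition increment :: "nat \<Rightarrow> nat \<Rightarrow> nat \<Rightarrow> 'a \<Rightarrow> real" where
  "increment m n k \<omega> = (case k of 0 \<Rightarrow> real_of_int (X0 n \<omega>) / sqrt (real n)
     | Suc k \<Rightarrow> (- (\<Sum>i\<in>{grid_index \<alpha> m n k<..grid_index \<alpha> m n (Suc k)}. \<alpha>n n * U n i \<omega> - 1)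
                + (\<Sum>i\<in>{grid_index \<beta> m n k<..grid_index \<beta> m n (Suc k)}. \<beta>n n * V n i \<omega> - 1)) / sqrt (real n) + c / real m)"

lemma input_indep:
  "prob_space.indep_vars (M n) (\<lambda>_. borel) (case_sum (case_sum (U n) (V n)) (\<lambda>_ \<omega>. real_of_int (X0 n \<omega>))) (({1..} <+> {1..}) <+> {()})"
  by (rule prob_space.indep_vars_queue_input[OF prob indep _ _ _ AU.iid AV.iid X0_meas]) auto

text \<open>Coordinate 0 uses the initial value and coordinate \<open>Suc k\<close> one block of
  each stream. The blocks have deterministic, monotone boundaries, so they are disjoint parts of one
  independent family.\<close>

lemma increment_indep: "prob_space.indep_vars (M n) (\<lambda>_. borel) (increment m n) UNIV"
proof -
  define R :: "(nat + nat) + unit \<Rightarrow> 'a \<Rightarrow> real" where "R = case_sum (case_sum (U n) (V n)) (\<lambda>_ \<omega>. real_of_int (X0 n \<omega>))"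
  define A where "A k = {grid_index \<alpha> m n k<..grid_index \<alpha> m n (Suc k)}" for k
  define B where "B k = {grid_index \<beta> m n k<..grid_index \<beta> m n (Suc k)}" for k
  define K where "K k = (case k of 0 \<Rightarrow> {Inr ()} | Suc k \<Rightarrow> Inl ` (Inl ` A k \<union> Inr ` B k))" for k
  define g where "g k x = (case k of 0 \<Rightarrow> x (Inr ()) / sqrt (real n)
     | Suc k \<Rightarrow> (- (\<Sum>i\<in>A k. \<alpha>n n * x (Inl (Inl i)) - 1) + (\<Sum>i\<in>B k. \<beta>n n * x (Inl (Inr i)) - 1)) / sqrt (real n) + c / real m)"
    for k and x :: "(nat + nat) + unit \<Rightarrow> real"
  have disj: "D k \<inter> D l = {}" if "k \<noteq> l" and D: "\<And>k. D k = {grid_index y m n k<..grid_index y m n (Suc k)}" and y: "0 \<le> y" for D y k l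
  proof -
    have "D k \<inter> D l = {}" if "k < l" for k l
      using grid_index_mono[OF y, of "Suc k" l m n] that by (auto simp: D)
    then show ?thesis using \<open>k \<noteq> l\<close> by (cases "k < l") (auto simp: Int_commute not_less le_less)
  qed
  have dA: "A k \<inter> A l = {}" and dB: "B k \<inter> B l = {}" if "k \<noteq> l" for k l
    using disj[OF that, of A \<alpha>] disj[OF that, of B \<beta>] pos by (auto simp: A_def B_def)
  show ?thesis
  proof (rule prob_space.indep_vars_blocks[OF prob input_indep[of n, folded R_def], where K = K and g = g])
    show "K k \<subseteq> ({1..} <+> {1..}) <+> {()}" for k by (cases k) (auto simp: K_def A_def B_def)
    show "disjoint_family_on K UNIV" unfolding disjoint_family_on_def
    proof (intro ballI impI)
      fix k l :: nat assume "k \<noteq> l"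
      then show "K k \<inter> K l = {}" using dA[of "k - 1" "l - 1"] dB[of "k - 1" "l - 1"]
        by (cases k; cases l) (auto simp: K_def)
    qed
    show "g k \<in> borel_measurable (Pi\<^sub>M (K k) (\<lambda>_. borel))" for k
    proof (cases k)
      case 0
      have "(\<lambda>x. x (Inr ())) \<in> borel_measurable (Pi\<^sub>M (K 0) (\<lambda>_. borel))"
        by (rule measurable_component_singleton) (simp add: K_def)
      then show ?thesis unfolding g_def 0 nat.case by (intro borel_measurable_divide borel_measurable_const)
    next
      case (Suc l)
      have "(\<lambda>x. x (Inl (Inl i))) \<in> borel_measurable (Pi\<^sub>M (K k) (\<lambda>_. borel))" if "i \<in> A l" for i
        using that by (intro measurable_component_singleton) (auto simp: K_def Suc)
      moreover have "(\<lambda>x. x (Inl (Inr i))) \<in> borel_measurable (Pi\<^sub>M (K k) (\<lambda>_. borel))" if "i \<in> B l" for i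
        using that by (intro measurable_component_singleton) (auto simp: K_def Suc)
      ultimately show ?thesis unfolding g_def Suc nat.case
        by (intro borel_measurable_add borel_measurable_divide borel_measurable_uminus borel_measurable_sum borel_measurable_diff borel_measurable_times borel_measurable_const) auto
    qed
    show "increment m n k \<omega> = g k (restrict (\<lambda>i. R i \<omega>) (K k))" for k \<omega>
    proof (cases k)
      case (Suc l)
      have "(\<Sum>i\<in>A l. \<alpha>n n * restrict (\<lambda>i. R i \<omega>) (K k) (Inl (Inl i)) - 1) = (\<Sum>i\<in>A l. \<alpha>n n * U n i \<omega> - 1)"
        by (intro sum.cong refl) (auto simp: K_def Suc R_def)
      moreover have "(\<Sum>i\<in>B l. \<beta>n n * restrict (\<lambda>i. R i \<omega>) (K k) (Inl (Inr i)) - 1) = (\<Sum>i\<in>B l. \<beta>n n * V n i \<omega> - 1)"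
        by (intro sum.cong refl) (auto simp: K_def Suc R_def)
      ultimately show ?thesis unfolding g_def increment_def Suc nat.case A_def B_def by simp
    qed (simp add: g_def increment_def K_def R_def)
  qed
qed

lemma increment_char:
  "char (distr (M n) borel (increment m n (Suc k))) t = iexp (t * (c / real m)) *
     (char (distr (M n) borel (\<lambda>\<omega>. \<alpha>n n * U n 1 \<omega> - 1)) (- t / sqrt (real n)) ^ card {grid_index \<alpha> m n k<..grid_index \<alpha> m n (Suc k)} *
      char (distr (M n) borel (\<lambda>\<omega>. \<beta>n n * V n 1 \<omega> - 1)) (t / sqrt (real n)) ^ card {grid_index \<beta> m n k<..grid_index \<beta> m n (Suc k)})"
proof -
  interpret prob_space "M n" by (rule prob)
  define R :: "(nat + nat) + unit \<Rightarrow> 'a \<Rightarrow> real" where "R = case_sum (case_sum (U n) (V n)) (\<lambda>_ \<omega>. real_of_int (X0 n \<omega>))"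
  define A where "A = {grid_index \<alpha> m n k<..grid_index \<alpha> m n (Suc k)}"
  define B where "B = {grid_index \<beta> m n k<..grid_index \<beta> m n (Suc k)}"
  define KA :: "((nat + nat) + unit) set" where "KA = Inl ` Inl ` A"
  define KB :: "((nat + nat) + unit) set" where "KB = Inl ` Inr ` B"
  let ?SA = "\<lambda>\<omega>. \<Sum>i\<in>A. \<alpha>n n * U n i \<omega> - 1" and ?SB = "\<lambda>\<omega>. \<Sum>i\<in>B. \<beta>n n * V n i \<omega> - 1"
  have sub: "A \<subseteq> {1..}" "B \<subseteq> {1..}" by (auto simp: A_def B_def)
  have "indep_var (Pi\<^sub>M KA (\<lambda>_. borel)) (\<lambda>\<omega>. restrict (\<lambda>i. R i \<omega>) KA) (Pi\<^sub>M KB (\<lambda>_. borel)) (\<lambda>\<omega>. restrict (\<lambda>i. R i \<omega>) KB)"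
    by (rule indep_var_restrict[OF input_indep[of n, folded R_def]]) (use sub in \<open>auto simp: KA_def KB_def\<close>)
  moreover have "(\<lambda>x. \<Sum>i\<in>A. \<alpha>n n * x (Inl (Inl i)) - 1) \<in> borel_measurable (Pi\<^sub>M KA (\<lambda>_. borel))"
    by (intro borel_measurable_sum borel_measurable_diff borel_measurable_times borel_measurable_const measurable_component_singleton)
      (auto simp: KA_def)
  moreover have "(\<lambda>x. \<Sum>i\<in>B. \<beta>n n * x (Inl (Inr i)) - 1) \<in> borel_measurable (Pi\<^sub>M KB (\<lambda>_. borel))"
    by (intro borel_measurable_sum borel_measurable_diff borel_measurable_times borel_measurable_const measurable_component_singleton)
      (auto simp: KB_def)
  ultimately have ind: "indep_var borel ((\<lambda>x. \<Sum>i\<in>A. \<alpha>n n * x (Inl (Inl i)) - 1) \<circ> (\<lambda>\<omega>. restrict (\<lambda>i. R i \<omega>) KA))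
      borel ((\<lambda>x. \<Sum>i\<in>B. \<beta>n n * x (Inl (Inr i)) - 1) \<circ> (\<lambda>\<omega>. restrict (\<lambda>i. R i \<omega>) KB))"
    by (rule indep_var_compose)
  have eqA: "(\<lambda>x. \<Sum>i\<in>A. \<alpha>n n * x (Inl (Inl i)) - 1) \<circ> (\<lambda>\<omega>. restrict (\<lambda>i. R i \<omega>) KA) = ?SA"
    by (rule ext) (auto simp: KA_def R_def intro!: sum.cong)
  have eqB: "(\<lambda>x. \<Sum>i\<in>B. \<beta>n n * x (Inl (Inr i)) - 1) \<circ> (\<lambda>\<omega>. restrict (\<lambda>i. R i \<omega>) KB) = ?SB"
    by (rule ext) (auto simp: KB_def R_def intro!: sum.cong)
  have ind': "indep_var borel ?SA borel ?SB" using ind unfolding eqA eqB .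
  have "increment m n (Suc k) = (\<lambda>\<omega>. (- ?SA \<omega> + ?SB \<omega>) / sqrt (real n) + c / real m)"
    by (rule ext) (simp add: increment_def A_def B_def)
  then show ?thesis
    using char_indep_combination[OF ind', of "sqrt (real n)" "c / real m" t] AU.char_steps_sum[OF sub(1)] AV.char_steps_sum[OF sub(2)]
    by (simp add: A_def B_def)
qed

lemma increment_weak_conv:
  assumes W: "standard_BM N W" and m: "0 < m"
  shows "weak_conv_m (\<lambda>n. distr (M n) borel (increment m n (Suc k)))
    (distr N borel (\<lambda>\<omega>. sqrt (\<alpha> ^ 3 * \<sigma>\<^sup>2 + \<beta> ^ 3 * \<zeta>\<^sup>2) * (W \<omega> (real (Suc k) / real m) - W \<omega> (real k / real m)) + c / real m))"
proof (rule levy_continuity)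
  define s where "s = sqrt (\<alpha> ^ 3 * \<sigma>\<^sup>2 + \<beta> ^ 3 * \<zeta>\<^sup>2)"
  interpret N: prob_space N using W by (simp add: standard_BM_def)
  have W_meas[measurable]: "(\<lambda>\<omega>. W \<omega> t) \<in> borel_measurable N" for t using W by (simp add: standard_BM_def)
  show "real_distribution (distr N borel (\<lambda>\<omega>. s * (W \<omega> (real (Suc k) / real m) - W \<omega> (real k / real m)) + c / real m))"
    by (intro N.real_distribution_distr) measurable
  fix n
  show "real_distribution (distr (M n) borel (increment m n (Suc k)))"
    using increment_indep[of n m] prob[of n] by (intro prob_space.real_distribution_distr) (auto simp: prob_space.indep_vars_def)
next
  fix t
  define s where "s = sqrt (\<alpha> ^ 3 * \<sigma>\<^sup>2 + \<beta> ^ 3 * \<zeta>\<^sup>2)"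
  interpret N: prob_space N using W by (simp add: standard_BM_def)
  have "real k / real m < real (Suc k) / real m" using m by (simp add: divide_strict_right_mono)
  moreover have "0 \<le> real k / real m" by simp
  ultimately have "distributed N lborel (\<lambda>\<omega>. W \<omega> (real (Suc k) / real m) - W \<omega> (real k / real m))
     (normal_density 0 (sqrt (real (Suc k) / real m - real k / real m)))"
    using W unfolding standard_BM_def by blast
  also have "real (Suc k) / real m - real k / real m = 1 / real m" by (simp add: diff_divide_distrib[symmetric])
  finally have "char (distr N borel (\<lambda>\<omega>. s * (W \<omega> (real (Suc k) / real m) - W \<omega> (real k / real m)) + c / real m)) t
     = iexp (t * (c / real m)) * complex_of_real (exp (- ((t * s * sqrt (1 / real m))\<^sup>2 / 2)))"
    using m by (intro char_affine_normal N.prob_space_axioms) auto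
  \<comment> \<open>The variance over a cell is split between the streams:
    \<open>(\<alpha> * \<sigma>)\<^sup>2\<close> per step with \<open>\<alpha> / m\<close> steps in
    the scaled limit, and correspondingly for the buyers. This is the form in which
    \<open>char_power_tendsto\<close> delivers it.\<close>
  also have "(t * s * sqrt (1 / real m))\<^sup>2 / 2 = t\<^sup>2 * (\<alpha> * \<sigma>)\<^sup>2 * (\<alpha> / real m) / 2 + t\<^sup>2 * (\<beta> * \<zeta>)\<^sup>2 * (\<beta> / real m) / 2"
  proof -
    have "s\<^sup>2 = \<alpha> ^ 3 * \<sigma>\<^sup>2 + \<beta> ^ 3 * \<zeta>\<^sup>2" unfolding s_def using pos by (intro real_sqrt_pow2) auto
    then have "(t * s * sqrt (1 / real m))\<^sup>2 = t\<^sup>2 * (\<alpha> ^ 3 * \<sigma>\<^sup>2 + \<beta> ^ 3 * \<zeta>\<^sup>2) / real m"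
      by (simp add: power_mult_distrib)
    then show ?thesis by (simp add: power_mult_distrib power2_eq_square power3_eq_cube algebra_simps add_divide_distrib)
  qed
  finally have lim: "char (distr N borel (\<lambda>\<omega>. s * (W \<omega> (real (Suc k) / real m) - W \<omega> (real k / real m)) + c / real m)) t
     = iexp (t * (c / real m)) * (complex_of_real (exp (- ((- t)\<^sup>2 * (\<alpha> * \<sigma>)\<^sup>2 * (\<alpha> / real m) / 2))) *
         complex_of_real (exp (- (t\<^sup>2 * (\<beta> * \<zeta>)\<^sup>2 * (\<beta> / real m) / 2))))"
    by (simp add: exp_add[symmetric] of_real_mult[symmetric] del: of_real_mult)
  have "(\<lambda>n. char (distr (M n) borel (increment m n (Suc k))) t) \<longlonglongrightarrow>
     char (distr N borel (\<lambda>\<omega>. s * (W \<omega> (real (Suc k) / real m) - W \<omega> (real k / real m)) + c / real m)) t"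
    unfolding increment_char lim using pos m
    by (intro tendsto_mult tendsto_const AU.char_power_tendsto AV.char_power_tendsto grid_index_diff_tendsto) auto
  then show "(\<lambda>n. char (distr (M n) borel (increment m n (Suc k))) t) \<longlonglongrightarrow>
     char (distr N borel (\<lambda>\<omega>. sqrt (\<alpha> ^ 3 * \<sigma>\<^sup>2 + \<beta> ^ 3 * \<zeta>\<^sup>2) * (W \<omega> (real (Suc k) / real m) - W \<omega> (real k / real m)) + c / real m)) t"
    unfolding s_def .
qed

end

section \<open>Drift, driving path and pathwise comparison with the Euler scheme\<close>

context double_ended_queue
begin

definition drift :: "real \<Rightarrow> real" where
  "drift x = \<gamma> * max (- x) 0 - \<theta> * max x 0"

lemma drift_0 [simp]: "drift 0 = 0" by (simp add: drift_def)

lemma drift_lipschitz: "\<bar>drift x - drift y\<bar> \<le> (\<theta> + \<gamma>) * \<bar>x - y\<bar>"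
proof -
  have "drift x - drift y = \<gamma> * (max (- x) 0 - max (- y) 0) - \<theta> * (max x 0 - max y 0)"
    by (simp add: drift_def algebra_simps)
  also have "\<bar>\<dots>\<bar> \<le> \<gamma> * \<bar>max (- x) 0 - max (- y) 0\<bar> + \<theta> * \<bar>max x 0 - max y 0\<bar>"
    using \<theta>_pos \<gamma>_pos by (intro order_trans[OF abs_triangle_ineq4]) (simp add: abs_mult)
  also have "\<dots> \<le> \<gamma> * \<bar>x - y\<bar> + \<theta> * \<bar>x - y\<bar>"
    using \<theta>_pos \<gamma>_pos by (intro add_mono mult_left_mono) auto
  finally show ?thesis by (simp add: algebra_simps)
qed

lemma drift_lipschitz': "\<theta> + \<gamma> \<le> L \<Longrightarrow> \<bar>drift x - drift y\<bar> \<le> L * \<bar>x - y\<bar>"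
  by (rule order_trans[OF drift_lipschitz]) (simp add: mult_right_mono)

lemma continuous_drift: "continuous_on UNIV drift"
  using drift_lipschitz by (rule lipschitz_continuous_real)

lemma integral_drift:
  assumes "cadlag x"
  shows "integral {0..t} (\<lambda>s. drift (x s)) = \<gamma> * integral {0..t} (\<lambda>s. max (- x s) 0) - \<theta> * integral {0..t} (\<lambda>s. max (x s) 0)"
proof -
  have "cadlag (\<lambda>s. max (- x s) 0)" by (rule cadlag_compose[OF assms, of "\<lambda>z. max (- z) 0"]) (intro continuous_intros)
  moreover have "cadlag (\<lambda>s. max (x s) 0)" by (rule cadlag_compose[OF assms, of "\<lambda>z. max z 0"]) (intro continuous_intros)
  ultimately show ?thesis unfolding drift_def
    by (subst integral_diff) (auto intro!: integrable_on_mult_right cadlag_integrable)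
qed

text \<open>Each count is replaced by its mean minus a walk, hence the minus sign for the sellers'
  walk and the plus sign for the buyers'. The difference of the scaled means is already replaced by
  its limit \<open>c * t\<close>.\<close>

definition driving :: "nat \<Rightarrow> 'a \<Rightarrow> real \<Rightarrow> real" where
  "driving n \<omega> t = real_of_int (X0 n \<omega>) / sqrt (real n)
     + (- AU.walk n (nat \<lfloor>\<alpha> * t * real n\<rfloor>) \<omega> + AV.walk n (nat \<lfloor>\<beta> * t * real n\<rfloor>) \<omega>) / sqrt (real n) + c * t"

text \<open>At grid times the rounded indices of the walks are exactly the \<open>grid_index\<close>
  values, so the increments telescope without error, as \<open>euler_path_close\<close>
  requires.\<close>

lemma driving_grid: "driving n \<omega> (real k / real m) = (\<Sum>i\<le>k. increment m n i \<omega>)"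
proof (induction k)
  case 0
  then show ?case by (simp add: driving_def AU.walk_def AV.walk_def increment_def)
next
  case (Suc k)
  have split: "(\<Sum>i\<in>{1..b}. f i) = (\<Sum>i\<in>{1..a}. f i) + (\<Sum>i\<in>{a<..b}. f i)" if "a \<le> b" for a b and f :: "nat \<Rightarrow> real"
    using that by (subst sum.union_disjoint[symmetric]) (auto intro!: sum.cong)
  have a0: "0 \<le> \<alpha>" "0 \<le> \<beta>" using pos by auto
  have "driving n \<omega> (real (Suc k) / real m) = driving n \<omega> (real k / real m) + increment m n (Suc k) \<omega>"
    unfolding increment_def nat.case driving_def AU.walk_def AV.walk_def grid_index_def[symmetric]
      split[OF grid_index_mono[OF a0(1), of k "Suc k" m n, OF le_SucI[OF order_refl]]]
      split[OF grid_index_mono[OF a0(2), of k "Suc k" m n, OF le_SucI[OF order_refl]]]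
    by (simp add: add_divide_distrib diff_divide_distrib algebra_simps)
  then show ?case using Suc by simp
qed

definition poisson_close :: "real \<Rightarrow> real \<Rightarrow> nat \<Rightarrow> (real \<Rightarrow> nat) \<Rightarrow> bool" where
  "poisson_close C e n P \<longleftrightarrow> (\<forall>y. 0 \<le> y \<longrightarrow> y \<le> C * sqrt (real n) \<longrightarrow> \<bar>real (P y) - y\<bar> \<le> e * sqrt (real n))"

definition queue_equation :: "nat \<Rightarrow> 'a \<Rightarrow> bool" where
  "queue_equation n \<omega> \<longleftrightarrow> (\<forall>t\<ge>0. X n \<omega> t = X0 n \<omega> + int (AU.count n \<omega> t) - int (AV.count n \<omega> t)
     - int (Nsr n \<omega> (\<theta>n n * integral {0..t} (\<lambda>s. real_of_int (max (X n \<omega> s) 0))))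
     + int (Nbr n \<omega> (\<gamma>n n * integral {0..t} (\<lambda>s. real_of_int (max (- X n \<omega> s) 0)))))"

definition scaled_queue :: "nat \<Rightarrow> 'a \<Rightarrow> real \<Rightarrow> real" where
  "scaled_queue n \<omega> t = real_of_int (X n \<omega> (real n * t)) / sqrt (real n)"

text \<open>The time change contributes a factor \<open>n\<close> to the departure integrals and the
  space scaling a factor \<open>sqrt n\<close>. Since \<open>n * \<theta>n n\<close> and
  \<open>n * \<gamma>n n\<close> converge, the Poisson arguments are of order \<open>sqrt n\<close>
  as long as the scaled queue is bounded.\<close>

lemma scaled_queue_equation:
  assumes n: "0 < n" and cad: "cadlag (\<lambda>t. real_of_int (X n \<omega> t))" and eq: "queue_equation n \<omega>" and t: "0 \<le> t"
  shows "scaled_queue n \<omega> t = real_of_int (X0 n \<omega>) / sqrt (real n)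
     + real (AU.count n \<omega> (real n * t)) / sqrt (real n) - real (AV.count n \<omega> (real n * t)) / sqrt (real n)
     - real (Nsr n \<omega> (sqrt (real n) * (real n * \<theta>n n * integral {0..t} (\<lambda>s. max (scaled_queue n \<omega> s) 0)))) / sqrt (real n)
     + real (Nbr n \<omega> (sqrt (real n) * (real n * \<gamma>n n * integral {0..t} (\<lambda>s. max (- scaled_queue n \<omega> s) 0)))) / sqrt (real n)"
proof -
  define r where "r = sqrt (real n)"
  have r: "0 < r" using n by (simp add: r_def)
  have time_change: "integral {0..real n * t} (\<lambda>s. max (z * real_of_int (X n \<omega> s)) 0)
     = real n * r * integral {0..t} (\<lambda>s. max (z * scaled_queue n \<omega> s) 0)" for z :: real
  proof -
    have i: "(\<lambda>s. max (z * real_of_int (X n \<omega> s)) 0) integrable_on {0..real n * t}"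
      by (intro cadlag_integrable cadlag_compose[OF cad, of "\<lambda>y. max (z * y) 0"] continuous_intros) auto
    have "integral {0..real n * t} (\<lambda>s. max (z * real_of_int (X n \<omega> s)) 0)
       = real n * integral {0..t} (\<lambda>s. max (z * real_of_int (X n \<omega> (real n * s))) 0)"
      using integral_time_scale[OF i] n by simp
    also have "(\<lambda>s. max (z * real_of_int (X n \<omega> (real n * s))) 0) = (\<lambda>s. r * max (z * scaled_queue n \<omega> s) 0)"
    proof
      fix s
      have "z * real_of_int (X n \<omega> (real n * s)) = r * (z * scaled_queue n \<omega> s)"
        using r by (simp add: scaled_queue_def r_def)
      moreover have "r * max (z * scaled_queue n \<omega> s) 0 = max (r * (z * scaled_queue n \<omega> s)) 0"
        using r max_mult_distrib_left[of r "z * scaled_queue n \<omega> s" 0] by simp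
      ultimately show "max (z * real_of_int (X n \<omega> (real n * s))) 0 = r * max (z * scaled_queue n \<omega> s) 0" by metis
    qed
    finally show ?thesis by simp
  qed
  have "real_of_int (X n \<omega> (real n * t)) = real_of_int (X0 n \<omega>) + real (AU.count n \<omega> (real n * t)) - real (AV.count n \<omega> (real n * t))
     - real (Nsr n \<omega> (\<theta>n n * integral {0..real n * t} (\<lambda>s. max (1 * real_of_int (X n \<omega> s)) 0)))
     + real (Nbr n \<omega> (\<gamma>n n * integral {0..real n * t} (\<lambda>s. max (- 1 * real_of_int (X n \<omega> s)) 0)))"
    using eq t unfolding queue_equation_def by (simp add: of_int_max)
  then show ?thesis unfolding time_change
    by (simp add: scaled_queue_def[of n \<omega> t] r_def[symmetric] add_divide_distrib diff_divide_distrib mult_ac)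
qed

text \<open>\<open>R0\<close>, \<open>RU\<close>, \<open>RV\<close> bound the scaled initial value and walks; \<open>Rx\<close> is the resulting bound on the
  scaled queue from Gronwall's inequality, \<open>C\<close> the range of the Poisson arguments.\<close>

lemma pathwise_euler:
  fixes K RU RV R0 \<delta> e L T :: real
  defines "Ru \<equiv> R0 + RU + RV + \<bar>c\<bar> * T + 5"
  defines "Rx \<equiv> 2 * (Ru + 2) * exp (2 * L * T)"
  defines "C \<equiv> L * T * Rx + 1"
  assumes n: "0 < n" and m: "0 < m" and T: "0 \<le> T" and L: "0 < L" "\<theta> + \<gamma> \<le> L" and e: "0 < e" "e \<le> 1"
    and cad: "cadlag (\<lambda>t. real_of_int (X n \<omega> t))" and Xeq: "queue_equation n \<omega>"
    and Up: "\<And>k. 1 \<le> k \<Longrightarrow> 0 < U n k \<omega>" and Vp: "\<And>k. 1 \<le> k \<Longrightarrow> 0 < V n k \<omega>"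
    and X0b: "\<bar>real_of_int (X0 n \<omega>) / sqrt (real n)\<bar> \<le> R0"
    and bU: "AU.bounded_walk K RU n \<omega>" and bV: "AV.bounded_walk K RV n \<omega>"
    and oU: "AU.walk_oscillation K \<delta> e n \<omega>" and oV: "AV.walk_oscillation K \<delta> e n \<omega>"
    and pS: "poisson_close C e n (Nsr n \<omega>)" and pB: "poisson_close C e n (Nbr n \<omega>)"
    and K: "\<alpha> * T \<le> K" "\<beta> * T \<le> K"
    and nU: "AU.large_index T K RU \<delta> n" and nV: "AV.large_index T K RV \<delta> n"
    and ne: "1 / sqrt (real n) \<le> e" "\<bar>sqrt (real n) * (\<alpha>n n - \<beta>n n) - c\<bar> * T \<le> e"
    and nL: "real n * \<theta>n n + real n * \<gamma>n n \<le> L" "(\<bar>real n * \<theta>n n - \<theta>\<bar> + \<bar>real n * \<gamma>n n - \<gamma>\<bar>) * (T * Rx) \<le> e"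
    and mm: "\<alpha> * (1 / real m) * real n + 1 \<le> \<delta> * real n" "\<beta> * (1 / real m) * real n + 1 \<le> \<delta> * real n"
      "\<bar>c\<bar> / real m \<le> e" "L * Rx / real m \<le> e"
    and t: "t \<in> {0..T}"
  shows "\<bar>scaled_queue n \<omega> t - euler_path drift m (\<lambda>k. increment m n k \<omega>) t\<bar> \<le> 24 * e * exp (2 * L * T)"
proof -
  define r where "r = sqrt (real n)"
  have r: "0 < r" "r * r = real n" using n by (auto simp: r_def)
  define x where "x = scaled_queue n \<omega>"
  have x: "cadlag x" unfolding x_def scaled_queue_def
    by (rule cadlag_compose[OF cadlag_time_scale[OF cad], of "real n" "\<lambda>z. z / sqrt (real n)"]) (use n in \<open>auto intro!: continuous_intros\<close>)
  define NU where "NU t = real (AU.count n \<omega> (real n * t))" for t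
  define NV where "NV t = real (AV.count n \<omega> (real n * t))" for t
  define DU where "DU t = AU.walk n (nat \<lfloor>\<alpha> * t * real n\<rfloor>) \<omega>" for t
  define DV where "DV t = AV.walk n (nat \<lfloor>\<beta> * t * real n\<rfloor>) \<omega>" for t
  define u where "u t = real_of_int (X0 n \<omega>) / r + NU t / r - NV t / r" for t
  define th where "th = real n * \<theta>n n"
  define ga where "ga = real n * \<gamma>n n"
  define P where "P t = integral {0..t} (\<lambda>s. max (x s) 0)" for t
  define Q where "Q t = integral {0..t} (\<lambda>s. max (- x s) 0)" for t
  have cp: "cadlag (\<lambda>s. max (x s) 0)" by (rule cadlag_compose[OF x, of "\<lambda>z. max z 0"]) (intro continuous_intros)
  have cm: "cadlag (\<lambda>s. max (- x s) 0)" by (rule cadlag_compose[OF x, of "\<lambda>z. max (- z) 0"]) (intro continuous_intros)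
  have x_eq: "x s = u s - real (Nsr n \<omega> (r * (th * P s))) / r + real (Nbr n \<omega> (r * (ga * Q s))) / r" if "s \<in> {0..T}" for s
    using scaled_queue_equation[OF n cad Xeq, of s] that
    by (simp add: x_def u_def NU_def NV_def P_def Q_def th_def ga_def r_def)
  have rU: "\<bar>NU s - \<alpha>n n * (real n * s) + DU s\<bar> \<le> 1 + e * r" if "s \<in> {0..T}" for s
    unfolding NU_def DU_def r_def by (rule AU.count_approx[OF Up bU oU nU K(1) that])
  have rV: "\<bar>NV s - \<beta>n n * (real n * s) + DV s\<bar> \<le> 1 + e * r" if "s \<in> {0..T}" for s
    unfolding NV_def DV_def r_def by (rule AV.count_approx[OF Vp bV oV nV K(2) that])
  let ?w = "driving n \<omega>"
  have w_eq: "?w s = real_of_int (X0 n \<omega>) / r - DU s / r + DV s / r + c * s" for s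
    unfolding driving_def r_def[symmetric] DU_def DV_def by (simp add: add_divide_distrib diff_divide_distrib)
  have re: "1 \<le> e * r" using ne(1) r by (simp add: r_def[symmetric] field_simps)
  \<comment> \<open>Each count contributes \<open>2 * e\<close>, because
    \<open>1 \<le> e * r\<close> absorbs the additive 1 of the renewal estimate; the replacement of
    the drift by \<open>c\<close> contributes one more \<open>e\<close>.\<close>
  have uw: "\<bar>u s - ?w s\<bar> \<le> 5 * e" if s: "s \<in> {0..T}" for s
  proof -
    define a where "a = NU s - \<alpha>n n * (real n * s) + DU s"
    define b where "b = NV s - \<beta>n n * (real n * s) + DV s"
    have "\<bar>a\<bar> \<le> 2 * e * r" "\<bar>b\<bar> \<le> 2 * e * r" using rU[OF s] rV[OF s] re by (auto simp: a_def b_def)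
    then have "\<bar>a / r\<bar> \<le> 2 * e" "\<bar>b / r\<bar> \<le> 2 * e" using r by (auto simp: divide_le_eq)
    moreover have "\<bar>(r * (\<alpha>n n - \<beta>n n) - c) * s\<bar> \<le> e"
    proof -
      have "\<bar>(r * (\<alpha>n n - \<beta>n n) - c) * s\<bar> \<le> \<bar>r * (\<alpha>n n - \<beta>n n) - c\<bar> * T"
        using s by (auto simp: abs_mult intro!: mult_left_mono)
      then show ?thesis using ne(2) by (simp add: r_def)
    qed
    moreover have "u s - ?w s = a / r - b / r + (r * (\<alpha>n n - \<beta>n n) - c) * s"
    proof -
      have nr: "real n / r = r" using r by (simp add: field_simps)
      have "(\<alpha>n n * (real n * s)) / r = \<alpha>n n * s * (real n / r)" "(\<beta>n n * (real n * s)) / r = \<beta>n n * s * (real n / r)" by simp_all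
      then show ?thesis unfolding u_def w_eq a_def b_def nr
        by (simp add: add_divide_distrib diff_divide_distrib algebra_simps)
    qed
    ultimately show ?thesis by linarith
  qed
  have ub: "\<bar>u s\<bar> \<le> Ru" if s: "s \<in> {0..T}" for s
  proof -
    have "\<bar>DU s\<bar> \<le> RU * r" "\<bar>DV s\<bar> \<le> RV * r"
      using bU bV AU.index_bounds(2)[OF K(1) s] AV.index_bounds(2)[OF K(2) s]
      unfolding DU_def DV_def r_def AU.bounded_walk_def AV.bounded_walk_def by blast+
    then have "\<bar>DU s / r\<bar> \<le> RU" "\<bar>DV s / r\<bar> \<le> RV" using r by (auto simp: divide_le_eq)
    moreover have "\<bar>c * s\<bar> \<le> \<bar>c\<bar> * T" using s by (auto simp: abs_mult intro!: mult_left_mono)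
    ultimately have "\<bar>?w s\<bar> \<le> R0 + RU + RV + \<bar>c\<bar> * T" using X0b unfolding w_eq r_def[symmetric] by linarith
    then show ?thesis using uw[OF s] e unfolding Ru_def by linarith
  qed
  have Ru0: "0 \<le> Ru" using ub[of 0] T by auto
  \<comment> \<open>The assumption \<open>e \<le> 1\<close> removes \<open>e\<close> from the a
    priori bounds: it replaced \<open>5 * e\<close> by 5 in \<open>Ru\<close> and replaces
    \<open>2 * e\<close> by 2 here.\<close>
  have RxR: "2 * (Ru + 2 * e) * exp (2 * L * T) \<le> Rx" unfolding Rx_def using e by (intro mult_right_mono) auto
  have Rx0: "0 \<le> Rx" unfolding Rx_def using Ru0 by simp
  have Cb: "L * T * (2 * (Ru + 2 * e) * exp (2 * L * T)) < C"
  proof -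
    have "L * T * (2 * (Ru + 2 * e) * exp (2 * L * T)) \<le> L * T * Rx" using RxR L T by (intro mult_left_mono) auto
    then show ?thesis by (simp add: C_def)
  qed
  have th: "0 \<le> th" "0 \<le> ga" "th + ga \<le> L" using \<theta>n_pos[of n] \<gamma>n_pos[of n] nL(1) by (auto simp: th_def ga_def)
  note qb = queue_path_bound[OF x r(1) th(1,2) L(1) th(3), where ?h1.0 = "\<lambda>s. r * (th * P s)" and ?h2.0 = "\<lambda>s. r * (ga * Q s)"
      and u = u and ?R0.0 = Ru and e = e and C = C and T = T and ?p1.0 = "\<lambda>y. real (Nsr n \<omega> y)" and ?p2.0 = "\<lambda>y. real (Nbr n \<omega> y)",
      unfolded P_def[symmetric] Q_def[symmetric], OF refl refl x_eq ub refl Cb]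
  have xb: "\<bar>x s\<bar> \<le> Rx" if s: "s \<in> {0..T}" for s
  proof -
    have "\<bar>x s\<bar> \<le> 2 * (Ru + 2 * e) * exp (2 * L * T)"
      by (rule qb(1)) (use e pS pB s in \<open>auto simp: r_def poisson_close_def\<close>)
    then show ?thesis using RxR by linarith
  qed
  have xe: "\<bar>x s - u s + th * P s - ga * Q s\<bar> \<le> 2 * e" if s: "s \<in> {0..T}" for s
    by (rule qb(2)) (use e pS pB s in \<open>auto simp: r_def poisson_close_def\<close>)
  have PQ: "0 \<le> P s" "P s \<le> T * Rx" "0 \<le> Q s" "Q s \<le> T * Rx" if s: "s \<in> {0..T}" for s
  proof -
    have I: "integral {0..s} (\<lambda>_. Rx) \<le> T * Rx" using s Rx0 by (auto intro: mult_right_mono)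
    have le: "max (x v) 0 \<le> Rx" "max (- x v) 0 \<le> Rx" if "v \<in> {0..s}" for v
      using xb[of v] that s Rx0 by (auto simp: abs_le_iff)
    have "P s \<le> integral {0..s} (\<lambda>_. Rx)" unfolding P_def
      by (rule integral_le[OF cadlag_integrable[OF cp order_refl]]) (use le in auto)
    moreover have "Q s \<le> integral {0..s} (\<lambda>_. Rx)" unfolding Q_def
      by (rule integral_le[OF cadlag_integrable[OF cm order_refl]]) (use le in auto)
    ultimately show "P s \<le> T * Rx" "Q s \<le> T * Rx" using I by auto
    show "0 \<le> P s" "0 \<le> Q s" unfolding P_def Q_def by (intro integral_nonneg cadlag_integrable cp cm; simp)+
  qed
  \<comment> \<open>Collected errors: \<open>2 * e\<close> from the Poisson processes,
    \<open>5 * e\<close> from the driving path, and \<open>e\<close> from the limits of the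
    departure rates.\<close>
  have eq: "\<bar>x s - ?w s - integral {0..s} (\<lambda>z. drift (x z))\<bar> \<le> 8 * e" if s: "s \<in> {0..T}" for s
  proof -
    have "\<bar>(th - \<theta>) * P s\<bar> \<le> \<bar>th - \<theta>\<bar> * (T * Rx)" "\<bar>(ga - \<gamma>) * Q s\<bar> \<le> \<bar>ga - \<gamma>\<bar> * (T * Rx)"
      using PQ[OF s] by (auto simp: abs_mult intro!: mult_left_mono)
    moreover have "\<bar>th - \<theta>\<bar> * (T * Rx) + \<bar>ga - \<gamma>\<bar> * (T * Rx) \<le> e" using nL(2) by (simp add: th_def ga_def distrib_right)
    moreover have "x s - ?w s - integral {0..s} (\<lambda>z. drift (x z))
       = (x s - u s + th * P s - ga * Q s) + (u s - ?w s) - (th - \<theta>) * P s + (ga - \<gamma>) * Q s"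
      unfolding integral_drift[OF x] P_def[symmetric] Q_def[symmetric] by (simp add: algebra_simps)
    ultimately show ?thesis using xe[OF s] uw[OF s] by linarith
  qed
  \<comment> \<open>One \<open>e\<close> for each walk and one for the linear term over a
    cell.\<close>
  have osc: "\<bar>?w s - ?w (real (nat \<lfloor>real m * s\<rfloor>) / real m)\<bar> \<le> 3 * e" if s: "s \<in> {0..T}" for s
  proof -
    define q where "q = real (nat \<lfloor>real m * s\<rfloor>) / real m"
    have q: "q \<le> s" "s < q + 1 / real m" "0 \<le> q" using grid_point_bounds[OF m _ refl, of s] s by (auto simp: q_def)
    have q': "q \<in> {0..T}" using q s by auto
    define a where "a = (DU s - DU q) / r"
    define b where "b = (DV s - DV q) / r"
    have "\<bar>DU s - DU q\<bar> \<le> e * r" unfolding DU_def r_def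
      by (rule AU.walk_mesh_oscillation[OF oU K(1) q' s _ _ mm(1)]) (use q in auto)
    moreover have "\<bar>DV s - DV q\<bar> \<le> e * r" unfolding DV_def r_def
      by (rule AV.walk_mesh_oscillation[OF oV K(2) q' s _ _ mm(2)]) (use q in auto)
    ultimately have ab: "\<bar>a\<bar> \<le> e" "\<bar>b\<bar> \<le> e" using r by (auto simp: a_def b_def divide_le_eq)
    define d where "d = c * (s - q)"
    have "\<bar>d\<bar> = \<bar>c\<bar> * (s - q)" using q by (simp add: d_def abs_mult)
    also have "\<dots> \<le> \<bar>c\<bar> * (1 / real m)" using q by (intro mult_left_mono) auto
    finally have d: "\<bar>d\<bar> \<le> e" using mm(3) by simp
    have "?w s - ?w q = - a + b + d"
      unfolding w_eq a_def b_def d_def by (simp add: diff_divide_distrib algebra_simps)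
    moreover have "\<bar>- a + b + d\<bar> \<le> 3 * e" using ab d by linarith
    ultimately show ?thesis unfolding q_def[symmetric] by simp
  qed
  \<comment> \<open>With \<open>L * Rx / m \<le> e\<close> the bracket is at most
    \<open>12 * e\<close>, whence the constant 24.\<close>
  have "\<bar>x t - euler_path drift m (\<lambda>k. increment m n k \<omega>) t\<bar> \<le> 2 * (8 * e + 3 * e + L * Rx / real m) * exp (2 * L * T)"
    by (rule euler_path_close[OF x m L(1) drift_lipschitz'[OF L(2)] drift_0 xb eq osc driving_grid t])
  also have "\<dots> \<le> 2 * (12 * e) * exp (2 * L * T)" using mm(4) by (intro mult_right_mono) auto
  finally show ?thesis by (simp add: x_def)
qed

end

section \<open>Uniform approximation in probability by the Euler scheme\<close>

context double_ended_queue
begin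

text \<open>All bounds and the modulus \<open>\<delta>\<close> of the walks are chosen before
  \<open>m\<close> and \<open>n\<close>. \<open>\<delta>\<close> decides how fine the mesh must be,
  while the conditions that make \<open>n\<close> large involve \<open>\<delta>\<close> but not
  \<open>m\<close>; hence the exceptional probability is controlled for every sufficiently large
  fixed \<open>m\<close>.\<close>

lemma euler_approximation:
  assumes init: "real_distribution \<mu>" "weak_conv_m (\<lambda>n. distr (M n) borel (\<lambda>\<omega>. real_of_int (X0 n \<omega>) / sqrt (real n))) \<mu>"
    and T: "0 \<le> T" and e: "0 < e"
  shows "eventually (\<lambda>m. whp M e (\<lambda>n \<omega>. \<forall>t\<in>{0..T}.
     \<bar>scaled_queue n \<omega> t - euler_path drift m (\<lambda>k. increment m n k \<omega>) t\<bar> \<le> e)) sequentially"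
proof -
  \<comment> \<open>Seven events may fail with probability \<open>\<eta>\<close> each: the initial
    bound, the bound and the modulus of either walk, and the two Poisson estimates.\<close>
  define \<eta> where "\<eta> = e / 8"
  have \<eta>: "0 < \<eta>" using e by (simp add: \<eta>_def)
  define K where "K = max (\<alpha> * T) (\<beta> * T) + 1"
  have K: "\<alpha> * T < K" "\<beta> * T < K" by (auto simp: K_def)
  have K0: "0 < K" using K T pos by (meson mult_nonneg_nonneg less_imp_le order_le_less_trans)
  have X0m: "(\<lambda>\<omega>. real_of_int (X0 n \<omega>) / sqrt (real n)) \<in> borel_measurable (M n)" for n
    using X0_meas[of n] by measurable
  obtain R0 where R0: "0 < R0" "whp M \<eta> (\<lambda>n \<omega>. \<bar>real_of_int (X0 n \<omega>) / sqrt (real n)\<bar> \<le> R0)"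
    by (rule weak_conv_tight[OF prob X0m init \<eta>])
  obtain RU where RU: "0 < RU" "whp M \<eta> (AU.bounded_walk K RU)" by (rule AU.whp_bounded_walk[OF K0 \<eta>])
  obtain RV where RV: "0 < RV" "whp M \<eta> (AV.bounded_walk K RV)" by (rule AV.whp_bounded_walk[OF K0 \<eta>])
  define L where "L = \<theta> + \<gamma> + 1"
  have L: "0 < L" "\<theta> + \<gamma> \<le> L" "\<theta> + \<gamma> < L" using \<theta>_pos \<gamma>_pos by (auto simp: L_def)
  define Rx where "Rx = 2 * ((R0 + RU + RV + \<bar>c\<bar> * T + 5) + 2) * exp (2 * L * T)"
  define C where "C = L * T * Rx + 1"
  have Rx0: "0 \<le> Rx" unfolding Rx_def using R0 RU RV T by simp
  have C0: "0 < C" unfolding C_def using L T Rx0 by (simp add: add_nonneg_pos)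
  \<comment> \<open>Inverts the factor \<open>24 * exp (2 * L * T)\<close> of the pathwise estimate,
    capped by 1 as that estimate requires.\<close>
  define e1 where "e1 = min 1 (e / (24 * exp (2 * L * T)))"
  have e1: "0 < e1" "e1 \<le> 1" using e by (auto simp: e1_def)
  have e1_le: "24 * e1 * exp (2 * L * T) \<le> e"
  proof -
    have "e1 \<le> e / (24 * exp (2 * L * T))" by (simp add: e1_def)
    then show ?thesis by (simp add: field_simps)
  qed
  obtain \<delta>U where \<delta>U: "0 < \<delta>U" "whp M \<eta> (AU.walk_oscillation K \<delta>U e1)"
    by (rule AU.whp_walk_oscillation[OF less_imp_le[OF K0] e1(1) \<eta>])
  obtain \<delta>V where \<delta>V: "0 < \<delta>V" "whp M \<eta> (AV.walk_oscillation K \<delta>V e1)"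
    by (rule AV.whp_walk_oscillation[OF less_imp_le[OF K0] e1(1) \<eta>])
  define \<delta> where "\<delta> = min \<delta>U \<delta>V"
  have \<delta>: "0 < \<delta>" "\<delta> \<le> \<delta>U" "\<delta> \<le> \<delta>V" using \<delta>U \<delta>V by (auto simp: \<delta>_def)
  have pois: "whp M \<eta> (\<lambda>n \<omega>. poisson_close C e1 n (Nsr n \<omega>))" "whp M \<eta> (\<lambda>n \<omega>. poisson_close C e1 n (Nbr n \<omega>))"
    unfolding whp_def poisson_close_def
    by (rule poisson_process_uniform[OF Psr C0 e1(1) \<eta>], rule poisson_process_uniform[OF Pbr C0 e1(1) \<eta>])
  have "AE \<omega> in M n. queue_equation n \<omega> \<and> (\<forall>k\<ge>1. 0 < U n k \<omega>) \<and> (\<forall>k\<ge>1. 0 < V n k \<omega>)" for n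
    using X_eq[of n] U_AE_all_pos[of n] V_AE_all_pos[of n]
    unfolding queue_equation_def AU.count_def AV.count_def by eventually_elim blast
  note AE = whp_AE[OF prob this]
  note good = whp_conj[OF prob AE whp_conj[OF prob R0(2) whp_conj[OF prob RU(2) whp_conj[OF prob RV(2)
      whp_conj[OF prob \<delta>U(2) whp_conj[OF prob \<delta>V(2) whp_conj[OF prob pois]]]]]]]
  have le: "eventually (\<lambda>i. f i \<le> b) sequentially" if "f \<longlonglongrightarrow> a" "a < b" for f :: "nat \<Rightarrow> real" and a b
    using order_tendstoD(2)[OF that] by eventually_elim simp
  have n_ev: "eventually (\<lambda>n. 0 < n \<and> 1 / sqrt (real n) \<le> e1 \<and> \<bar>sqrt (real n) * (\<alpha>n n - \<beta>n n) - c\<bar> * T \<le> e1 \<and>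
      real n * \<theta>n n + real n * \<gamma>n n \<le> L \<and> (\<bar>real n * \<theta>n n - \<theta>\<bar> + \<bar>real n * \<gamma>n n - \<gamma>\<bar>) * (T * Rx) \<le> e1 \<and> 1 \<le> \<delta> / 2 * real n) sequentially"
  proof (intro eventually_conj)
    show "eventually (\<lambda>n. 1 / sqrt (real n) \<le> e1) sequentially" by (rule le[OF inverse_sqrt_tendsto_0 e1(1)])
    have "(\<lambda>n. \<bar>sqrt (real n) * (\<alpha>n n - \<beta>n n) - c\<bar> * T) \<longlonglongrightarrow> \<bar>c - c\<bar> * T" by (intro tendsto_intros diff_lim)
    then show "eventually (\<lambda>n. \<bar>sqrt (real n) * (\<alpha>n n - \<beta>n n) - c\<bar> * T \<le> e1) sequentially" by (rule le) (use e1 in simp)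
    show "eventually (\<lambda>n. real n * \<theta>n n + real n * \<gamma>n n \<le> L) sequentially"
      by (rule le[OF tendsto_add[OF \<theta>_lim \<gamma>_lim] L(3)])
    have "(\<lambda>n. (\<bar>real n * \<theta>n n - \<theta>\<bar> + \<bar>real n * \<gamma>n n - \<gamma>\<bar>) * (T * Rx)) \<longlonglongrightarrow> (\<bar>\<theta> - \<theta>\<bar> + \<bar>\<gamma> - \<gamma>\<bar>) * (T * Rx)"
      by (intro tendsto_intros \<theta>_lim \<gamma>_lim)
    then show "eventually (\<lambda>n. (\<bar>real n * \<theta>n n - \<theta>\<bar> + \<bar>real n * \<gamma>n n - \<gamma>\<bar>) * (T * Rx) \<le> e1) sequentially"
      by (rule le) (use e1 in simp)
    have "eventually (\<lambda>n. 2 / \<delta> \<le> real n) sequentially"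
      using filterlim_real_sequentially by (auto simp: filterlim_at_top)
    then show "eventually (\<lambda>n. 1 \<le> \<delta> / 2 * real n) sequentially" by eventually_elim (use \<delta> in \<open>simp add: field_simps\<close>)
  qed (rule eventually_gt_at_top)
  have m_small: "eventually (\<lambda>m. y / real m \<le> z) sequentially" if "0 < z" for y z :: real
    by (rule le[OF _ that]) (use tendsto_mult_right[OF lim_1_over_n, of y] in simp)
  have \<delta>2: "0 < \<delta> / 2" using \<delta> by simp
  show ?thesis
    using eventually_gt_at_top[of 0] m_small[OF \<delta>2, of \<alpha>] m_small[OF \<delta>2, of \<beta>] m_small[OF e1(1), of "\<bar>c\<bar>"] m_small[OF e1(1), of "L * Rx"]
  proof eventually_elim
    case (elim m)
    show ?case
    proof (rule whp_mono_eventually[OF good])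
      show "0 + (\<eta> + (\<eta> + (\<eta> + (\<eta> + (\<eta> + (\<eta> + \<eta>)))))) \<le> e" using e by (simp add: \<eta>_def)
      show "eventually (\<lambda>n. \<forall>\<omega>. (\<omega> \<in> space (M n) \<and> queue_equation n \<omega> \<and> (\<forall>k\<ge>1. 0 < U n k \<omega>) \<and> (\<forall>k\<ge>1. 0 < V n k \<omega>)) \<and>
          \<bar>real_of_int (X0 n \<omega>) / sqrt (real n)\<bar> \<le> R0 \<and> AU.bounded_walk K RU n \<omega> \<and> AV.bounded_walk K RV n \<omega> \<and>
          AU.walk_oscillation K \<delta>U e1 n \<omega> \<and> AV.walk_oscillation K \<delta>V e1 n \<omega> \<and>
          poisson_close C e1 n (Nsr n \<omega>) \<and> poisson_close C e1 n (Nbr n \<omega>) \<longrightarrow>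
          (\<forall>t\<in>{0..T}. \<bar>scaled_queue n \<omega> t - euler_path drift m (\<lambda>k. increment m n k \<omega>) t\<bar> \<le> e)) sequentially"
        using n_ev AU.eventually_large_index[OF K(1) \<delta>(1), of RU] AV.eventually_large_index[OF K(2) \<delta>(1), of RV]
      proof eventually_elim
        case n_elim: (elim n)
        \<comment> \<open>Half of \<open>\<delta> * n\<close> pays for the mesh, the other half for
          the rounding of indices.\<close>
        have mesh: "y * (1 / real m) * real n + 1 \<le> \<delta> * real n" if "y / real m \<le> \<delta> / 2" for y
        proof -
          have "y / real m * real n \<le> \<delta> / 2 * real n" using that by (intro mult_right_mono) auto
          moreover have "1 \<le> \<delta> / 2 * real n" using n_elim by blast
          moreover have "\<delta> * real n = \<delta> / 2 * real n + \<delta> / 2 * real n" by simp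
          moreover have "y * (1 / real m) * real n = y / real m * real n" by simp
          ultimately show ?thesis by linarith
        qed
        show ?case
        proof (intro allI impI ballI, elim conjE)
          fix \<omega> t
          assume w: "\<omega> \<in> space (M n)" and t: "t \<in> {0..T}" and Xeq: "queue_equation n \<omega>"
            and p: "\<forall>k\<ge>1. 0 < U n k \<omega>" "\<forall>k\<ge>1. 0 < V n k \<omega>" and x0: "\<bar>real_of_int (X0 n \<omega>) / sqrt (real n)\<bar> \<le> R0"
            and b: "AU.bounded_walk K RU n \<omega>" "AV.bounded_walk K RV n \<omega>"
            and o: "AU.walk_oscillation K \<delta>U e1 n \<omega>" "AV.walk_oscillation K \<delta>V e1 n \<omega>"
            and P: "poisson_close C e1 n (Nsr n \<omega>)" "poisson_close C e1 n (Nbr n \<omega>)"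
          have "\<bar>scaled_queue n \<omega> t - euler_path drift m (\<lambda>k. increment m n k \<omega>) t\<bar> \<le> 24 * e1 * exp (2 * L * T)"
            by (rule pathwise_euler[OF _ _ T L(1,2) e1 X_cadlag[OF w] Xeq _ _ x0 b
                  AU.walk_oscillation_mono[OF o(1) \<delta>(2)] AV.walk_oscillation_mono[OF o(2) \<delta>(3)]
                  P[unfolded C_def Rx_def] less_imp_le[OF K(1)] less_imp_le[OF K(2)] _ _ _ _ _ _ mesh mesh _ _ t,
                  folded Rx_def])
              (use p elim n_elim in auto)
          then show "\<bar>scaled_queue n \<omega> t - euler_path drift m (\<lambda>k. increment m n k \<omega>) t\<bar> \<le> e"
            using e1_le by linarith
        qed
      qed
    qed
  qed
qed

end

section \<open>Fluid limit, limit process and conclusion\<close>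

text \<open>Independence concerns finite subfamilies only, and each lies in an initial segment;
  \<open>standard_BM\<close> provides the increments in this form.\<close>

lemma (in prob_space) indep_vars_nat_UNIV:
  assumes "\<And>k. indep_vars Q X {..<k :: nat}"
  shows "indep_vars Q X UNIV"
  unfolding indep_vars_def2
proof
  show "\<forall>i\<in>UNIV. random_variable (Q i) (X i)"
  proof
    fix i show "random_variable (Q i) (X i)" using assms[of "Suc i"] unfolding indep_vars_def2 by auto
  qed
  show "indep_sets (\<lambda>i. {X i -` A \<inter> space M |A. A \<in> sets (Q i)}) UNIV"
  proof (subst indep_sets_finite_index_sets, intro allI impI)
    fix J :: "nat set" assume "finite J"
    then obtain k where "J \<subseteq> {..<k}" using finite_nat_iff_bounded by blast
    then show "indep_sets (\<lambda>i. {X i -` A \<inter> space M |A. A \<in> sets (Q i)}) J"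
      using assms[of k] unfolding indep_vars_def2 by (blast intro: indep_sets_mono_index)
  qed
qed

context double_ended_queue
begin

text \<open>Convergence of the difference of rates times \<open>sqrt n\<close> forces the difference
  itself to vanish, so the linear term of the fluid equation disappears.\<close>

lemma rates_eq: "\<alpha> = \<beta>"
proof -
  from tendsto_mult[OF inverse_sqrt_tendsto_0 diff_lim]
  have "(\<lambda>n. 1 / sqrt (real n) * (sqrt (real n) * (\<alpha>n n - \<beta>n n))) \<longlonglongrightarrow> 0" by simp
  moreover have "eventually (\<lambda>n. 1 / sqrt (real n) * (sqrt (real n) * (\<alpha>n n - \<beta>n n)) = \<alpha>n n - \<beta>n n) sequentially"
    using eventually_gt_at_top[of 0] by eventually_elim simp
  ultimately have "(\<lambda>n. \<alpha>n n - \<beta>n n) \<longlonglongrightarrow> 0" using tendsto_cong by fast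
  moreover have "(\<lambda>n. \<alpha>n n - \<beta>n n) \<longlonglongrightarrow> \<alpha> - \<beta>" by (intro tendsto_diff AU.a_lim AV.a_lim)
  ultimately show ?thesis using LIMSEQ_unique by fastforce
qed

text \<open>Without a linear term the equation has a Lipschitz right-hand side that vanishes at 0,
  and Gronwall with constant \<open>a = 0\<close> leaves only the zero solution.\<close>

lemma fluid_limit_zero:
  assumes x: "continuous_on {0..} x"
  shows "(\<forall>t\<ge>0. x t = (\<alpha> - \<beta>) * t - \<theta> * integral {0..t} (\<lambda>s. max (x s) 0) + \<gamma> * integral {0..t} (\<lambda>s. max (- x s) 0))
     \<longleftrightarrow> (\<forall>t\<ge>0. x t = 0)" (is "?E \<longleftrightarrow> _")
proof
  assume ?E
  have cad: "cadlag x" by (rule cadlag_continuous_on[OF x])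
  show "\<forall>t\<ge>0. x t = 0"
  proof (intro allI impI)
    fix t :: real assume t: "0 \<le> t"
    have ca: "cadlag (\<lambda>s. \<bar>x s\<bar>)" by (rule cadlag_compose[OF cad, of abs]) (intro continuous_intros)
    have cd: "cadlag (\<lambda>s. drift (x s))" by (rule cadlag_compose[OF cad continuous_drift])
    have "\<bar>x t\<bar> \<le> 2 * 0 * exp (2 * (\<theta> + \<gamma>) * t)"
    proof (rule gronwall_cadlag[OF ca])
      fix s assume s: "s \<in> {0..t}"
      have "x s = integral {0..s} (\<lambda>u. drift (x u))"
        unfolding integral_drift[OF cad] using \<open>?E\<close> s rates_eq by simp
      then have "\<bar>x s\<bar> = norm (integral {0..s} (\<lambda>u. drift (x u)))" by simp
      also have "\<dots> \<le> integral {0..s} (\<lambda>u. (\<theta> + \<gamma>) * \<bar>x u\<bar>)"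
      proof (rule integral_norm_bound_integral)
        show "(\<lambda>u. (\<theta> + \<gamma>) * \<bar>x u\<bar>) integrable_on {0..s}" by (intro integrable_on_mult_right cadlag_integrable ca) simp
        show "norm (drift (x u)) \<le> (\<theta> + \<gamma>) * \<bar>x u\<bar>" for u using drift_lipschitz[of "x u" 0] by simp
      qed (intro cadlag_integrable cd order_refl)
      finally show "\<bar>x s\<bar> \<le> 0 + (\<theta> + \<gamma>) * integral {0..s} (\<lambda>u. \<bar>x u\<bar>)" by simp
    qed (use \<theta>_pos \<gamma>_pos t in auto)
    then show "x t = 0" by simp
  qed
next
  assume x0: "\<forall>t\<ge>0. x t = 0"
  have "integral {0..t} (\<lambda>s. max (x s) 0) = 0" "integral {0..t} (\<lambda>s. max (- x s) 0) = 0" for t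
  proof -
    have "integral {0..t} (\<lambda>s. max (x s) 0) = integral {0..t} (\<lambda>s. 0)"
      by (rule Henstock_Kurzweil_Integration.integral_cong) (use x0 in auto)
    then show "integral {0..t} (\<lambda>s. max (x s) 0) = 0" by simp
    have "integral {0..t} (\<lambda>s. max (- x s) 0) = integral {0..t} (\<lambda>s. 0)"
      by (rule Henstock_Kurzweil_Integration.integral_cong) (use x0 in auto)
    then show "integral {0..t} (\<lambda>s. max (- x s) 0) = 0" by simp
  qed
  then show ?E using x0 rates_eq by simp
qed

text \<open>Indexed like \<open>increment\<close>, so that the weak limit can be verified coordinate
  by coordinate.\<close>

definition limit_increment :: "('b \<Rightarrow> real \<Rightarrow> real) \<Rightarrow> ('b \<Rightarrow> real \<Rightarrow> real) \<Rightarrow> nat \<Rightarrow> nat \<Rightarrow> 'b \<Rightarrow> real" where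
  "limit_increment W Z m k \<omega> = (case k of 0 \<Rightarrow> Z \<omega> 0
     | Suc k \<Rightarrow> sqrt (\<alpha> ^ 3 * \<sigma>\<^sup>2 + \<beta> ^ 3 * \<zeta>\<^sup>2) * (W \<omega> (real (Suc k) / real m) - W \<omega> (real k / real m)) + c / real m)"

lemma limit_increment_indep:
  fixes N :: "'b measure"
  assumes W: "standard_BM N W" and Z: "(\<lambda>\<omega>. Z \<omega> 0) \<in> borel_measurable N" and m: "0 < m"
    and ind: "prob_space.indep_set N (gen_sets N (\<lambda>\<omega>. Z \<omega> 0) borel)
       (gen_sets N (\<lambda>\<omega>. restrict (W \<omega>) {0..}) (Pi\<^sub>M {0..} (\<lambda>_. borel)))"
  shows "prob_space.indep_vars N (\<lambda>_. borel) (limit_increment W Z m) UNIV"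
proof -
  interpret N: prob_space N using W by (simp add: standard_BM_def)
  let ?P = "Pi\<^sub>M {0::real..} (\<lambda>_. borel :: real measure)"
  define dW where "dW k \<omega> = W \<omega> (real (Suc k) / real m) - W \<omega> (real k / real m)" for k \<omega>
  define SZ where "SZ = vimage_algebra (space N) (\<lambda>\<omega>. Z \<omega> 0) (borel :: real measure)"
  define SW where "SW = vimage_algebra (space N) (\<lambda>\<omega>. restrict (W \<omega>) {0..}) ?P"
  have dW_ind: "N.indep_vars (\<lambda>_. borel) dW UNIV"
  proof (rule N.indep_vars_nat_UNIV)
    fix k
    have mono: "strict_mono (\<lambda>i. real i / real m)" using m by (auto simp: strict_mono_def divide_strict_right_mono)
    have "\<forall>ts k. 0 \<le> ts 0 \<and> strict_mono (ts :: nat \<Rightarrow> real) \<longrightarrow>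
        N.indep_vars (\<lambda>_. borel) (\<lambda>i \<omega>. W \<omega> (ts (Suc i)) - W \<omega> (ts i)) {..<k}"
      using W by (simp add: standard_BM_def)
    from this[rule_format, of "\<lambda>i. real i / real m" k] mono
    show "N.indep_vars (\<lambda>_. borel) dW {..<k}" unfolding dW_def by simp
  qed
  have W_SW: "(\<lambda>\<omega>. W \<omega> t) \<in> borel_measurable SW" if "0 \<le> t" for t
  proof -
    have "(\<lambda>\<omega>. restrict (W \<omega>) {0..}) \<in> measurable SW ?P"
      unfolding SW_def by (rule measurable_vimage_algebra1) (auto simp: space_PiM)
    from measurable_compose[OF this measurable_component_singleton[of t "{0..}" "\<lambda>_. borel"]] that show ?thesis by simp
  qed
  have dW_SW: "dW k \<in> borel_measurable SW" for k
    unfolding dW_def by (intro borel_measurable_diff W_SW) auto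
  have Z_SZ: "(\<lambda>\<omega>. Z \<omega> 0) \<in> borel_measurable SZ"
    unfolding SZ_def by (rule measurable_vimage_algebra1) auto
  have "N.indep_set (sets SZ) (sets SW)" using ind unfolding gen_sets_def SZ_def SW_def .
  note joined = N.indep_vars_join[OF this _ _ N.indep_vars_singleton[OF Z, of "()"] Z_SZ dW_ind dW_SW]
  define R :: "unit + nat \<Rightarrow> 'b \<Rightarrow> real" where "R = case_sum (\<lambda>_ \<omega>. Z \<omega> 0) dW"
  have R: "N.indep_vars (\<lambda>_. borel) R ({()} <+> UNIV)"
    unfolding R_def by (rule joined) (auto simp: SZ_def SW_def)
  define K :: "nat \<Rightarrow> (unit + nat) set" where "K k = (case k of 0 \<Rightarrow> {Inl ()} | Suc k \<Rightarrow> {Inr k})" for k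
  define g where "g k x = (case k of 0 \<Rightarrow> x (Inl ()) | Suc k \<Rightarrow> sqrt (\<alpha> ^ 3 * \<sigma>\<^sup>2 + \<beta> ^ 3 * \<zeta>\<^sup>2) * x (Inr k) + c / real m)"
    for k and x :: "unit + nat \<Rightarrow> real"
  show ?thesis
  proof (rule N.indep_vars_blocks[OF R, where K = K and g = g])
    show "K k \<subseteq> {()} <+> UNIV" for k by (cases k) (auto simp: K_def)
    show "disjoint_family_on K UNIV" unfolding disjoint_family_on_def
      by (auto simp: K_def split: nat.splits)
    show "g k \<in> borel_measurable (Pi\<^sub>M (K k) (\<lambda>_. borel))" for k
    proof (cases k)
      case 0
      have "(\<lambda>x. x (Inl ())) \<in> borel_measurable (Pi\<^sub>M (K k) (\<lambda>_. borel))"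
        by (rule measurable_component_singleton) (simp add: K_def 0)
      then show ?thesis unfolding g_def 0 nat.case .
    next
      case (Suc l)
      have "(\<lambda>x. x (Inr l)) \<in> borel_measurable (Pi\<^sub>M (K k) (\<lambda>_. borel))"
        by (rule measurable_component_singleton) (simp add: K_def Suc)
      then show ?thesis unfolding g_def Suc nat.case
        by (intro borel_measurable_add borel_measurable_times borel_measurable_const)
    qed
    show "limit_increment W Z m k \<omega> = g k (restrict (\<lambda>i. R i \<omega>) (K k))" for k \<omega>
      by (cases k) (auto simp: limit_increment_def g_def K_def R_def dW_def)
  qed
qed

text \<open>A statement about one path: the equation holds exactly, so the comparison runs with
  equation error 0, and uniform continuity of the driving path on \<open>{0..T}\<close> controls its
  oscillation over a cell.\<close>

lemma limit_euler_converges: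
  assumes W0: "W \<omega> 0 = 0" and Wc: "continuous_on {0..} (W \<omega>)" and Zc: "continuous_on {0..} (Z \<omega>)"
    and eq: "\<And>t. 0 \<le> t \<Longrightarrow> Z \<omega> t = Z \<omega> 0 + sqrt (\<alpha> ^ 3 * \<sigma>\<^sup>2 + \<beta> ^ 3 * \<zeta>\<^sup>2) * W \<omega> t + c * t
        - \<theta> * integral {0..t} (\<lambda>u. max (Z \<omega> u) 0) + \<gamma> * integral {0..t} (\<lambda>u. max (- Z \<omega> u) 0)"
    and T: "0 \<le> T" and e: "0 < e"
  shows "eventually (\<lambda>m. \<forall>t\<in>{0..T}. \<bar>euler_path drift m (\<lambda>k. limit_increment W Z m k \<omega>) t - Z \<omega> t\<bar> \<le> e) sequentially"
proof -
  define s where "s = sqrt (\<alpha> ^ 3 * \<sigma>\<^sup>2 + \<beta> ^ 3 * \<zeta>\<^sup>2)"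
  define w where "w t = Z \<omega> 0 + s * W \<omega> t + c * t" for t
  define L where "L = \<theta> + \<gamma>"
  have L: "0 < L" using \<theta>_pos \<gamma>_pos by (simp add: L_def)
  have cad: "cadlag (Z \<omega>)" by (rule cadlag_continuous_on[OF Zc])
  obtain R where R: "0 \<le> R" "\<And>t. t \<in> {0..T} \<Longrightarrow> \<bar>Z \<omega> t\<bar> \<le> R" using cadlag_bounded[OF cad, of T] by blast
  \<comment> \<open>Oscillation and unfinished cell cost \<open>e1\<close> each, and the comparison
    multiplies their sum by \<open>2 * exp (2 * L * T)\<close>.\<close>
  define e1 where "e1 = e / (4 * exp (2 * L * T))"
  have e1: "0 < e1" using e by (simp add: e1_def)
  have "continuous_on {0..T} w" unfolding w_def
    by (intro continuous_intros continuous_on_subset[OF Wc]) auto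
  then have "uniformly_continuous_on {0..T} w" by (intro compact_uniformly_continuous) auto
  then obtain d where d: "0 < d" "\<And>x y. x \<in> {0..T} \<Longrightarrow> y \<in> {0..T} \<Longrightarrow> dist y x < d \<Longrightarrow> dist (w y) (w x) < e1"
    using e1 unfolding uniformly_continuous_on_def by metis
  have small: "eventually (\<lambda>m. y * (1 / real m) < z) sequentially" if "0 < z" for y z :: real
  proof -
    have "(\<lambda>m. y * (1 / real m)) \<longlonglongrightarrow> y * 0" by (intro tendsto_intros lim_1_over_n)
    then show ?thesis using that by (intro order_tendstoD(2)) auto
  qed
  show ?thesis using small[OF d(1), of 1] small[OF e1, of "L * R"] eventually_gt_at_top[of 0]
  proof eventually_elim
    case (elim m)
    show ?case
    proof
      fix t assume t: "t \<in> {0..T}"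
      have "\<bar>Z \<omega> t - euler_path drift m (\<lambda>k. limit_increment W Z m k \<omega>) t\<bar> \<le> 2 * (0 + e1 + L * R / real m) * exp (2 * L * T)"
      proof (rule euler_path_close[OF cad _ L drift_lipschitz'[OF order_refl, folded L_def] drift_0 R(2), where w = w])
        show "0 < m" using elim by simp
        show "\<bar>Z \<omega> a - w a - integral {0..a} (\<lambda>z. drift (Z \<omega> z))\<bar> \<le> 0" if "a \<in> {0..T}" for a
          unfolding integral_drift[OF cad] using eq[of a] that by (simp add: w_def s_def)
        show "\<bar>w a - w (real (nat \<lfloor>real m * a\<rfloor>) / real m)\<bar> \<le> e1" if a: "a \<in> {0..T}" for a
        proof -
          define q where "q = real (nat \<lfloor>real m * a\<rfloor>) / real m"
          have q: "q \<le> a" "a < q + 1 / real m" "0 \<le> q" using grid_point_bounds[of m a, OF _ _ refl] a elim by (auto simp: q_def)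
          have "dist a q < d" using q elim(1) by (simp add: dist_real_def)
          then have "dist (w a) (w q) < e1" using d(2)[of q a] a q by auto
          then show ?thesis by (simp add: q_def dist_real_def)
        qed
        show "w (real k / real m) = (\<Sum>i\<le>k. limit_increment W Z m i \<omega>)" for k
        proof (induction k)
          case (Suc k)
          have "w (real (Suc k) / real m) = w (real k / real m) + limit_increment W Z m (Suc k) \<omega>"
            unfolding limit_increment_def nat.case w_def s_def[symmetric] by (simp add: algebra_simps add_divide_distrib)
          then show ?case using Suc by simp
        qed (simp add: w_def limit_increment_def W0)
      qed (use t in auto)
      also have "\<dots> \<le> 2 * (2 * e1) * exp (2 * L * T)" using elim(2) by (intro mult_right_mono) auto
      also have "\<dots> = e" by (simp add: e1_def)
      finally show "\<bar>euler_path drift m (\<lambda>k. limit_increment W Z m k \<omega>) t - Z \<omega> t\<bar> \<le> e" by (simp add: abs_minus_commute)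
    qed
  qed
qed

text \<open>The criterion \<open>weak_conv_D_approx\<close> is applied with the Euler paths of the
  queue and of the limit. For fixed mesh both are the same continuous function of independent
  sequences, which converge in law coordinate by coordinate; in the limit process the scheme
  converges along almost every path.\<close>

theorem diffusion_limit:
  fixes N :: "'b measure"
  assumes \<mu>: "real_distribution \<mu>"
    and init: "weak_conv_m (\<lambda>n. distr (M n) borel (\<lambda>\<omega>. real_of_int (X n \<omega> 0) / sqrt (real n))) \<mu>"
    and W: "standard_BM N W" and Z0: "distr N borel (\<lambda>\<omega>. Z \<omega> 0) = \<mu>"
    and ind: "prob_space.indep_set N (gen_sets N (\<lambda>\<omega>. Z \<omega> 0) borel)
       (gen_sets N (\<lambda>\<omega>. restrict (W \<omega>) {0..}) (Pi\<^sub>M {0..} (\<lambda>_. borel)))"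
    and Z_meas: "\<And>t. (\<lambda>\<omega>. Z \<omega> t) \<in> borel_measurable N"
    and Z_cont: "\<And>\<omega>. \<omega> \<in> space N \<Longrightarrow> continuous_on {0..} (Z \<omega>)"
    and Z_eq: "AE \<omega> in N. \<forall>t\<ge>0. Z \<omega> t = Z \<omega> 0 + sqrt (\<alpha> ^ 3 * \<sigma>\<^sup>2 + \<beta> ^ 3 * \<zeta>\<^sup>2) * W \<omega> t + c * t
        - \<theta> * integral {0..t} (\<lambda>u. max (Z \<omega> u) 0) + \<gamma> * integral {0..t} (\<lambda>u. max (- Z \<omega> u) 0)"
  shows "weak_conv_D M (\<lambda>n \<omega> t. real_of_int (X n \<omega> (real n * t)) / sqrt (real n)) N Z"
proof -
  interpret N: prob_space N using W by (simp add: standard_BM_def)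
  have X0m: "(\<lambda>\<omega>. real_of_int (X0 n \<omega>) / sqrt (real n)) \<in> borel_measurable (M n)" for n
    using X0_meas[of n] by measurable
  have Xm: "(\<lambda>\<omega>. real_of_int (X n \<omega> t) / sqrt (real n)) \<in> borel_measurable (M n)" for n t
    using X_meas[of n t] by measurable
  have "distr (M n) borel (\<lambda>\<omega>. real_of_int (X n \<omega> 0) / sqrt (real n)) = distr (M n) borel (\<lambda>\<omega>. real_of_int (X0 n \<omega>) / sqrt (real n))" for n
    by (rule distr_cong_AE[OF refl refl _ Xm X0m]) (use X_initial[of n] in \<open>eventually_elim, simp\<close>)
  then have init0: "weak_conv_m (\<lambda>n. distr (M n) borel (\<lambda>\<omega>. real_of_int (X0 n \<omega>) / sqrt (real n))) \<mu>"
    using init by simp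
  \<comment> \<open>The shift to \<open>Suc m\<close> avoids a zero number of steps per unit time,
    so that the approximating paths are cadlag for every index.\<close>
  define A where "A m n \<omega> = euler_path drift (Suc m) (\<lambda>k. increment (Suc m) n k \<omega>)" for m n \<omega>
  define A' where "A' m \<omega> = euler_path drift (Suc m) (\<lambda>k. limit_increment W Z (Suc m) k \<omega>)" for m \<omega>
  have inc_ind: "N.indep_vars (\<lambda>_. borel) (limit_increment W Z (Suc m)) UNIV" for m
    by (rule limit_increment_indep[where Z = Z, OF W Z_meas _ ind]) simp
  have g_cont: "(\<lambda>i. g (euler_path drift (Suc m) (vs i))) \<longlonglongrightarrow> g (euler_path drift (Suc m) v)"
    if "lipschitz_functional j B g" "\<And>k. (\<lambda>i. vs i k) \<longlonglongrightarrow> v k" for m j B g vs v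
    by (rule euler_functional[OF _ continuous_drift that]) simp
  have g_meas: "(\<lambda>v. g (euler_path drift (Suc m) v)) \<in> borel_measurable (Pi\<^sub>M UNIV (\<lambda>_. borel))"
    if "lipschitz_functional j B g" for m j B g
    by (rule sequentially_continuous_functional) (rule g_cont[OF that])
  show ?thesis
  proof (rule weak_conv_D_approx[OF prob N.prob_space_axioms, where A = A and A' = A'])
    fix n \<omega> assume w: "\<omega> \<in> space (M n)"
    show "cadlag (\<lambda>t. real_of_int (X n \<omega> (real n * t)) / sqrt (real n))"
    proof (cases "n = 0")
      case True
      then show ?thesis by (simp add: cadlag_continuous_on)
    next
      case False
      then show ?thesis
        by (intro cadlag_compose[OF cadlag_time_scale[OF X_cadlag[OF w]], of "real n" "\<lambda>z. z / sqrt (real n)"]) (auto intro!: continuous_intros)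
    qed
  next
    show "(\<lambda>\<omega>. real_of_int (X n \<omega> (real n * t)) / sqrt (real n)) \<in> borel_measurable (M n)" for n t by (rule Xm)
    show "cadlag (Z \<omega>)" if "\<omega> \<in> space N" for \<omega> by (rule cadlag_continuous_on[OF Z_cont[OF that]])
    show "(\<lambda>\<omega>. Z \<omega> t) \<in> borel_measurable N" for t by (rule Z_meas)
    show "cadlag (A m n \<omega>)" for m n \<omega> unfolding A_def by (rule cadlag_euler_path) simp
    show "cadlag (A' m \<omega>)" for m \<omega> unfolding A'_def by (rule cadlag_euler_path) simp
  next
    fix m n j B g assume g: "lipschitz_functional j B g"
    have "increment (Suc m) n k \<in> borel_measurable (M n)" for k
      using increment_indep[of n "Suc m"] prob[of n] by (auto simp: prob_space.indep_vars_def)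
    then have "(\<lambda>\<omega> k. increment (Suc m) n k \<omega>) \<in> measurable (M n) (Pi\<^sub>M UNIV (\<lambda>_. borel))"
      by (intro measurable_PiM_single') auto
    from measurable_compose[OF this g_meas[OF g]] show "(\<lambda>\<omega>. g (A m n \<omega>)) \<in> borel_measurable (M n)" unfolding A_def .
  next
    fix m j B g assume g: "lipschitz_functional j B g"
    have "limit_increment W Z (Suc m) k \<in> borel_measurable N" for k
      using inc_ind[of m] by (auto simp: N.indep_vars_def)
    then have "(\<lambda>\<omega> k. limit_increment W Z (Suc m) k \<omega>) \<in> measurable N (Pi\<^sub>M UNIV (\<lambda>_. borel))"
      by (intro measurable_PiM_single') auto
    from measurable_compose[OF this g_meas[OF g]] show "(\<lambda>\<omega>. g (A' m \<omega>)) \<in> borel_measurable N" unfolding A'_def .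
    show "(\<lambda>n. \<integral>\<omega>. g (A m n \<omega>) \<partial>M n) \<longlonglongrightarrow> (\<integral>\<omega>. g (A' m \<omega>) \<partial>N)"
      unfolding A_def A'_def
    proof (rule indep_sequences_weak_conv[OF prob N.prob_space_axioms increment_indep inc_ind _ g_meas[OF g] g_cont[OF g]])
      fix k
      show "weak_conv_m (\<lambda>n. distr (M n) borel (increment (Suc m) n k)) (distr N borel (limit_increment W Z (Suc m) k))"
      proof (cases k)
        case 0
        then have "increment (Suc m) n k = (\<lambda>\<omega>. real_of_int (X0 n \<omega>) / sqrt (real n))" for n
          by (simp add: increment_def fun_eq_iff)
        moreover have "limit_increment W Z (Suc m) k = (\<lambda>\<omega>. Z \<omega> 0)" using 0 by (simp add: limit_increment_def fun_eq_iff)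
        ultimately show ?thesis using init0 Z0 by simp
      next
        case (Suc l)
        have "limit_increment W Z (Suc m) k = (\<lambda>\<omega>. sqrt (\<alpha> ^ 3 * \<sigma>\<^sup>2 + \<beta> ^ 3 * \<zeta>\<^sup>2) *
            (W \<omega> (real (Suc l) / real (Suc m)) - W \<omega> (real l / real (Suc m))) + c / real (Suc m))"
          unfolding Suc by (rule ext) (simp only: limit_increment_def nat.case)
        then show ?thesis unfolding Suc using increment_weak_conv[OF W, of "Suc m" l] by (simp only: zero_less_Suc)
      qed
      show "\<bar>g (euler_path drift (Suc m) v)\<bar> \<le> B" for v
        by (rule lipschitz_functionalD(1)[OF g cadlag_euler_path]) simp
    qed
  next
    fix T e :: real assume "0 \<le> T" "0 < e"
    from eventually_compose_filterlim[OF euler_approximation[OF \<mu> init0 this] filterlim_Suc]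
    show "eventually (\<lambda>m. eventually (\<lambda>n. \<exists>G\<in>sets (M n). 1 - e \<le> measure (M n) G \<and>
       (\<forall>\<omega>\<in>G. \<forall>t\<in>{0..T}. \<bar>real_of_int (X n \<omega> (real n * t)) / sqrt (real n) - A m n \<omega> t\<bar> \<le> e)) sequentially) sequentially"
      unfolding whp_def A_def scaled_queue_def .
  next
    have "AE \<omega> in N. W \<omega> 0 = 0 \<and> continuous_on {0..} (W \<omega>)" using W by (simp add: standard_BM_def)
    then show "AE \<omega> in N. \<forall>T\<ge>0. \<forall>e>0. eventually (\<lambda>m. \<forall>t\<in>{0..T}. \<bar>A' m \<omega> t - Z \<omega> t\<bar> \<le> e) sequentially"
      using Z_eq AE_space
    proof eventually_elim
      case (elim \<omega>)
      show ?case unfolding A'_def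
      proof (intro allI impI)
        fix T e :: real assume "0 \<le> T" "0 < e"
        have "eventually (\<lambda>m. \<forall>t\<in>{0..T}. \<bar>euler_path drift m (\<lambda>k. limit_increment W Z m k \<omega>) t - Z \<omega> t\<bar> \<le> e) sequentially"
          using elim(1) Z_cont[OF elim(3)] elim(2)[rule_format] \<open>0 \<le> T\<close> \<open>0 < e\<close>
          by (intro limit_euler_converges; blast)
        from eventually_compose_filterlim[OF this filterlim_Suc]
        show "eventually (\<lambda>m. \<forall>t\<in>{0..T}. \<bar>euler_path drift (Suc m) (\<lambda>k. limit_increment W Z (Suc m) k \<omega>) t - Z \<omega> t\<bar> \<le> e) sequentially" .
      qed
    qed
  qed
qed

end

theorem theorem3:
  fixes M :: "nat \<Rightarrow> 'a measure"
    and U V :: "nat \<Rightarrow> nat \<Rightarrow> 'a \<Rightarrow> real"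
    and Nsr Nbr :: "nat \<Rightarrow> 'a \<Rightarrow> real \<Rightarrow> nat"
    and X0 :: "nat \<Rightarrow> 'a \<Rightarrow> int"
    and X :: "nat \<Rightarrow> 'a \<Rightarrow> real \<Rightarrow> int"
    and \<alpha>n \<beta>n \<sigma>n \<zeta>n \<theta>n \<gamma>n :: "nat \<Rightarrow> real"
    and \<alpha> \<beta> \<sigma> \<zeta> \<theta> \<gamma> c :: real
  assumes prob: "\<And>n. prob_space (M n)"
    and U_iid: "\<And>n. prob_space.indep_vars (M n) (\<lambda>_. borel) (U n) {1..}"
    and U_id: "\<And>n k. k \<ge> 1 \<Longrightarrow> distr (M n) borel (U n k) = distr (M n) borel (U n 1)"
    and V_iid: "\<And>n. prob_space.indep_vars (M n) (\<lambda>_. borel) (V n) {1..}"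
    and V_id: "\<And>n k. k \<ge> 1 \<Longrightarrow> distr (M n) borel (V n k) = distr (M n) borel (V n 1)"
    and U_sq: "\<And>n. integrable (M n) (\<lambda>\<omega>. (U n 1 \<omega>)\<^sup>2)"
    and V_sq: "\<And>n. integrable (M n) (\<lambda>\<omega>. (V n 1 \<omega>)\<^sup>2)"
    and U_mean: "\<And>n. (\<integral>\<omega>. U n 1 \<omega> \<partial>M n) = 1 / \<alpha>n n"
    and V_mean: "\<And>n. (\<integral>\<omega>. V n 1 \<omega> \<partial>M n) = 1 / \<beta>n n"
    and U_sd: "\<And>n. \<sigma>n n = sqrt (prob_space.variance (M n) (U n 1))"
    and V_sd: "\<And>n. \<zeta>n n = sqrt (prob_space.variance (M n) (V n 1))"
    and U_pos: "\<And>n. measure (M n) {\<omega> \<in> space (M n). U n 1 \<omega> > 0} = 1"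
    and V_pos: "\<And>n. measure (M n) {\<omega> \<in> space (M n). V n 1 \<omega> > 0} = 1"
    and U_ui: "((\<lambda>K::real. \<Squnion>n. \<integral>\<^sup>+\<omega>. (if (U n 1 \<omega>)\<^sup>2 > K then ennreal ((U n 1 \<omega>)\<^sup>2) else 0) \<partial>M n)
                  \<longlongrightarrow> 0) at_top"
    and V_ui: "((\<lambda>K::real. \<Squnion>n. \<integral>\<^sup>+\<omega>. (if (V n 1 \<omega>)\<^sup>2 > K then ennreal ((V n 1 \<omega>)\<^sup>2) else 0) \<partial>M n)
                  \<longlongrightarrow> 0) at_top"
    and Psr: "\<And>n. unit_poisson_process (M n) (Nsr n)"
    and Pbr: "\<And>n. unit_poisson_process (M n) (Nbr n)"
    and X0_meas: "\<And>n. X0 n \<in> measurable (M n) (count_space UNIV)"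
    and indep: "\<And>n. prob_space.indep_sets (M n)
        (\<lambda>i::nat. if i = 0 then gen_sets (M n) (\<lambda>\<omega> k. U n k \<omega>) (Pi\<^sub>M UNIV (\<lambda>_. borel))
              else if i = 1 then gen_sets (M n) (\<lambda>\<omega> k. V n k \<omega>) (Pi\<^sub>M UNIV (\<lambda>_. borel))
              else if i = 2 then gen_sets (M n) (\<lambda>\<omega> t. real (Nsr n \<omega> t)) (Pi\<^sub>M UNIV (\<lambda>_. borel))
              else if i = 3 then gen_sets (M n) (\<lambda>\<omega> t. real (Nbr n \<omega> t)) (Pi\<^sub>M UNIV (\<lambda>_. borel))
              else gen_sets (M n) (X0 n) (count_space UNIV))
        {0..4}"
    and \<theta>n_pos: "\<And>n. \<theta>n n > 0"
    and \<gamma>n_pos: "\<And>n. \<gamma>n n > 0"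
    and X_meas: "\<And>n t. (\<lambda>\<omega>. X n \<omega> t) \<in> measurable (M n) (count_space UNIV)"
    and X_cadlag: "\<And>n \<omega>. \<omega> \<in> space (M n) \<Longrightarrow> cadlag (\<lambda>t. real_of_int (X n \<omega> t))"
    and X_eq: "\<And>n. AE \<omega> in M n. \<forall>t\<ge>0. X n \<omega> t =
        X0 n \<omega> + int (renewal_count (\<lambda>k. U n k \<omega>) t) - int (renewal_count (\<lambda>k. V n k \<omega>) t)
        - int (Nsr n \<omega> (\<theta>n n * integral {0..t} (\<lambda>s. real_of_int (max (X n \<omega> s) 0))))
        + int (Nbr n \<omega> (\<gamma>n n * integral {0..t} (\<lambda>s. real_of_int (max (- X n \<omega> s) 0))))"
    and \<alpha>_lim: "\<alpha>n \<longlonglongrightarrow> \<alpha>" and \<beta>_lim: "\<beta>n \<longlonglongrightarrow> \<beta>"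
    and \<sigma>_lim: "\<sigma>n \<longlonglongrightarrow> \<sigma>" and \<zeta>_lim: "\<zeta>n \<longlonglongrightarrow> \<zeta>"
    and pos: "\<alpha> > 0" "\<beta> > 0" "\<sigma> > 0" "\<zeta> > 0"
    and \<theta>_lim: "(\<lambda>n. real n * \<theta>n n) \<longlonglongrightarrow> \<theta>" and \<theta>_pos: "\<theta> > 0"
    and \<gamma>_lim: "(\<lambda>n. real n * \<gamma>n n) \<longlonglongrightarrow> \<gamma>" and \<gamma>_pos: "\<gamma> > 0"
    and init_fluid: "(\<lambda>n. \<integral>\<^sup>+\<omega>. ennreal (\<bar>real_of_int (X n \<omega> 0)\<bar> / real n) \<partial>M n) \<longlonglongrightarrow> 0"
    and diff_lim: "(\<lambda>n. sqrt (real n) * (\<alpha>n n - \<beta>n n)) \<longlonglongrightarrow> c"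
  shows "(\<forall>x :: real \<Rightarrow> real. continuous_on {0..} x \<longrightarrow>
            ((\<forall>t\<ge>0. x t = (\<alpha> - \<beta>) * t - \<theta> * integral {0..t} (\<lambda>s. max (x s) 0)
                               + \<gamma> * integral {0..t} (\<lambda>s. max (- x s) 0))
             \<longleftrightarrow> (\<forall>t\<ge>0. x t = 0)))
       \<and> (\<forall>\<mu>. real_distribution \<mu> \<and>
              weak_conv_m (\<lambda>n. distr (M n) borel (\<lambda>\<omega>. real_of_int (X n \<omega> 0) / sqrt (real n))) \<mu> \<longrightarrow>
            (\<forall>(N :: 'b measure) W Z. standard_BM N W \<and>
               distr N borel (\<lambda>\<omega>. Z \<omega> 0) = \<mu> \<and>
               prob_space.indep_set N (gen_sets N (\<lambda>\<omega>. Z \<omega> 0) borel)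
                  (gen_sets N (\<lambda>\<omega>. restrict (W \<omega>) {0..}) (Pi\<^sub>M {0..} (\<lambda>_. borel))) \<and>
               (\<forall>t. (\<lambda>\<omega>. Z \<omega> t) \<in> borel_measurable N) \<and>
               (\<forall>\<omega>\<in>space N. continuous_on {0..} (Z \<omega>)) \<and>
               (AE \<omega> in N. \<forall>t\<ge>0. Z \<omega> t = Z \<omega> 0
                   + sqrt (\<alpha> ^ 3 * \<sigma>\<^sup>2 + \<beta> ^ 3 * \<zeta>\<^sup>2) * W \<omega> t + c * t
                   - \<theta> * integral {0..t} (\<lambda>u. max (Z \<omega> u) 0)
                   + \<gamma> * integral {0..t} (\<lambda>u. max (- Z \<omega> u) 0))
             \<longrightarrow> weak_conv_D M (\<lambda>n \<omega> t. real_of_int (X n \<omega> (real n * t)) / sqrt (real n)) N Z))"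
proof -
  interpret double_ended_queue M U V \<alpha>n \<beta>n \<sigma>n \<zeta>n \<alpha> \<beta> \<sigma> \<zeta> Nsr Nbr X0 X \<theta>n \<gamma>n \<theta> \<gamma> c
    by (intro double_ended_queue.intro arrivals.intro double_ended_queue_axioms.intro) (fact assms)+
  show ?thesis (is "?fluid \<and> ?diffusion")
  proof
    show ?fluid by (intro allI impI fluid_limit_zero)
    show ?diffusion
    proof (intro allI impI, elim conjE)
      fix \<mu> and N :: "'b measure" and W Z
    assume "real_distribution \<mu>"
      "weak_conv_m (\<lambda>n. distr (M n) borel (\<lambda>\<omega>. real_of_int (X n \<omega> 0) / sqrt (real n))) \<mu>"
      "standard_BM N W" "distr N borel (\<lambda>\<omega>. Z \<omega> 0) = \<mu>"
      "prob_space.indep_set N (gen_sets N (\<lambda>\<omega>. Z \<omega> 0) borel)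
         (gen_sets N (\<lambda>\<omega>. restrict (W \<omega>) {0..}) (Pi\<^sub>M {0..} (\<lambda>_. borel)))"
      and Z: "\<forall>t. (\<lambda>\<omega>. Z \<omega> t) \<in> borel_measurable N" "\<forall>\<omega>\<in>space N. continuous_on {0..} (Z \<omega>)"
      and Z_eq: "AE \<omega> in N. \<forall>t\<ge>0. Z \<omega> t = Z \<omega> 0
           + sqrt (\<alpha> ^ 3 * \<sigma>\<^sup>2 + \<beta> ^ 3 * \<zeta>\<^sup>2) * W \<omega> t + c * t
           - \<theta> * integral {0..t} (\<lambda>u. max (Z \<omega> u) 0)
           + \<gamma> * integral {0..t} (\<lambda>u. max (- Z \<omega> u) 0)"
    then show "weak_conv_D M (\<lambda>n \<omega> t. real_of_int (X n \<omega> (real n * t)) / sqrt (real n)) N Z"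
      by (intro diffusion_limit[OF _ _ _ _ _ Z(1)[rule_format] Z(2)[rule_format] Z_eq])
    qed
  qed
qed


end
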